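(* For $n\ge2$ let $$G_n=\langle x_1,\dots,x_n,y_1,\dots,y_{n-1}\mid [x_i,x_n]=y_i\ (1\le i\le n-1),\ \text{all other commutators trivial}\rangle.$$ Then for all primes $p$, $$\zeta^{\triangleleft}_{G_n,p}(s)=\zeta_{\mathbb Z_p^n}(s)\,\zeta_p\big((2n-1)s-n(n-1)\big)\,F_{n-1}(p^{-1},\mathbf X),$$ where $\mathbf X=(X_1,\dots,X_{n-2})$ with $X_i=p^{-(2(n-i)-1)s+(n+i)(n-i-1)}$ for $1\le i\le n-2$. In particular, $$\zeta^{\triangleleft}_{G_n,p}(s)\big|_{p\to p^{-1}}=-p^{\binom{2n-1}{2}-(3n-1)s}\,\zeta^{\triangleleft}_{G_n,p}(s).$$
   Context: $\zeta^{\triangleleft}_{G,p}(s)=\sum_{k\ge0}a_{p^k}p^{-ks}$ with $a_m$ the number of normal subgroups of $G$ of index $m$. $\zeta_p(s)=(1-p^{-s})^{-1}$ and $\zeta_{\mathbb Z_p^n}(s)=\prod_{i=0}^{n-1}\zeta_p(s-i)$. For $m\ge2$, $F_m(q,\mathbf X)=\sum_{I\subseteq\{1,\dots,m-1\}}b_I(q)\prod_{i\in I}\frac{X_i}{1-X_i}$, where $b_I(q)\in\mathbb Z[q]$ is the number of flags of type $I$ in $\mathbb F_q^m$ (chains of subspaces $V_{i_1}>\dots>V_{i_l}$ with $\operatorname{codim}V_i=i$, $I=\{i_1<\dots<i_l\}$), and $b_I(p^{-1})$ means this polynomial evaluated at $p^{-1}$. The symbol $|_{p\to p^{-1}}$ means: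 writing $\zeta^{\triangleleft}_{G_n,p}(s)=V(p,p^{-s})$ with $V$ a rational function, replace it by $V(p^{-1},p^{s})$. *)

theory Defs
  imports "HOL-Algebra.Coset" "HOL-Computational_Algebra.Polynomial"
          "HOL-Computational_Algebra.Primes" "HOL-Library.FuncSet" "HOL-Analysis.Complex_Transcendental"
begin

text \<open>Concrete model of
  G_n = < x_1..x_n, y_1..y_(n-1) | [x_i,x_n] = y_i (1 <= i <= n-1), all other commutators trivial >.
  Elements are pairs (a,b), a : {1..n} -> int, b : {1..n-1} -> int, standing for
  x_1^(a_1) ... x_n^(a_n) y_1^(b_1) ... y_(n-1)^(b_(n-1)); multiplication is
  (a,b)(a',b') = (a+a', b+b'+beta(a,a')) with beta(a,a')_j = a_j * a'_n.
  With x_i = (e_i,0), y_j = (0,e_j) and [g,h] = g^-1 h^-1 g h one gets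
  [x_i,x_n] = y_i, all other commutators of generators trivial.\<close>

definition Gn :: "nat \<Rightarrow> ((nat \<Rightarrow> int) \<times> (nat \<Rightarrow> int)) monoid" where
  "Gn n = \<lparr> carrier = extensional {1..n} \<times> extensional {1..n-1},
            monoid.mult = (\<lambda>g h. ((\<lambda>i\<in>{1..n}. fst g i + fst h i),
                             (\<lambda>j\<in>{1..n-1}. snd g j + snd h j + fst g j * fst h n))),
            monoid.one = ((\<lambda>i\<in>{1..n}. 0), (\<lambda>j\<in>{1..n-1}. 0)) \<rparr>"

definition normal_index_count :: "('a, 'b) monoid_scheme \<Rightarrow> nat \<Rightarrow> nat" where
  "normal_index_count G m = card {H. H \<lhd> G \<and> card (rcosets\<^bsub>G\<^esub> H) = m}"

definition vecs :: "nat \<Rightarrow> nat \<Rightarrow> (nat \<Rightarrow> nat) set" where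
  "vecs q m = {0..<m} \<rightarrow>\<^sub>E {0..<q}"

definition vzero :: "nat \<Rightarrow> (nat \<Rightarrow> nat)" where
  "vzero m = (\<lambda>j\<in>{0..<m}. 0)"

definition vadd :: "nat \<Rightarrow> nat \<Rightarrow> (nat \<Rightarrow> nat) \<Rightarrow> (nat \<Rightarrow> nat) \<Rightarrow> (nat \<Rightarrow> nat)" where
  "vadd q m v w = (\<lambda>j\<in>{0..<m}. (v j + w j) mod q)"

definition vsmult :: "nat \<Rightarrow> nat \<Rightarrow> nat \<Rightarrow> (nat \<Rightarrow> nat) \<Rightarrow> (nat \<Rightarrow> nat)" where
  "vsmult q m c v = (\<lambda>j\<in>{0..<m}. (c * v j) mod q)"

definition lincomb :: "nat \<Rightarrow> nat \<Rightarrow> nat list \<Rightarrow> (nat \<Rightarrow> nat) list \<Rightarrow> (nat \<Rightarrow> nat)" where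
  "lincomb q m cs vs = (\<lambda>j\<in>{0..<m}. (\<Sum>k<length vs. cs ! k * (vs ! k) j) mod q)"

definition span_mod :: "nat \<Rightarrow> nat \<Rightarrow> (nat \<Rightarrow> nat) list \<Rightarrow> (nat \<Rightarrow> nat) set" where
  "span_mod q m vs = {lincomb q m cs vs | cs. length cs = length vs \<and> set cs \<subseteq> {0..<q}}"

definition lin_indep_mod :: "nat \<Rightarrow> nat \<Rightarrow> (nat \<Rightarrow> nat) list \<Rightarrow> bool" where
  "lin_indep_mod q m vs \<longleftrightarrow>
     (\<forall>cs. length cs = length vs \<and> set cs \<subseteq> {0..<q} \<and> lincomb q m cs vs = vzero m
            \<longrightarrow> set cs \<subseteq> {0})"

definition subspace_mod :: "nat \<Rightarrow> nat \<Rightarrow> (nat \<Rightarrow> nat) set \<Rightarrow> bool" where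
  "subspace_mod q m W \<longleftrightarrow> W \<subseteq> vecs q m \<and> vzero m \<in> W \<and>
     (\<forall>v\<in>W. \<forall>w\<in>W. vadd q m v w \<in> W) \<and> (\<forall>c<q. \<forall>v\<in>W. vsmult q m c v \<in> W)"

definition has_dim :: "nat \<Rightarrow> nat \<Rightarrow> (nat \<Rightarrow> nat) set \<Rightarrow> nat \<Rightarrow> bool" where
  "has_dim q m W d \<longleftrightarrow>
     (\<exists>vs. length vs = d \<and> set vs \<subseteq> W \<and> lin_indep_mod q m vs \<and> span_mod q m vs = W)"

definition flags :: "nat \<Rightarrow> nat \<Rightarrow> nat set \<Rightarrow> (nat \<Rightarrow> (nat \<Rightarrow> nat) set) set" where
  "flags q m I = {f \<in> I \<rightarrow>\<^sub>E Pow (vecs q m).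
      (\<forall>i\<in>I. subspace_mod q m (f i) \<and> i \<le> m \<and> has_dim q m (f i) (m - i)) \<and>
      (\<forall>i\<in>I. \<forall>j\<in>I. i < j \<longrightarrow> f j \<subset> f i)}"

definition flag_count :: "nat \<Rightarrow> nat \<Rightarrow> nat set \<Rightarrow> nat" where
  "flag_count q m I = card (flags q m I)"

definition bpoly :: "nat \<Rightarrow> nat set \<Rightarrow> int poly" where
  "bpoly m I = (THE P. \<forall>q. prime q \<longrightarrow> poly P (int q) = int (flag_count q m I))"

definition Ffun :: "nat \<Rightarrow> complex \<Rightarrow> (nat \<Rightarrow> complex) \<Rightarrow> complex" where
  "Ffun m c X = (\<Sum>I\<in>Pow {1..m-1}.
       poly (map_poly of_int (bpoly m I)) c * (\<Prod>i\<in>I. X i / (1 - X i)))"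

section \<open>The rational function V(q,t) with zeta = V(p, p^-s)\<close>

definition Xfun :: "nat \<Rightarrow> complex \<Rightarrow> complex \<Rightarrow> nat \<Rightarrow> complex" where
  "Xfun n q t i = q ^ ((n + i) * (n - i - 1)) * t ^ (2 * (n - i) - 1)"

definition Vn :: "nat \<Rightarrow> complex \<Rightarrow> complex \<Rightarrow> complex" where
  "Vn n q t = (\<Prod>i<n. 1 / (1 - q ^ i * t)) * (1 / (1 - q ^ (n * (n - 1)) * t ^ (2 * n - 1)))
              * Ffun (n - 1) (1 / q) (Xfun n q t)"

definition Vn_defined :: "nat \<Rightarrow> complex \<Rightarrow> complex \<Rightarrow> bool" where
  "Vn_defined n q t \<longleftrightarrow> q \<noteq> 0 \<and> t \<noteq> 0 \<and> (\<forall>i<n. q ^ i * t \<noteq> 1) \<and>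
     q ^ (n * (n - 1)) * t ^ (2 * n - 1) \<noteq> 1 \<and> (\<forall>i\<in>{1..n-2}. Xfun n q t i \<noteq> 1)"

end

theory Submission
  imports Defs "HOL-Library.Function_Algebras" "HOL-Analysis.FPS_Convergence"
begin

text \<open>
  Put \<open>m = n - 1\<close>. A normal subgroup \<open>H\<close> meets the centre \<open>\<int>\<^sup>m\<close> in a lattice \<open>M\<close>, and normality says that
  the image of \<open>H\<close> in \<open>\<int>\<^sup>n\<close> lies in \<open>M \<oplus> e \<int>\<close>, where \<open>e\<close> is the exponent of \<open>\<int>\<^sup>m / M\<close>. On such \<open>H\<close> the
  commutator form takes values in \<open>M\<close>, so \<open>H\<close> is an additive subgroup of \<open>\<int>\<^sup>2\<^sup>n\<^sup>-\<^sup>1\<close> with the same cosets.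
  Adding the \<open>n\<close> noncentral coordinates one at a time gives \<open>|\<int>\<^sup>m : M|\<^sup>n\<close> times the coefficients of
  \<open>\<Prod>\<^sub>i 1 / (1 - p\<^sup>i t)\<close> for the number of \<open>H\<close> over \<open>M\<close>, and it remains to sum
  \<open>|\<int>\<^sup>m : M|\<^sup>n t\<^sup>2\<^sup>a\<^sup>+\<^sup>b\<close> over all \<open>M\<close> of index \<open>p\<^sup>a\<close> and exponent \<open>p\<^sup>b\<close>.

  For this sum pass from \<open>M\<close> to \<open>N = {v. p v \<in> M}\<close>, which lowers the exponent by one step. The \<open>M\<close> over a
  given \<open>N\<close> are the subspaces of \<open>N / p N\<close> meeting a fixed subspace trivially, so their number is a Gaussian
  binomial coefficient times a power of \<open>p\<close>. The resulting triangular recursion is the transpose of the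
  recursion \<open>F\<^sub>m = 1 + \<Sum>\<^sub>j [m choose j] X\<^sub>j / (1 - X\<^sub>j) F\<^sub>j\<close>, obtained by splitting flags at their smallest
  member. The functional equation of \<open>F\<^sub>m\<close> is Gaussian inversion applied to the same recursion.
\<close>

section \<open>Additive subgroups and their indices\<close>

text \<open>The exponents of X_k come from one passage between M and N. Let k be the dimension of M
  / p N and d the dimension that belongs in the same way to N. From N to M the index grows by
  p^(m-k) and the exponent by one step, which gives t^(2(m-k)+1); the weight, an (m+1)-st power of
  the index, gives p^((m-k)(m+1)). The number of M over N is a binomial at p times p^(k(m-d)), which
  depends on d. Rewriting the binomial at 1/p releases p^(k(d-k)), and k(d-k) + k(m-d) = k(m-k) is
  free of d. What remains is X_k times a binomial at 1/p: this is why F is evaluated at p^(-1). The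
  diagonal term d = k turns X_k into X_k / (1 - X_k). The index k = 0, absent from F, contributes 1
  / (1 - X_0), the separate zeta factor.

  All identities are formal in t. They become analytic only at the end, by expanding a rational
  function at t = 0, so the counts need no estimate.\<close>

definition add_subgrp :: "'a::ab_group_add set \<Rightarrow> bool" where
  "add_subgrp S \<longleftrightarrow> 0 \<in> S \<and> (\<forall>x\<in>S. \<forall>y\<in>S. x - y \<in> S)"

definition add_coset :: "'a::ab_group_add set \<Rightarrow> 'a \<Rightarrow> 'a set" where
  "add_coset S x = {y. y - x \<in> S}"

text \<open>The value 0 stands for an infinite index, so \<open>idx T S > 0\<close> carries
  finiteness.\<close>

definition idx :: "'a::ab_group_add set \<Rightarrow> 'a set \<Rightarrow> nat" where
  "idx T S = card (add_coset S ` T)"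

definition sumset :: "'a::ab_group_add set \<Rightarrow> 'a set \<Rightarrow> 'a set" where
  "sumset A B = {a + b | a b. a \<in> A \<and> b \<in> B}"

lemma add_subgrp_0: "add_subgrp S \<Longrightarrow> 0 \<in> S"
  by (simp add: add_subgrp_def)

lemma add_subgrp_diff: "add_subgrp S \<Longrightarrow> x \<in> S \<Longrightarrow> y \<in> S \<Longrightarrow> x - y \<in> S"
  by (simp add: add_subgrp_def)

lemma add_subgrp_uminus: "add_subgrp S \<Longrightarrow> x \<in> S \<Longrightarrow> - x \<in> S"
  using add_subgrp_diff[of S 0 x] by (simp add: add_subgrp_0)

lemma add_subgrp_add: "add_subgrp S \<Longrightarrow> x \<in> S \<Longrightarrow> y \<in> S \<Longrightarrow> x + y \<in> S"
  using add_subgrp_diff[of S x "- y"] by (simp add: add_subgrp_uminus)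

lemma add_subgrp_add_iff: "add_subgrp S \<Longrightarrow> x \<in> S \<Longrightarrow> x + y \<in> S \<longleftrightarrow> y \<in> S"
  using add_subgrp_add[of S x y] add_subgrp_diff[of S "x + y" x] by auto

lemma add_subgrp_Int: "add_subgrp S \<Longrightarrow> add_subgrp T \<Longrightarrow> add_subgrp (S \<inter> T)"
  by (auto simp: add_subgrp_def)

lemma add_subgrp_scale_nat:
  fixes x :: "'a::ring_1"
  shows "add_subgrp S \<Longrightarrow> x \<in> S \<Longrightarrow> of_nat k * x \<in> S"
  by (induction k) (auto simp: add_subgrp_0 algebra_simps intro: add_subgrp_add)

lemma add_subgrp_scale:
  fixes x :: "'a::ring_1"
  assumes "add_subgrp S" "x \<in> S"
  shows "of_int k * x \<in> S"
proof (cases k)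
  case (nonneg n)
  then show ?thesis using add_subgrp_scale_nat[OF assms, of n] by simp
next
  case (neg n)
  then show ?thesis
    using add_subgrp_uminus[OF assms(1) add_subgrp_scale_nat[OF assms, of "Suc n"]]
    by (simp add: left_diff_distrib distrib_right)
qed

lemma add_coset_eq_iff:
  assumes "add_subgrp S"
  shows "add_coset S x = add_coset S y \<longleftrightarrow> x - y \<in> S"
proof
  assume "add_coset S x = add_coset S y"
  moreover have "x \<in> add_coset S x" using assms by (simp add: add_coset_def add_subgrp_0)
  ultimately show "x - y \<in> S" by (auto simp: add_coset_def)
next
  assume h: "x - y \<in> S"
  have "z - x \<in> S \<longleftrightarrow> z - y \<in> S" for z
    using add_subgrp_add[OF assms _ h, of "z - x"] add_subgrp_diff[OF assms _ h, of "z - y"] by auto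
  then show "add_coset S x = add_coset S y" by (auto simp: add_coset_def)
qed

text \<open>Sending \<open>f x\<close> to \<open>g x\<close> is a bijection between the two images.
  It covers infinite images too, which is why the index laws below need no finiteness
  assumption.\<close>

lemma card_image_cong_kernel:
  assumes "\<And>x y. x \<in> A \<Longrightarrow> y \<in> A \<Longrightarrow> f x = f y \<longleftrightarrow> g x = g y"
  shows "card (f ` A) = card (g ` A)"
proof -
  define h where "h = (\<lambda>z. g (SOME x. x \<in> A \<and> f x = z))"
  have h: "h (f x) = g x" if "x \<in> A" for x
  proof -
    have "(SOME y. y \<in> A \<and> f y = f x) \<in> A \<and> f (SOME y. y \<in> A \<and> f y = f x) = f x"
      by (rule someI[of _ x]) (use that in auto)
    then show ?thesis using assms that unfolding h_def by blast
  qed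
  have "inj_on h (f ` A)" by (auto simp: inj_on_def h assms)
  moreover have "h ` f ` A = g ` A" by (auto simp: h image_iff)
  ultimately show ?thesis by (metis card_image)
qed

text \<open>Tower law without quotient groups: with a representative \<open>r x\<close> chosen for
  every S-coset, the P-coset of x carries the same information as the S-coset of x together with the
  P-coset of \<open>x - r x\<close>, and every such pair occurs.\<close>

lemma idx_mult:
  assumes P: "add_subgrp P" and S: "add_subgrp S" and T: "add_subgrp T"
    and PS: "P \<subseteq> S" and ST: "S \<subseteq> T"
  shows "idx T P = idx T S * idx S P"
proof -
  define r where "r = (\<lambda>x. SOME y. y \<in> T \<and> add_coset S y = add_coset S x)"
  have r: "r x \<in> T" "x - r x \<in> S" if "x \<in> T" for x
  proof -
    have *: "r x \<in> T \<and> add_coset S (r x) = add_coset S x"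
      unfolding r_def by (rule someI[of _ x]) (use that in auto)
    then show "r x \<in> T" by simp
    show "x - r x \<in> S" using * add_coset_eq_iff[OF S, of x "r x"] by simp
  qed
  have r_cong: "r x = r y" if "add_coset S x = add_coset S y" for x y
    using that by (simp add: r_def)
  let ?f = "\<lambda>x. (add_coset S x, add_coset P (x - r x))"
  have "card (add_coset P ` T) = card (?f ` T)"
  proof (rule card_image_cong_kernel)
    fix x y assume xy: "x \<in> T" "y \<in> T"
    show "add_coset P x = add_coset P y \<longleftrightarrow> ?f x = ?f y"
    proof
      assume "add_coset P x = add_coset P y"
      then have h: "x - y \<in> P" using add_coset_eq_iff[OF P] by blast
      then have e: "add_coset S x = add_coset S y" using add_coset_eq_iff[OF S] PS by blast
      show "?f x = ?f y" using e h r_cong[OF e] by (simp add: add_coset_eq_iff[OF P])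
    next
      assume h: "?f x = ?f y"
      then have "r x = r y" using r_cong[of x y] by blast
      then show "add_coset P x = add_coset P y" using h by (simp add: add_coset_eq_iff[OF P])
    qed
  qed
  also have "?f ` T = (add_coset S ` T) \<times> (add_coset P ` S)"
  proof (intro equalityI subsetI)
    fix z assume "z \<in> ?f ` T"
    then show "z \<in> (add_coset S ` T) \<times> (add_coset P ` S)" using r by auto
  next
    fix z assume "z \<in> (add_coset S ` T) \<times> (add_coset P ` S)"
    then obtain x y where xy: "x \<in> T" "y \<in> S" "z = (add_coset S x, add_coset P y)" by auto
    let ?w = "r x + y"
    have w: "?w \<in> T" using r(1)[OF xy(1)] xy ST add_subgrp_add[OF T] by blast
    have "?w - x \<in> S"
      using add_subgrp_diff[OF S xy(2) r(2)[OF xy(1)]] by (simp add: algebra_simps)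
    then have e: "add_coset S ?w = add_coset S x" by (simp add: add_coset_eq_iff[OF S])
    then have "r ?w = r x" by (rule r_cong)
    then have "?f ?w = z" using e xy by simp
    then show "z \<in> ?f ` T" using w by blast
  qed
  also have "card \<dots> = idx T S * idx S P" by (simp add: idx_def card_cartesian_product)
  finally show ?thesis by (simp add: idx_def)
qed

lemma idx_self: "add_subgrp S \<Longrightarrow> idx S S = 1"
proof -
  assume S: "add_subgrp S"
  have "add_coset S x = add_coset S 0" if "x \<in> S" for x
    using that by (simp add: add_coset_eq_iff[OF S])
  then have "add_coset S ` S = {add_coset S 0}" using add_subgrp_0[OF S] by blast
  then show ?thesis by (simp add: idx_def)
qed

lemma idx_1_imp_eq:
  assumes "add_subgrp S" "add_subgrp T" "S \<subseteq> T" "idx T S = 1"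
  shows "S = T"
proof -
  obtain C where C: "add_coset S ` T = {C}" using assms(4) by (auto simp: idx_def card_1_singleton_iff)
  have "x \<in> S" if "x \<in> T" for x
  proof -
    have "add_coset S x = add_coset S 0" using C that add_subgrp_0[OF assms(2)] by blast
    then show ?thesis using add_coset_eq_iff[OF assms(1)] by force
  qed
  then show ?thesis using assms(3) by blast
qed

lemma idx_pos_imp_finite: "idx T S > 0 \<Longrightarrow> finite (add_coset S ` T)"
  by (simp add: idx_def card_gt_0_iff)

lemma add_subgrp_sumset:
  assumes A: "add_subgrp A" and B: "add_subgrp B"
  shows "add_subgrp (sumset A B)" "A \<subseteq> sumset A B" "B \<subseteq> sumset A B"
proof -
  show "A \<subseteq> sumset A B" "B \<subseteq> sumset A B"
    using add_subgrp_0[OF A] add_subgrp_0[OF B] unfolding sumset_def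
    by (auto intro: exI[of _ 0]) (metis add.right_neutral)
  then have "0 \<in> sumset A B" using add_subgrp_0[OF A] by blast
  moreover have "x - y \<in> sumset A B" if xy: "x \<in> sumset A B" "y \<in> sumset A B" for x y
  proof -
    from xy obtain a b a' b' where "x = a + b" "y = a' + b'" "a \<in> A" "a' \<in> A" "b \<in> B" "b' \<in> B"
      by (auto simp: sumset_def)
    then have "x - y = (a - a') + (b - b')" "a - a' \<in> A" "b - b' \<in> B"
      using add_subgrp_diff A B by (auto simp: algebra_simps)
    then show ?thesis unfolding sumset_def by blast
  qed
  ultimately show "add_subgrp (sumset A B)" by (simp add: add_subgrp_def)
qed

lemma sumset_least:
  assumes "add_subgrp T" "A \<subseteq> T" "B \<subseteq> T"
  shows "sumset A B \<subseteq> T"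
  using assms add_subgrp_add[OF assms(1)] by (auto simp: sumset_def)

text \<open>Second isomorphism theorem: every A-coset in A + B already meets B.\<close>

lemma idx_sumset:
  assumes A: "add_subgrp A" and B: "add_subgrp B"
  shows "idx (sumset A B) A = idx B (A \<inter> B)"
proof -
  have "add_coset A ` sumset A B = add_coset A ` B"
  proof
    show "add_coset A ` B \<subseteq> add_coset A ` sumset A B"
      using add_subgrp_sumset(3)[OF A B] by blast
    show "add_coset A ` sumset A B \<subseteq> add_coset A ` B"
    proof
      fix z assume "z \<in> add_coset A ` sumset A B"
      then obtain a b where ab: "a \<in> A" "b \<in> B" "z = add_coset A (a + b)" by (auto simp: sumset_def)
      then have "z = add_coset A b" using add_coset_eq_iff[OF A, of "a + b" b] by simp
      then show "z \<in> add_coset A ` B" using ab by blast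
    qed
  qed
  moreover have "card (add_coset A ` B) = card (add_coset (A \<inter> B) ` B)"
    by (rule card_image_cong_kernel)
       (auto simp: add_coset_eq_iff A B add_subgrp_Int add_subgrp_diff)
  ultimately show ?thesis by (simp add: idx_def)
qed

text \<open>Elements of T share a coset of S exactly when their images share a coset of S'. Needed
  for multiplication by p and for the commutator map \<open>shiftv\<close>.\<close>

lemma idx_vimage:
  assumes "\<And>x y. f (x - y) = f x - f y" and S': "add_subgrp S'" and S: "add_subgrp S"
    and "f ` T = T'" and T: "add_subgrp T" and "\<And>x. x \<in> T \<Longrightarrow> x \<in> S \<longleftrightarrow> f x \<in> S'"
  shows "idx T S = idx T' S'"
proof -
  have "card (add_coset S ` T) = card ((\<lambda>x. add_coset S' (f x)) ` T)"
    by (rule card_image_cong_kernel)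
       (metis add_coset_eq_iff assms(1,6) S S' T add_subgrp_diff)
  also have "(\<lambda>x. add_coset S' (f x)) ` T = add_coset S' ` T'"
    using assms(4) by auto
  finally show ?thesis by (simp add: idx_def)
qed

text \<open>An intermediate U is the union of the P-cosets that it contains, hence is determined by
  a subset of a finite set.\<close>

lemma finite_intermediate_subgroups:
  assumes "add_subgrp P" "finite (add_coset P ` T)"
  shows "finite {U. add_subgrp U \<and> P \<subseteq> U \<and> U \<subseteq> T}"
proof -
  have "inj_on (\<lambda>U. add_coset P ` U) {U. add_subgrp U \<and> P \<subseteq> U \<and> U \<subseteq> T}"
  proof (rule inj_onI)
    have aux: "A \<subseteq> B" if "add_subgrp B" "P \<subseteq> B" "add_coset P ` A = add_coset P ` B" for A B
    proof
      fix x assume "x \<in> A"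
      then have "add_coset P x \<in> add_coset P ` B" using that(3) by blast
      then obtain y where y: "y \<in> B" "add_coset P x = add_coset P y" by blast
      then have "x - y \<in> B" using add_coset_eq_iff[OF assms(1)] that by blast
      then show "x \<in> B" using add_subgrp_add[OF that(1) _ y(1)] by fastforce
    qed
    fix A B assume "A \<in> {U. add_subgrp U \<and> P \<subseteq> U \<and> U \<subseteq> T}" "B \<in> {U. add_subgrp U \<and> P \<subseteq> U \<and> U \<subseteq> T}"
      "add_coset P ` A = add_coset P ` B"
    then show "A = B" using aux[of A B] aux[of B A] by auto
  qed
  moreover have "(\<lambda>U. add_coset P ` U) ` {U. add_subgrp U \<and> P \<subseteq> U \<and> U \<subseteq> T} \<subseteq> Pow (add_coset P ` T)"
    by auto
  ultimately show ?thesis using assms(2) by (meson finite_Pow_iff finite_imageD finite_subset)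
qed

section \<open>Cyclic quotients, orders of elements and lifts of subgroups\<close>

lemma idx_cyclic:
  fixes x :: "'a::ring_1" and r :: nat
  assumes T0: "add_subgrp T0" and T: "add_subgrp T" and x: "x \<in> T"
    and gen: "\<And>y. y \<in> T \<Longrightarrow> \<exists>j. y - of_int j * x \<in> T0"
    and r: "r > 0" and rel: "\<And>j. of_int j * x \<in> T0 \<longleftrightarrow> int r dvd j"
  shows "idx T T0 = r"
proof -
  have eq: "add_coset T0 (of_int i * x) = add_coset T0 (of_int j * x) \<longleftrightarrow> int r dvd i - j" for i j
    using rel[of "i - j"] by (simp add: add_coset_eq_iff[OF T0] algebra_simps)
  have "add_coset T0 ` T = (\<lambda>j. add_coset T0 (of_int j * x)) ` {0..<int r}"
  proof
    show "(\<lambda>j. add_coset T0 (of_int j * x)) ` {0..<int r} \<subseteq> add_coset T0 ` T"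
      using add_subgrp_scale[OF T x] by blast
    show "add_coset T0 ` T \<subseteq> (\<lambda>j. add_coset T0 (of_int j * x)) ` {0..<int r}"
    proof
      fix C assume "C \<in> add_coset T0 ` T"
      then obtain y where y: "y \<in> T" "C = add_coset T0 y" by blast
      then obtain j where "y - of_int j * x \<in> T0" using gen by blast
      then have "C = add_coset T0 (of_int j * x)" using y by (simp add: add_coset_eq_iff[OF T0])
      also have "\<dots> = add_coset T0 (of_int (j mod int r) * x)" unfolding eq
        by (metis dvd_eq_mod_eq_0 mod_mod_trivial mod_eq_dvd_iff)
      finally show "C \<in> (\<lambda>j. add_coset T0 (of_int j * x)) ` {0..<int r}" using r by auto
    qed
  qed
  moreover have "inj_on (\<lambda>j. add_coset T0 (of_int j * x)) {0..<int r}"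
    by (auto simp: inj_on_def eq) (metis mod_eq_dvd_iff mod_pos_pos_trivial)
  ultimately show ?thesis by (simp add: idx_def card_image)
qed

lemma add_subgrp_cyclic_ext:
  fixes x :: "'a::ring_1"
  assumes S: "add_subgrp S"
  shows "add_subgrp {u + of_int j * x | u j. u \<in> S}"
    and "S \<subseteq> {u + of_int j * x | u j. u \<in> S}" and "x \<in> {u + of_int j * x | u j. u \<in> S}"
proof -
  let ?U = "{u + of_int j * x | u j. u \<in> S}"
  show "S \<subseteq> ?U" by (force intro: exI[of _ 0])
  show "x \<in> ?U" using add_subgrp_0[OF S] by (force intro: exI[of _ 0] exI[of _ 1])
  have "a - b \<in> ?U" if ab: "a \<in> ?U" "b \<in> ?U" for a b
  proof -
    obtain u i v j where "u \<in> S" "v \<in> S" "a = u + of_int i * x" "b = v + of_int j * x"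
      using ab by blast
    then have "a - b = (u - v) + of_int (i - j) * x" "u - v \<in> S"
      by (auto simp: algebra_simps intro: add_subgrp_diff[OF S])
    then show ?thesis by blast
  qed
  then show "add_subgrp ?U" using add_subgrp_0[OF S] \<open>S \<subseteq> ?U\<close>
    unfolding add_subgrp_def by blast
qed

text \<open>Stated for a predicate, so that it yields alike the order of an element modulo a
  subgroup, the values of a coordinate on a lattice, and the exponent of a quotient. The witness
  \<open>j0\<close> excludes the zero ideal.\<close>

lemma int_ideal_generator:
  assumes "j0 > 0" "P (j0::int)" "\<And>i j. P i \<Longrightarrow> P j \<Longrightarrow> P (i - j)"
  obtains g where "g > 0" "P g" "\<And>j. P j \<longleftrightarrow> g dvd j"
proof -
  define g where "g = int (LEAST k. k > 0 \<and> P (int k))"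
  have ex: "nat j0 > 0 \<and> P (int (nat j0))" using assms by simp
  have g: "g > 0" "P g" using LeastI[of "\<lambda>k. k > 0 \<and> P (int k)", OF ex] by (auto simp: g_def)
  have P0: "P 0" using assms(3)[OF g(2) g(2)] by simp
  have Pm: "P (- j)" if "P j" for j using assms(3)[OF P0 that] by simp
  have Pp: "P (i + j)" if "P i" "P j" for i j using assms(3)[OF that(1) Pm[OF that(2)]] by simp
  have Pn: "P (int k * g)" for k by (induction k) (auto simp: P0 algebra_simps intro: Pp g(2))
  have Pz: "P (k * g)" for k
    using Pn[of "nat k"] Pm[OF Pn[of "nat (- k)"]] by (cases "k \<ge> 0") auto
  have "g dvd j" if "P j" for j
  proof (rule ccontr)
    assume "\<not> g dvd j"
    then have pos: "j mod g > 0" using g(1) by (simp add: dvd_eq_mod_eq_0 order.not_eq_order_implies_strict)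
    have "P (j mod g)" using assms(3)[OF that Pz[of "j div g"]] by (simp add: minus_div_mult_eq_mod)
    then have "nat (j mod g) > 0 \<and> P (int (nat (j mod g)))" using pos by simp
    then have "(LEAST k. k > 0 \<and> P (int k)) \<le> nat (j mod g)" by (rule Least_le)
    then have "g \<le> j mod g" using pos unfolding g_def by linarith
    then show False using pos_mod_bound[OF g(1), of j] by linarith
  qed
  then have "P j \<longleftrightarrow> g dvd j" for j using Pz by (metis dvdE mult.commute)
  then show ?thesis using that g by blast
qed

text \<open>Lagrange. Pigeonhole among the multiples of x gives a finite order g modulo U; g is the
  index of U in the subgroup generated by U and x, so by the tower law it divides the full
  index.\<close>

lemma idx_scale_mem:
  fixes x :: "'a::ring_1"
  assumes U: "add_subgrp U" and T: "add_subgrp T" and UT: "U \<subseteq> T"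
    and fin: "idx T U > 0" and x: "x \<in> T"
  shows "of_nat (idx T U) * x \<in> U"
proof -
  have "\<not> inj_on (\<lambda>k::nat. add_coset U (of_nat k * x)) UNIV"
  proof
    assume "inj_on (\<lambda>k::nat. add_coset U (of_nat k * x)) UNIV"
    moreover have "(\<lambda>k::nat. add_coset U (of_nat k * x)) ` UNIV \<subseteq> add_coset U ` T"
      using add_subgrp_scale_nat[OF T x] by blast
    ultimately have "finite (UNIV :: nat set)"
      using idx_pos_imp_finite[OF fin] by (meson finite_imageD finite_subset)
    then show False by simp
  qed
  then obtain i j :: nat where ij: "i < j" "add_coset U (of_nat i * x) = add_coset U (of_nat j * x)"
    unfolding inj_on_def by (metis linorder_neqE_nat)
  then have "of_nat j * x - of_nat i * x \<in> U" by (simp add: add_coset_eq_iff[OF U, of "of_nat j * x", symmetric])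
  then have j0: "of_int (int j - int i) * x \<in> U" by (simp add: algebra_simps)
  obtain g where g: "g > 0" "\<And>k. of_int k * x \<in> U \<longleftrightarrow> g dvd k"
    by (rule int_ideal_generator[of "int j - int i" "\<lambda>k. of_int k * x \<in> U"])
       (use ij j0 add_subgrp_diff[OF U] in \<open>auto simp: algebra_simps\<close>)
  let ?E = "{u + of_int j * x | u j. u \<in> U}"
  have E: "add_subgrp ?E" "U \<subseteq> ?E" "x \<in> ?E" by (rule add_subgrp_cyclic_ext[OF U])+
  have "\<exists>j. y - of_int j * x \<in> U" if y: "y \<in> ?E" for y
  proof -
    obtain u j where "u \<in> U" "y = u + of_int j * x" using y by blast
    then have "y - of_int j * x \<in> U" by simp
    then show ?thesis ..
  qed
  then have "idx ?E U = nat g"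
    by (rule idx_cyclic[OF U E(1) E(3)]) (use g in auto)
  moreover have "?E \<subseteq> T" using UT add_subgrp_scale[OF T x] add_subgrp_add[OF T] by blast
  ultimately have "nat g dvd idx T U" using idx_mult[OF U E(1) T E(2)] by simp
  then have "g dvd int (idx T U)" using g by (simp add: nat_dvd_iff)
  then have "of_int (int (idx T U)) * x \<in> U" using g(2) by blast
  then show ?thesis by simp
qed

text \<open>A subgroup \<open>U\<close> with \<open>U \<inter> T0 = U'\<close> and \<open>U + T0 = T\<close> is determined by the
  coset of \<open>U'\<close> formed by those \<open>b \<in> T0\<close> with \<open>x + b \<in> U\<close>.\<close>

lemma card_lifts:
  fixes x :: "'a::ring_1"
  assumes U': "add_subgrp U'" and T0: "add_subgrp T0" and T: "add_subgrp T"
    and sub: "U' \<subseteq> T0" "T0 \<subseteq> T" and x: "x \<in> T"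
    and gen: "\<And>y. y \<in> T \<Longrightarrow> \<exists>j. y - of_int j * x \<in> T0"
    and rel: "\<And>j y. of_int j * x \<in> T0 \<Longrightarrow> y \<in> T \<Longrightarrow> of_int j * y \<in> U'"
  shows "card {U. add_subgrp U \<and> U \<subseteq> T \<and> U \<inter> T0 = U' \<and> sumset U T0 = T} = idx T0 U'"
proof -
  let ?A = "{U. add_subgrp U \<and> U \<subseteq> T \<and> U \<inter> T0 = U' \<and> sumset U T0 = T}"
  let ?f = "\<lambda>U. {b \<in> T0. x + b \<in> U}"
  have f_coset: "?f U = add_coset U' b" if "U \<in> ?A" "b \<in> ?f U" for U b
  proof -
    have U: "add_subgrp U" "U \<inter> T0 = U'" and b: "b \<in> T0" "x + b \<in> U" using that by auto
    have "c \<in> ?f U \<longleftrightarrow> c - b \<in> U'" for c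
    proof
      assume "c \<in> ?f U"
      then have "c \<in> T0" "(x + c) - (x + b) \<in> U" using add_subgrp_diff[OF U(1)] b by blast+
      then show "c - b \<in> U'" using U b add_subgrp_diff[OF T0] by auto
    next
      assume h: "c - b \<in> U'"
      then have "(c - b) + b \<in> T0" "(x + b) + (c - b) \<in> U"
        using sub b U add_subgrp_add[OF T0] add_subgrp_add[OF U(1)] by blast+
      then show "c \<in> ?f U" by simp
    qed
    then show ?thesis by (auto simp: add_coset_def)
  qed
  have f_ne: "\<exists>b. b \<in> ?f U" if "U \<in> ?A" for U
  proof -
    have "x \<in> sumset U T0" using that x by auto
    then obtain u t where ut: "x = u + t" "u \<in> U" "t \<in> T0" by (auto simp: sumset_def)
    then have "x + (- t) \<in> U" "- t \<in> T0" using add_subgrp_uminus[OF T0] by auto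
    then show ?thesis by blast
  qed
  have recover: "y \<in> U \<longleftrightarrow> (\<exists>j. y - of_int j * (x + b) \<in> U')" if A: "U \<in> ?A" and b: "b \<in> ?f U" for U b y
  proof -
    have U: "add_subgrp U" "U \<subseteq> T" "U \<inter> T0 = U'" and b: "b \<in> T0" "x + b \<in> U" using A b by auto
    show ?thesis
    proof
      assume y: "y \<in> U"
      then obtain j where "y - of_int j * x \<in> T0" using gen U by blast
      then have "y - of_int j * x - of_int j * b \<in> T0"
        using add_subgrp_diff[OF T0] add_subgrp_scale[OF T0 b(1)] by blast
      moreover have "y - of_int j * (x + b) \<in> U"
        using add_subgrp_diff[OF U(1) y add_subgrp_scale[OF U(1) b(2)]] .
      ultimately show "\<exists>j. y - of_int j * (x + b) \<in> U'" using U(3) by (auto simp: algebra_simps)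
    next
      assume "\<exists>j. y - of_int j * (x + b) \<in> U'"
      then obtain j where "y - of_int j * (x + b) \<in> U" using U by blast
      then show "y \<in> U" using add_subgrp_add[OF U(1) _ add_subgrp_scale[OF U(1) b(2), of j]] by fastforce
    qed
  qed
  have inj: "inj_on ?f ?A"
  proof (rule inj_onI)
    fix U V assume A: "U \<in> ?A" "V \<in> ?A" "?f U = ?f V"
    then obtain b where "b \<in> ?f U" using f_ne by blast
    then show "U = V" using recover[OF A(1)] recover[OF A(2)] A(3) by blast
  qed
  have "?f ` ?A = add_coset U' ` T0"
  proof
    show "?f ` ?A \<subseteq> add_coset U' ` T0"
    proof
      fix C assume "C \<in> ?f ` ?A"
      then obtain U where U: "U \<in> ?A" "C = ?f U" by blast
      then obtain b where "b \<in> ?f U" using f_ne by blast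
      then show "C \<in> add_coset U' ` T0" using f_coset[OF U(1)] U(2) by blast
    qed
    show "add_coset U' ` T0 \<subseteq> ?f ` ?A"
    proof
      fix C assume "C \<in> add_coset U' ` T0"
      then obtain b where b: "b \<in> T0" "C = add_coset U' b" by blast
      let ?U = "{u + of_int j * (x + b) | u j. u \<in> U'}"
      have xb: "x + b \<in> T" using x b sub add_subgrp_add[OF T] by blast
      have U: "add_subgrp ?U" "U' \<subseteq> ?U" "x + b \<in> ?U" by (rule add_subgrp_cyclic_ext[OF U'])+
      have UT: "?U \<subseteq> T"
        using sub add_subgrp_scale[OF T xb] add_subgrp_add[OF T] by blast
      have "?U \<inter> T0 \<subseteq> U'"
      proof
        fix y assume "y \<in> ?U \<inter> T0"
        then obtain u j where y: "y \<in> T0" "y = u + of_int j * (x + b)" "u \<in> U'" by blast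
        have "(y - u) - of_int j * b \<in> T0"
          using y sub add_subgrp_diff[OF T0] add_subgrp_scale[OF T0 b(1)] by blast
        then have "of_int j * x \<in> T0" using y by (simp add: algebra_simps)
        \<comment> \<open>This is where \<open>rel\<close> makes every b admissible: otherwise the
          subgroup generated by U' and x + b could meet T0 in more than U'.\<close>
        then have "of_int j * (x + b) \<in> U'" using rel xb by blast
        then show "y \<in> U'" using y add_subgrp_add[OF U'] by blast
      qed
      then have int: "?U \<inter> T0 = U'" using U(2) sub by blast
      have "T \<subseteq> sumset ?U T0"
      proof
        fix y assume "y \<in> T"
        then obtain j where "y - of_int j * x \<in> T0" using gen by blast
        then have "y - of_int j * x - of_int j * b \<in> T0"
          using add_subgrp_diff[OF T0] add_subgrp_scale[OF T0 b(1)] by blast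
        moreover have "y = of_int j * (x + b) + (y - of_int j * x - of_int j * b)" by (simp add: algebra_simps)
        ultimately show "y \<in> sumset ?U T0"
          using add_subgrp_scale[OF U(1) U(3)] unfolding sumset_def by blast
      qed
      then have sum: "sumset ?U T0 = T" using sumset_least[OF T UT sub(2)] by blast
      have A: "?U \<in> ?A" using U(1) UT int sum by blast
      have "b \<in> ?f ?U" using b U(3) by blast
      then have "?f ?U = C" using f_coset[OF A] b by blast
      then show "C \<in> ?f ` ?A" using A by blast
    qed
  qed
  then show ?thesis using card_image[OF inj] by (simp only: idx_def)
qed

section \<open>Gaussian binomial coefficients\<close>

text \<open>The recursion sorts subspaces by whether they lie in a fixed hyperplane, which is how
  they are counted below. For n < k the truncated exponent multiplies 0. A semiring suffices, so the
  same function is used at naturals, polynomials, complex numbers and power series.\<close>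

fun gbin :: "'a::comm_semiring_1 \<Rightarrow> nat \<Rightarrow> nat \<Rightarrow> 'a" where
  "gbin q n 0 = 1"
| "gbin q 0 (Suc k) = 0"
| "gbin q (Suc n) (Suc k) = gbin q n (Suc k) + q ^ (n - k) * gbin q n k"

lemma gbin_eq_0: "n < k \<Longrightarrow> gbin q n k = 0"
  by (induction q n k rule: gbin.induct) auto

lemma gbin_self [simp]: "gbin q n n = 1"
  by (induction n) (auto simp: gbin_eq_0)

lemma gbin_hom:
  fixes h :: "'a::comm_semiring_1 \<Rightarrow> 'b::comm_semiring_1"
  assumes "h 0 = 0" "h 1 = 1" "\<And>a b. h (a + b) = h a + h b" "\<And>a b. h (a * b) = h a * h b"
  shows "gbin (h q) n k = h (gbin q n k)"
proof -
  have pow: "h (q ^ j) = h q ^ j" for j by (induction j) (auto simp: assms)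
  show ?thesis
  proof (induction n arbitrary: k)
    case 0
    then show ?case by (cases k) (auto simp: assms)
  next
    case (Suc n)
    then show ?case by (cases k) (auto simp: assms pow)
  qed
qed

text \<open>The q-factorial. Multiplying by it replaces the quotient formula for Gaussian binomials,
  which cannot be written in a semiring.\<close>

definition qfact :: "'a::comm_semiring_1 \<Rightarrow> nat \<Rightarrow> 'a" where
  "qfact q n = (\<Prod>i<n. \<Sum>j<Suc i. q ^ j)"

lemma qfact_Suc: "qfact q (Suc n) = qfact q n * (\<Sum>j<Suc n. q ^ j)"
  by (simp add: qfact_def)

lemma sum_power_split: "(\<Sum>i<a. q ^ i) + q ^ a * (\<Sum>i<b. q ^ i) = (\<Sum>i<a + b. (q::'a::comm_semiring_1) ^ i)"
  by (induction b) (auto simp: power_add distrib_left simp flip: add.assoc)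

text \<open>Writing [a] for 1 + q + ... + q^(a-1), the step rests on [n-k] + q^(n-k) [k+1] =
  [n+1].\<close>

lemma gbin_qfact: "k \<le> n \<Longrightarrow> gbin q n k * (qfact q k * qfact q (n - k)) = qfact q n"
proof (induction q n k rule: gbin.induct)
  case (1 q n)
  show ?case by (simp add: qfact_def)
next
  case (2 q k)
  then show ?case by simp
next
  case (3 q n k)
  show ?case
  proof (cases "k = n")
    case True
    then show ?thesis by (simp add: gbin_eq_0 qfact_def)
  next
    case False
    then have k: "Suc k \<le> n" using 3 by simp
    then obtain l where l: "n - k = Suc l" "n - Suc k = l" by (metis Suc_diff_Suc Suc_le_eq)
    have "gbin q (Suc n) (Suc k) * (qfact q (Suc k) * qfact q (Suc n - Suc k))
      = gbin q n (Suc k) * (qfact q (Suc k) * qfact q l) * (\<Sum>j<n - k. q ^ j)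
        + q ^ (n - k) * (\<Sum>j<Suc k. q ^ j) * (gbin q n k * (qfact q k * qfact q (n - k)))"
      using l by (simp add: qfact_Suc[of q l] qfact_Suc[of q k] algebra_simps)
    also have "\<dots> = qfact q n * ((\<Sum>j<n - k. q ^ j) + q ^ (n - k) * (\<Sum>j<Suc k. q ^ j))"
      using 3 k l by (simp add: algebra_simps)
    also have "\<dots> = qfact q (Suc n)"
      using k by (simp only: sum_power_split) (simp add: qfact_Suc)
    finally show ?thesis .
  qed
qed

lemma poly_map_of_int_hom:
  fixes q :: "'a::comm_ring_1"
  defines "h \<equiv> \<lambda>P. poly (map_poly of_int P) q"
  shows "h 0 = 0" "h 1 = 1" "h (P + Q) = h P + h Q" "h (P * Q) = h P * h Q" "h [:0, 1:] = q"
proof -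
  have "map_poly of_int (P + Q) = map_poly of_int P + (map_poly of_int Q :: 'a poly)"
    by (rule poly_eqI) (simp add: coeff_map_poly)
  moreover have "map_poly of_int (P * Q) = map_poly of_int P * (map_poly of_int Q :: 'a poly)"
    by (rule poly_eqI) (simp add: coeff_map_poly coeff_mult)
  ultimately show "h 0 = 0" "h 1 = 1" "h (P + Q) = h P + h Q" "h (P * Q) = h P * h Q" "h [:0, 1:] = q"
    by (auto simp: h_def map_poly_pCons)
qed

text \<open>Binomial identities are proved over Z[X], where q-factorials are nonzero and can be
  cancelled, and then specialised; at a particular q, such as a root of unity, the cancellation
  would fail.\<close>

lemma gbin_conv_poly: "gbin (q::'a::comm_ring_1) n k = poly (map_poly of_int (gbin [:0, 1:] n k)) q"
  using gbin_hom[of "\<lambda>P. poly (map_poly of_int P) q" "[:0, 1:]" n k] by (simp add: poly_map_of_int_hom)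

lemma qfact_X_nonzero: "qfact ([:0, 1:] :: int poly) n \<noteq> 0"
proof -
  have "(\<Sum>j<Suc i. [:0, 1:] ^ j) \<noteq> (0 :: int poly)" for i
  proof
    assume "(\<Sum>j<Suc i. [:0, 1:] ^ j) = (0 :: int poly)"
    then have "poly (\<Sum>j<Suc i. [:0, 1:] ^ j) (1::int) = 0" by simp
    then show False by (simp add: poly_sum del: sum.lessThan_Suc)
  qed
  then show ?thesis unfolding qfact_def by (simp del: sum.lessThan_Suc)
qed

lemma gbin_symmetric:
  assumes "k \<le> n"
  shows "gbin (q::'a::comm_ring_1) n (n - k) = gbin q n k"
proof -
  let ?X = "[:0, 1:] :: int poly"
  have "gbin ?X n (n - k) * (qfact ?X k * qfact ?X (n - k)) = gbin ?X n k * (qfact ?X k * qfact ?X (n - k))"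
    using gbin_qfact[of k n ?X] gbin_qfact[of "n - k" n ?X] assms by (simp add: mult.commute)
  then have "gbin ?X n (n - k) = gbin ?X n k" using qfact_X_nonzero by simp
  then show ?thesis by (subst (1 2) gbin_conv_poly) simp
qed

text \<open>Either side, multiplied by the q-factorials of j, k - j and d - k, is the q-factorial of
  d.\<close>

lemma gbin_trinomial:
  assumes "j \<le> k" "k \<le> d"
  shows "gbin (q::'a::comm_ring_1) d k * gbin q k j = gbin q d j * gbin q (d - j) (k - j)"
proof -
  let ?X = "[:0, 1:] :: int poly"
  let ?f = "qfact ?X" and ?g = "gbin ?X"
  have "(?g d k * ?g k j) * (?f j * ?f (k - j) * ?f (d - k)) = (?g k j * (?f j * ?f (k - j))) * (?g d k * ?f (d - k))"
    by (simp only: ac_simps)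
  also have "\<dots> = ?f d" using gbin_qfact[of j k ?X] gbin_qfact[of k d ?X] assms by (simp add: ac_simps)
  also have "\<dots> = ?g d j * ?f j * ?f (d - j)" using gbin_qfact[of j d ?X] assms by (simp add: ac_simps)
  also have "\<dots> = ?g d j * ?f j * (?g (d - j) (k - j) * (?f (k - j) * ?f (d - j - (k - j))))"
    using gbin_qfact[of "k - j" "d - j" ?X] assms by simp
  also have "\<dots> = (?g d j * ?g (d - j) (k - j)) * (?f j * ?f (k - j) * ?f (d - k))"
    using assms by (simp add: ac_simps)
  finally have "?g d k * ?g k j = ?g d j * ?g (d - j) (k - j)" using qfact_X_nonzero by simp
  then show ?thesis using poly_map_of_int_hom(4)[of _ _ q]
    by (subst (1 2 3 4) gbin_conv_poly) metis
qed

lemma gbin_Suc_Suc':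
  "gbin (q::'a::comm_ring_1) (Suc n) (Suc k) = gbin q n k + q ^ Suc k * gbin q n (Suc k)"
proof (cases "k < n")
  case True
  then obtain l where l: "n = Suc (k + l)" using less_iff_Suc_add by auto
  have "gbin q (Suc n) (Suc k) = gbin q (Suc n) (Suc l)"
    using gbin_symmetric[of "Suc k" "Suc n" q] l by simp
  also have "\<dots> = gbin q n (Suc l) + q ^ Suc k * gbin q n l" using l by simp
  also have "gbin q n (Suc l) = gbin q n k" using gbin_symmetric[of k n q] l by (simp add: Suc_diff_le)
  also have "gbin q n l = gbin q n (Suc k)" using gbin_symmetric[of "Suc k" n q] l by simp
  finally show ?thesis .
next
  case False
  then show ?thesis by (cases "n = k") (simp_all add: gbin_eq_0)
qed

text \<open>Up to the power of q, replacing q by 1 / q interchanges the two Pascal recursions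
  \<open>gbin.simps\<close> and \<open>gbin_Suc_Suc'\<close>.\<close>

lemma gbin_inverse:
  fixes q :: "'a::field"
  assumes "q \<noteq> 0" "k \<le> n"
  shows "gbin (1 / q) n k * q ^ (k * (n - k)) = gbin q n k"
  using assms(2)
proof (induction n arbitrary: k)
  case 0
  then show ?case by simp
next
  case (Suc n)
  show ?case
  proof (cases k)
    case 0
    then show ?thesis by simp
  next
    case k: (Suc j)
    show ?thesis
    proof (cases "j = n")
      case True
      then show ?thesis using k by (simp add: gbin_eq_0)
    next
      case False
      then have j: "j < n" using Suc.prems k by simp
      then obtain l where l: "n = Suc (j + l)" using less_iff_Suc_add by auto
      have 1: "gbin (1 / q) n (Suc j) * q ^ (Suc j * l) = gbin q n (Suc j)" using Suc.IH[of "Suc j"] l by simp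
      have 2: "gbin (1 / q) n j * q ^ (j * Suc l) = gbin q n j" using Suc.IH[of j] l by (simp add: Suc_diff_le)
      have "gbin (1 / q) (Suc n) k * q ^ (k * (Suc n - k))
         = gbin (1 / q) n (Suc j) * q ^ (Suc j * Suc l) + (1 / q) ^ Suc l * gbin (1 / q) n j * q ^ (Suc j * Suc l)"
        using k l by (simp add: distrib_right Suc_diff_le)
      also have "q ^ (Suc j * Suc l) = q ^ (Suc j * l) * q ^ Suc j"
        by (simp flip: power_add add: ac_simps)
      also have "gbin (1 / q) n (Suc j) * (q ^ (Suc j * l) * q ^ Suc j) = q ^ Suc j * gbin q n (Suc j)"
        using 1 by (simp add: ac_simps)
      also have "q ^ (Suc j * l) * q ^ Suc j = q ^ Suc l * q ^ (j * Suc l)" by (simp flip: power_add add: ac_simps)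
      also have "(1 / q) ^ Suc l * gbin (1 / q) n j * (q ^ Suc l * q ^ (j * Suc l)) = gbin q n j"
        using assms(1) 2 by (simp add: power_divide)
      finally show ?thesis using gbin_Suc_Suc'[of q n j] k by simp
    qed
  qed
qed

text \<open>The Pascal recursion gives s (n + 1) = (1 - q^n) s n, and the factor for n = 0 is
  zero.\<close>

lemma gbin_alternating_sum:
  fixes q :: "'a::comm_ring_1"
  shows "(\<Sum>k\<le>n. (-1) ^ k * q ^ (k choose 2) * gbin q n k) = (if n = 0 then 1 else 0)"
proof -
  define s where "s = (\<lambda>n. \<Sum>k\<le>n. (-1) ^ k * q ^ (k choose 2) * gbin q n k)"
  have s: "s (Suc n) = (1 - q ^ n) * s n" for n
  proof -
    have "s (Suc n) = 1 + (\<Sum>k\<le>n. (-1) ^ Suc k * q ^ (Suc k choose 2) * (gbin q n (Suc k) + q ^ (n - k) * gbin q n k))"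
      unfolding s_def by (subst sum.atMost_Suc_shift) (simp add: numeral_2_eq_2)
    also have "\<dots> = (1 + (\<Sum>k\<le>n. (-1) ^ Suc k * q ^ (Suc k choose 2) * gbin q n (Suc k)))
        + (\<Sum>k\<le>n. (-1) ^ Suc k * q ^ (Suc k choose 2) * (q ^ (n - k) * gbin q n k))"
      by (simp add: distrib_left sum.distrib sum_subtractf sum_negf)
    also have "1 + (\<Sum>k\<le>n. (-1) ^ Suc k * q ^ (Suc k choose 2) * gbin q n (Suc k))
        = (\<Sum>k\<le>Suc n. (-1) ^ k * q ^ (k choose 2) * gbin q n k)"
      by (subst sum.atMost_Suc_shift) (simp add: numeral_2_eq_2)
    also have "\<dots> = s n" by (simp add: s_def gbin_eq_0)
    also have "(\<Sum>k\<le>n. (-1) ^ Suc k * q ^ (Suc k choose 2) * (q ^ (n - k) * gbin q n k)) = - (q ^ n) * s n"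
      unfolding s_def sum_distrib_left
    proof (rule sum.cong)
      fix k assume "k \<in> {..n}"
      then have "q ^ n = q ^ k * q ^ (n - k)" by (simp flip: power_add)
      moreover have "q ^ (Suc k choose 2) = q ^ k * q ^ (k choose 2)"
        by (simp add: numeral_2_eq_2 power_add)
      ultimately show "(-1) ^ Suc k * q ^ (Suc k choose 2) * (q ^ (n - k) * gbin q n k)
          = - (q ^ n) * ((-1) ^ k * q ^ (k choose 2) * gbin q n k)" by (simp add: ac_simps)
    qed simp
    finally show ?thesis by (simp add: algebra_simps)
  qed
  have "s n = (if n = 0 then 1 else 0)"
  proof (induction n)
    case 0
    show ?case by (simp add: s_def numeral_2_eq_2)
  next
    case (Suc n)
    then show ?case by (simp add: s)
  qed
  then show ?thesis by (simp add: s_def)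
qed

text \<open>After exchanging the sums, \<open>gbin_trinomial\<close> pulls out the binomial of d
  over j and leaves an alternating sum for d - j, which vanishes unless j = d.\<close>

lemma gbin_inversion:
  fixes q :: "'a::comm_ring_1"
  shows "(\<Sum>k\<le>d. (-1) ^ (d - k) * q ^ ((d - k) choose 2) * gbin q d k * (\<Sum>j\<le>k. gbin q k j * y j)) = y d"
proof -
  let ?c = "\<lambda>k. (-1) ^ (d - k) * q ^ ((d - k) choose 2)"
  have "(\<Sum>k\<le>d. ?c k * gbin q d k * (\<Sum>j\<le>k. gbin q k j * y j))
      = (\<Sum>k\<le>d. \<Sum>j\<le>k. ?c k * gbin q d k * (gbin q k j * y j))" by (simp only: sum_distrib_left)
  also have "\<dots> = (\<Sum>j\<le>d. \<Sum>k=j..d. ?c k * gbin q d k * (gbin q k j * y j))"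
    unfolding sum.Sigma[OF finite_atMost ballI[OF finite_atMost]]
      sum.Sigma[OF finite_atMost ballI[OF finite_atLeastAtMost]]
    by (rule sum.reindex_bij_witness[of _ "\<lambda>(a, b). (b, a)" "\<lambda>(a, b). (b, a)"]) auto
  also have "\<dots> = (\<Sum>j\<le>d. y j * gbin q d j * (if d - j = 0 then 1 else 0))"
  proof (rule sum.cong[OF refl])
    fix j assume "j \<in> {..d}"
    then have j: "j \<le> d" by simp
    have "(\<Sum>k=j..d. ?c k * gbin q d k * (gbin q k j * y j))
        = (\<Sum>k=j..d. y j * gbin q d j * (?c k * gbin q (d - j) (d - k)))"
    proof (rule sum.cong[OF refl])
      fix k assume k: "k \<in> {j..d}"
      have "gbin q (d - j) (d - k) = gbin q (d - j) (k - j)"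
        using gbin_symmetric[of "k - j" "d - j" q] k by (simp add: diff_le_mono)
      then have "gbin q d k * gbin q k j = gbin q d j * gbin q (d - j) (d - k)"
        using gbin_trinomial[of j k d q] k by simp
      then have "y j * ?c k * (gbin q d k * gbin q k j) = y j * ?c k * (gbin q d j * gbin q (d - j) (d - k))"
        by simp
      then show "?c k * gbin q d k * (gbin q k j * y j) = y j * gbin q d j * (?c k * gbin q (d - j) (d - k))"
        by (simp only: ac_simps)
    qed
    also have "\<dots> = y j * gbin q d j * (\<Sum>k=j..d. ?c k * gbin q (d - j) (d - k))" by (simp only: sum_distrib_left)
    also have "(\<Sum>k=j..d. ?c k * gbin q (d - j) (d - k)) = (\<Sum>i\<le>d - j. (-1) ^ i * q ^ (i choose 2) * gbin q (d - j) i)"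
      by (rule sum.reindex_bij_witness[of _ "\<lambda>i. d - i" "\<lambda>k. d - k"]) (use j in auto)
    finally show "(\<Sum>k=j..d. ?c k * gbin q d k * (gbin q k j * y j)) = y j * gbin q d j * (if d - j = 0 then 1 else 0)"
      by (simp only: gbin_alternating_sum)
  qed
  also have "\<dots> = (\<Sum>j\<le>d. if j = d then y j else 0)" by (rule sum.cong) auto
  also have "\<dots> = y d" by simp
  finally show ?thesis .
qed

section \<open>The Igusa function and its functional equation\<close>

text \<open>The inner \<open>Min\<close> is the successor of i in I, with m closing the list. A flag
  member of codimension i over the next smaller member W is a subspace of codimension i in the
  quotient by W, whose dimension is the codimension of W; this gives the factor for i.\<close>

definition flag_product :: "'a::comm_semiring_1 \<Rightarrow> nat \<Rightarrow> nat set \<Rightarrow> 'a" where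
  "flag_product q m I = (\<Prod>i\<in>I. gbin q (Min (insert m {j \<in> I. i < j})) i)"

lemma flag_product_empty [simp]: "flag_product q m {} = 1"
  by (simp add: flag_product_def)

lemma flag_product_insert_max:
  assumes "finite I" "\<And>i. i \<in> I \<Longrightarrow> i < j" "j \<le> m"
  shows "flag_product q m (insert j I) = gbin q m j * flag_product q j I"
proof -
  have jI: "j \<notin> I" using assms(2) by blast
  have "{k \<in> insert j I. j < k} = {}" by (auto dest!: assms(2))
  moreover have "Min (insert m {k \<in> insert j I. i < k}) = Min (insert j {k \<in> I. i < k})" if i: "i \<in> I" for i
  proof -
    have "{k \<in> insert j I. i < k} = insert j {k \<in> I. i < k}" using assms(2) i by auto
    then have "Min (insert m {k \<in> insert j I. i < k}) = min m (Min (insert j {k \<in> I. i < k}))"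
      using assms(1) by (simp add: Min_insert)
    moreover have "Min (insert j {k \<in> I. i < k}) \<le> j" using assms(1) by simp
    ultimately show ?thesis using assms(3) by simp
  qed
  ultimately show ?thesis using jI assms(1) unfolding flag_product_def
    by (simp only: prod.insert[OF assms(1) jI]) simp
qed

lemma flag_product_hom:
  fixes h :: "'a::comm_semiring_1 \<Rightarrow> 'b::comm_semiring_1"
  assumes "h 0 = 0" "h 1 = 1" "\<And>a b. h (a + b) = h a + h b" "\<And>a b. h (a * b) = h a * h b" "finite I"
  shows "flag_product (h q) m I = h (flag_product q m I)"
  unfolding flag_product_def
  using assms(5)
proof -
  have "h (prod f I) = (\<Prod>i\<in>I. h (f i))" for f :: "nat \<Rightarrow> 'a"
    using assms(5) by (induction I rule: finite_induct) (auto simp: assms)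
  then show "(\<Prod>i\<in>I. gbin (h q) (Min (insert m {j \<in> I. i < j})) i)
      = h (\<Prod>i\<in>I. gbin q (Min (insert m {j \<in> I. i < j})) i)"
    using gbin_hom[of h q] assms by simp
qed

text \<open>\<open>x i\<close> stands for X_i / (1 - X_i). Keeping it free over any commutative ring
  allows both complex numbers and power series.\<close>

definition igusa :: "'a::comm_ring_1 \<Rightarrow> nat \<Rightarrow> (nat \<Rightarrow> 'a) \<Rightarrow> 'a" where
  "igusa q m x = (\<Sum>I\<in>Pow {1..<m}. flag_product q m I * (\<Prod>i\<in>I. x i))"

text \<open>The smallest flag member has the largest codimension, so the split is by the maximum j
  of I. The auxiliary induction bounds the indices by k while m stays fixed.\<close>

lemma igusa_rec: "igusa q m x = 1 + (\<Sum>j=1..<m. gbin q m j * x j * igusa q j x)"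
proof -
  have "1 \<le> k \<Longrightarrow> k \<le> m \<Longrightarrow> (\<Sum>I\<in>Pow {1..<k}. flag_product q m I * (\<Prod>i\<in>I. x i))
      = 1 + (\<Sum>j=1..<k. gbin q m j * x j * igusa q j x)" for k
  proof (induction k)
    case (Suc k)
    show ?case
    proof (cases "k = 0")
      case True
      then show ?thesis by simp
    next
      case False
      then have ins: "{1..<Suc k} = insert k {1..<k}" by auto
      have "(\<Sum>I\<in>Pow {1..<Suc k}. flag_product q m I * (\<Prod>i\<in>I. x i))
        = (\<Sum>I\<in>Pow {1..<k}. flag_product q m I * (\<Prod>i\<in>I. x i))
          + (\<Sum>I\<in>insert k ` Pow {1..<k}. flag_product q m I * (\<Prod>i\<in>I. x i))"
        unfolding ins Pow_insert by (rule sum.union_disjoint) auto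
      also have "(\<Sum>I\<in>insert k ` Pow {1..<k}. flag_product q m I * (\<Prod>i\<in>I. x i))
        = (\<Sum>I\<in>Pow {1..<k}. flag_product q m (insert k I) * (\<Prod>i\<in>insert k I. x i))"
        by (subst sum.reindex) (force simp: inj_on_def)+
      also have "\<dots> = (\<Sum>I\<in>Pow {1..<k}. gbin q m k * x k * (flag_product q k I * (\<Prod>i\<in>I. x i)))"
      proof (rule sum.cong[OF refl])
        fix I assume I: "I \<in> Pow {1..<k}"
        then have fin: "finite I" and "k \<notin> I" by (auto intro: finite_subset)
        moreover have "flag_product q m (insert k I) = gbin q m k * flag_product q k I"
          by (rule flag_product_insert_max) (use I fin Suc.prems in auto)
        ultimately show "flag_product q m (insert k I) * (\<Prod>i\<in>insert k I. x i)
            = gbin q m k * x k * (flag_product q k I * (\<Prod>i\<in>I. x i))" by (simp add: ac_simps)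
      qed
      also have "\<dots> = gbin q m k * x k * igusa q k x" by (simp add: igusa_def sum_distrib_left)
      finally show ?thesis using Suc False by simp
    qed
  qed simp
  from this[of m] show ?thesis unfolding igusa_def by (cases "m = 0") auto
qed

text \<open>Substituting the inductive hypothesis into the recursion for \<open>1 / q\<close> turns the claim into
  Gaussian inversion of \<open>(1 + x k) * igusa q k x = (\<Sum>j\<le>k. gbin q k j * y j)\<close>.\<close>

lemma igusa_functional_equation:
  fixes q :: "'a::field"
  assumes q: "q \<noteq> 0" and m: "m \<ge> 1"
  shows "igusa (1 / q) m (\<lambda>i. - 1 - x i) = (-1) ^ (m - 1) * (1 / q) ^ (m choose 2) * igusa q m x"
  using m
proof (induction m rule: less_induct)
  case (less d)
  define y where "y = (\<lambda>k. if k = 0 then 1 else x k * igusa q k x)"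
  define s where "s = (\<lambda>k. \<Sum>j\<le>k. gbin q k j * y j)"
  have F: "igusa q k x = (\<Sum>j<k. gbin q k j * y j)" if "k \<ge> 1" for k
  proof -
    have "{..<k} = insert 0 {1..<k}" using that by auto
    then have "(\<Sum>j<k. gbin q k j * y j) = 1 + (\<Sum>j=1..<k. gbin q k j * y j)" by (simp add: y_def)
    also have "(\<Sum>j=1..<k. gbin q k j * y j) = (\<Sum>j=1..<k. gbin q k j * x j * igusa q j x)"
      by (rule sum.cong) (auto simp: y_def)
    finally show ?thesis by (simp add: igusa_rec[of q k x])
  qed
  have s: "s k = (1 + x k) * igusa q k x" if "k \<ge> 1" for k
    unfolding s_def lessThan_Suc_atMost[symmetric] using F[OF that] that
    by (simp add: y_def algebra_simps)
  have s0: "s 0 = 1" by (simp add: s_def y_def)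
  let ?c = "\<lambda>k. (-1) ^ (d - k) * q ^ ((d - k) choose 2) * gbin q d k * s k"
  have inversion: "(\<Sum>k\<le>d. ?c k) = y d" unfolding s_def by (rule gbin_inversion)
  \<comment> \<open>The term k = 0 matches the constant 1 in the recursion for 1 / q. The term k = d
    goes to the right, where y d - s d = - \<open>igusa q d x\<close>.\<close>
  have "{..d} = insert d (insert 0 {1..<d})" using less.prems by auto
  then have "(\<Sum>k\<le>d. ?c k) = s d + ((-1) ^ d * q ^ (d choose 2) + (\<Sum>k=1..<d. ?c k))"
    using less.prems s0 by (simp add: numeral_2_eq_2)
  then have "(-1) ^ d * q ^ (d choose 2) + (\<Sum>k=1..<d. ?c k) = y d - s d"
    by (simp only: inversion add_diff_cancel_left')
  then have inv: "(-1) ^ d * q ^ (d choose 2) + (\<Sum>k=1..<d. ?c k) = - igusa q d x"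
    using s[OF less.prems] less.prems by (simp only:) (simp add: y_def algebra_simps)
  have "(-1) ^ d * q ^ (d choose 2) * igusa (1 / q) d (\<lambda>i. - 1 - x i)
      = (-1) ^ d * q ^ (d choose 2) + (\<Sum>k=1..<d. (-1) ^ d * q ^ (d choose 2) * (gbin (1 / q) d k * (- 1 - x k) * igusa (1 / q) k (\<lambda>i. - 1 - x i)))"
    by (subst igusa_rec) (simp add: distrib_left sum_distrib_left)
  also have "(\<Sum>k=1..<d. (-1) ^ d * q ^ (d choose 2) * (gbin (1 / q) d k * (- 1 - x k) * igusa (1 / q) k (\<lambda>i. - 1 - x i)))
      = (\<Sum>k=1..<d. ?c k)"
  proof (rule sum.cong[OF refl])
    fix k assume "k \<in> {1..<d}"
    then have k: "k \<ge> 1" "k < d" by auto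
    then obtain l where l: "d = k + l" "l \<ge> 1" using less_iff_Suc_add by (metis One_nat_def Suc_leI add_diff_inverse_nat not_less_iff_gr_or_eq zero_less_diff)
    \<comment> \<open>The three parts of the exponent are used up separately: k choose 2 by the
      inductive hypothesis, k l by \<open>gbin_inverse\<close>, and l choose 2 as the weight in
      Gaussian inversion.\<close>
    have "(k + l) choose 2 = (k choose 2) + (l choose 2) + k * l"
      by (induction l) (simp_all add: numeral_2_eq_2)
    then have Q: "q ^ (d choose 2) = q ^ (k choose 2) * q ^ (l choose 2) * q ^ (k * l)"
      using l by (simp add: power_add)
    have g: "gbin (1 / q) d k * q ^ (k * l) = gbin q d k" using gbin_inverse[OF q, of k d] l by simp
    have F': "igusa (1 / q) k (\<lambda>i. - 1 - x i) = (-1) ^ (k - 1) * (1 / q) ^ (k choose 2) * igusa q k x"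
      using less.IH k by simp
    have sign: "(-1::'a) ^ d * (-1) ^ (k - 1) = - ((-1) ^ l)"
    proof -
      obtain k' where "k = Suc k'" using k by (cases k) auto
      then have "(-1::'a) ^ d * (-1) ^ (k - 1) = - ((-1) ^ l) * ((-1) ^ k' * (-1) ^ k')"
        using l by (simp add: power_add ac_simps)
      then show ?thesis by (simp flip: power_mult_distrib)
    qed
    have "(-1) ^ d * q ^ (d choose 2) * (gbin (1 / q) d k * (- 1 - x k) * igusa (1 / q) k (\<lambda>i. - 1 - x i))
       = ((-1) ^ d * (-1) ^ (k - 1)) * (q ^ (k choose 2) * (1 / q) ^ (k choose 2)) * q ^ (l choose 2)
         * (gbin (1 / q) d k * q ^ (k * l)) * ((- 1 - x k) * igusa q k x)"
      by (simp only: Q F' ac_simps)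
    also have "\<dots> = - ((-1) ^ l) * (q ^ (k choose 2) * (1 / q) ^ (k choose 2)) * q ^ (l choose 2)
         * gbin q d k * ((- 1 - x k) * igusa q k x)" by (simp only: g sign)
    also have "\<dots> = (-1) ^ l * q ^ (l choose 2) * gbin q d k * s k"
      using q by (simp add: s[OF k(1)] power_divide algebra_simps)
    finally show "(-1) ^ d * q ^ (d choose 2) * (gbin (1 / q) d k * (- 1 - x k) * igusa (1 / q) k (\<lambda>i. - 1 - x i)) = ?c k"
      using l by simp
  qed
  finally have "(-1) ^ d * q ^ (d choose 2) * igusa (1 / q) d (\<lambda>i. - 1 - x i) = - igusa q d x" using inv by simp
  moreover have "(-1::'a) ^ d * (-1) ^ d = 1" by (simp flip: power_mult_distrib)
  moreover have "(1 / q) ^ (d choose 2) * q ^ (d choose 2) = 1" using q by (simp add: power_divide)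
  moreover have "((1 / q) ^ (d choose 2) * q ^ (d choose 2)) * ((-1) ^ d * (-1) ^ d) * igusa (1 / q) d (\<lambda>i. - 1 - x i)
     = (1 / q) ^ (d choose 2) * ((-1) ^ d * ((-1) ^ d * q ^ (d choose 2) * igusa (1 / q) d (\<lambda>i. - 1 - x i)))"
    by (simp only: ac_simps)
  ultimately have "igusa (1 / q) d (\<lambda>i. - 1 - x i) = (1 / q) ^ (d choose 2) * ((-1) ^ d * - igusa q d x)"
    by simp
  also have "(-1) ^ d = - ((-1::'a) ^ (d - 1))" using less.prems by (cases d) auto
  finally show ?case by (simp add: ac_simps)
qed

text \<open>The hypothesis sums over larger indices, \<open>igusa_rec\<close> over smaller ones.
  With A d = (1 + x 0) \<open>igusa q d x\<close> for d > 0 and A 0 = 1, evaluating the sum of S k A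
  k over k < m through either recursion shows that it equals the sum of S d (A d - 1) over d \<le>
  m. Comparison leaves the sum of S equal to A m.\<close>

lemma sum_transposed_igusa:
  fixes q :: "'a::comm_ring_1"
  assumes m: "m \<ge> 1" and "S m = 1"
    and rec: "\<And>k. k < m \<Longrightarrow> S k = x k * (\<Sum>d\<in>{k<..m}. gbin q d k * S d)"
  shows "(\<Sum>k\<le>m. S k) = (1 + x 0) * igusa q m x"
proof -
  define A where "A = (\<lambda>d. if d = 0 then 1 else (1 + x 0) * igusa q d x)"
  have A: "A d = 1 + (\<Sum>k<d. gbin q d k * x k * A k)" for d
  proof (cases "d = 0")
    case False
    then have "{..<d} = insert 0 {1..<d}" by auto
    then have "(\<Sum>k<d. gbin q d k * x k * A k) = x 0 + (\<Sum>k=1..<d. gbin q d k * x k * A k)" by (simp add: A_def)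
    also have "(\<Sum>k=1..<d. gbin q d k * x k * A k) = (1 + x 0) * (\<Sum>k=1..<d. gbin q d k * x k * igusa q k x)"
      unfolding sum_distrib_left by (rule sum.cong) (auto simp: A_def)
    finally show ?thesis using False igusa_rec[of q d x] by (simp add: A_def algebra_simps)
  qed (simp add: A_def)
  have "(\<Sum>k<m. S k * A k) = (\<Sum>k<m. \<Sum>d\<in>{k<..m}. S d * (gbin q d k * x k * A k))"
    using rec by (simp add: sum_distrib_left sum_distrib_right ac_simps)
  also have "\<dots> = (\<Sum>d\<le>m. \<Sum>k<d. S d * (gbin q d k * x k * A k))"
    unfolding sum.Sigma[OF finite_lessThan ballI[OF finite_greaterThanAtMost]]
      sum.Sigma[OF finite_atMost ballI[OF finite_lessThan]]
    by (rule sum.reindex_bij_witness[of _ "\<lambda>(a, b). (b, a)" "\<lambda>(a, b). (b, a)"]) auto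
  also have "\<dots> = (\<Sum>d\<le>m. S d * A d - S d)"
  proof (rule sum.cong[OF refl])
    fix d
    show "(\<Sum>k<d. S d * (gbin q d k * x k * A k)) = S d * A d - S d"
      by (subst A) (simp add: sum_distrib_left algebra_simps)
  qed
  also have "\<dots> = (\<Sum>d\<le>m. S d * A d) - (\<Sum>d\<le>m. S d)" by (rule sum_subtractf)
  also have "(\<Sum>d\<le>m. S d * A d) = (\<Sum>d<m. S d * A d) + A m"
    using assms(2) by (simp flip: lessThan_Suc_atMost)
  finally show ?thesis using m by (simp add: A_def)
qed

section \<open>Counting in elementary abelian sections\<close>

lemma prime_multiple_mem_iff:
  fixes x :: "'a::ring_1"
  assumes S: "add_subgrp S" and p: "prime (p::nat)" and px: "of_nat p * x \<in> S" and x: "x \<notin> S"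
  shows "of_int j * x \<in> S \<longleftrightarrow> int p dvd j"
proof
  assume j: "of_int j * x \<in> S"
  show "int p dvd j"
  proof (rule ccontr)
    assume "\<not> int p dvd j"
    then have "coprime (int p) j" using p by (simp add: prime_imp_coprime)
    then obtain a b where ab: "a * int p + b * j = 1" using bezout_int[of "int p" j] by auto
    have "of_int a * (of_nat p * x) + of_int b * (of_int j * x) = of_int (a * int p + b * j) * x"
      by (simp add: algebra_simps)
    then have "x \<in> S"
      using add_subgrp_add[OF S add_subgrp_scale[OF S px, of a] add_subgrp_scale[OF S j, of b]] ab by simp
    then show False using x by blast
  qed
next
  assume "int p dvd j"
  then obtain k where "j = k * int p" by (metis dvdE mult.commute)
  then show "of_int j * x \<in> S" using add_subgrp_scale[OF S px, of k] by (simp add: mult.assoc)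
qed

text \<open>A hyperplane of T / W, obtained as a maximal proper subgroup, so that no bases over F_p
  are needed.\<close>

lemma exists_subgroup_of_prime_index:
  fixes T :: "'a::ring_1 set"
  assumes p: "prime (p::nat)" and W: "add_subgrp W" and T: "add_subgrp T" and WT: "W \<subset> T"
    and fin: "idx T W > 0" and el: "\<And>x. x \<in> T \<Longrightarrow> of_nat p * x \<in> W"
  obtains T0 x where "add_subgrp T0" "W \<subseteq> T0" "T0 \<subseteq> T" "idx T T0 = p" "x \<in> T" "x \<notin> T0"
    "\<And>y. y \<in> T \<Longrightarrow> \<exists>j. y - of_int j * x \<in> T0"
proof -
  let ?A = "{U. add_subgrp U \<and> W \<subseteq> U \<and> U \<subseteq> T} - {T}"
  have "finite ?A" using finite_intermediate_subgroups[OF W idx_pos_imp_finite[OF fin]] by blast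
  moreover have "W \<in> ?A" using W WT by auto
  ultimately have "\<exists>T0\<in>?A. \<forall>U\<in>?A. T0 \<subseteq> U \<longrightarrow> T0 = U" by (intro finite_has_maximal) blast+
  then obtain T0 where T0: "T0 \<in> ?A" and max: "\<forall>U\<in>?A. T0 \<subseteq> U \<longrightarrow> T0 = U" by (rule bexE)
  from T0 have sT0: "add_subgrp T0" "W \<subseteq> T0" "T0 \<subset> T" by auto
  then obtain x where x: "x \<in> T" "x \<notin> T0" by blast
  let ?E = "{u + of_int j * x | u j. u \<in> T0}"
  have E: "add_subgrp ?E" "T0 \<subseteq> ?E" "x \<in> ?E" by (rule add_subgrp_cyclic_ext[OF sT0(1)])+
  have ET: "?E \<subseteq> T" using sT0(3) add_subgrp_scale[OF T x(1)] add_subgrp_add[OF T] by blast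
  have "?E = T"
  proof (rule ccontr)
    assume "?E \<noteq> T"
    then have "?E \<in> ?A" using E ET sT0(2) by blast
    then have "T0 = ?E" using max E(2) by blast
    then show False using E(3) x(2) by blast
  qed
  then have gen: "\<exists>j. y - of_int j * x \<in> T0" if y: "y \<in> T" for y
  proof -
    obtain u j where "u \<in> T0" "y = u + of_int j * x" using y \<open>?E = T\<close> by blast
    then have "y - of_int j * x \<in> T0" by simp
    then show ?thesis ..
  qed
  have "idx T T0 = p"
    by (rule idx_cyclic[OF sT0(1) T x(1) gen])
       (use prime_multiple_mem_iff[OF sT0(1) p _ x(2)] el[OF x(1)] sT0(2) prime_gt_0_nat[OF p] in auto)
  then show ?thesis using that sT0 x gen by blast
qed

lemma card_eq_sum_fibres:
  assumes "finite B" "\<And>a. a \<in> A \<Longrightarrow> f a \<in> B" "\<And>b. b \<in> B \<Longrightarrow> finite {a \<in> A. f a = b}"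
  shows "card A = (\<Sum>b\<in>B. card {a \<in> A. f a = b})"
proof -
  have "A = (\<Union>b\<in>B. {a \<in> A. f a = b})" using assms(2) by blast
  then have "card A = card (\<Union>b\<in>B. {a \<in> A. f a = b})" by simp
  also have "\<dots> = (\<Sum>b\<in>B. card {a \<in> A. f a = b})"
    by (rule card_UN_disjoint) (use assms in auto)
  finally show ?thesis .
qed

text \<open>In terms of F_p-spaces: U / P maps injectively to T / W, and is the graph of a linear
  map from its k-dimensional image to W / P. The proof follows the recursion of \<open>gbin\<close>
  along a hyperplane T0 containing W: subgroups inside T0 are counted by induction, and every other
  U is one of the \<open>idx T0 U'\<close> lifts of U' = U \<inter> T0.\<close>

theorem card_trivially_meeting:
  fixes T :: "'a::ring_1 set" and p :: nat
  assumes p: "prime p" and P: "add_subgrp P" and W: "add_subgrp W" and T: "add_subgrp T"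
    and sub: "P \<subseteq> W" "W \<subseteq> T" and el: "\<And>x. x \<in> T \<Longrightarrow> of_nat p * x \<in> P"
    and d: "idx T W = p ^ d" and w: "idx W P = p ^ w"
  shows "card {U. add_subgrp U \<and> P \<subseteq> U \<and> U \<subseteq> T \<and> U \<inter> W = P \<and> idx U P = p ^ k} = gbin p d k * p ^ (k * w)"
  using T sub(2) el d
proof (induction d arbitrary: T k)
  case 0
  have "W = T" using idx_1_imp_eq[OF W 0(1,2)] 0 by simp
  then have eq: "{U. add_subgrp U \<and> P \<subseteq> U \<and> U \<subseteq> T \<and> U \<inter> W = P \<and> idx U P = p ^ k} = {U. U = P \<and> idx P P = p ^ k}"
    using P sub by (auto simp: Int_absorb2)
  have k0: "idx P P = p ^ k \<longleftrightarrow> k = 0"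
    using idx_self[OF P] prime_gt_1_nat[OF p] by (metis less_not_refl one_less_power power_0 neq0_conv)
  show ?case unfolding eq k0 by (cases k) simp_all
next
  case (Suc d)
  have pp: "p > 1" using prime_gt_1_nat[OF p] .
  have "W \<noteq> T" using idx_self[OF W] Suc.prems(4) pp by (metis less_numeral_extra(4) one_less_power zero_less_Suc)
  then have WT: "W \<subset> T" using Suc.prems by blast
  have fin: "idx T W > 0" using Suc.prems pp by simp
  have elW: "of_nat p * x \<in> W" if "x \<in> T" for x using Suc.prems(3)[OF that] sub by blast
  obtain T0 x where T0: "add_subgrp T0" "W \<subseteq> T0" "T0 \<subseteq> T" "idx T T0 = p" and x: "x \<in> T" "x \<notin> T0"
    and gen: "\<And>y. y \<in> T \<Longrightarrow> \<exists>j. y - of_int j * x \<in> T0"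
    using exists_subgroup_of_prime_index[OF p W Suc.prems(1) WT fin elW] by metis
  have PT0: "P \<subseteq> T0" using sub T0 by blast
  have rel: "of_int j * x \<in> T0 \<longleftrightarrow> int p dvd j" for j
    by (rule prime_multiple_mem_iff[OF T0(1) p _ x(2)]) (use Suc.prems(3)[OF x(1)] PT0 in blast)
  have d0: "idx T0 W = p ^ d"
    using idx_mult[OF W T0(1) Suc.prems(1) T0(2,3)] Suc.prems(4) T0(4) pp by simp
  have dP: "idx T0 P = p ^ (d + w)" using idx_mult[OF P W T0(1) sub(1) T0(2)] d0 w by (simp add: power_add)
  have TP: "idx T P > 0" using idx_mult[OF P T0(1) Suc.prems(1) PT0 T0(3)] dP T0(4) pp by simp
  let ?V = "\<lambda>T k. {U. add_subgrp U \<and> P \<subseteq> U \<and> U \<subseteq> T \<and> U \<inter> W = P \<and> idx U P = p ^ k}"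
  have finT: "finite {U. add_subgrp U \<and> P \<subseteq> U \<and> U \<subseteq> T}"
    using finite_intermediate_subgroups[OF P idx_pos_imp_finite[OF TP]] .
  then have finV: "finite (?V T k)" for k by (rule rev_finite_subset) auto
  have finV0: "finite (?V T0 k)" for k by (rule rev_finite_subset[OF finT]) (use T0 in auto)
  have IH: "card (?V T0 k) = gbin p d k * p ^ (k * w)" for k
    using Suc.IH[OF T0(1,2) _ d0, of k] Suc.prems(3) T0(3) by blast
  \<comment> \<open>T0 has prime index, so no subgroup lies strictly between T0 and T.\<close>
  have sum_T: "sumset U T0 = T" if U: "add_subgrp U" "U \<subseteq> T" "\<not> U \<subseteq> T0" for U
  proof -
    let ?S = "sumset U T0"
    have S: "add_subgrp ?S" "U \<subseteq> ?S" "T0 \<subseteq> ?S" using add_subgrp_sumset[OF U(1) T0(1)] .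
    have ST: "?S \<subseteq> T" by (rule sumset_least[OF Suc.prems(1) U(2) T0(3)])
    have "p = idx T ?S * idx ?S T0" using idx_mult[OF T0(1) S(1) Suc.prems(1) S(3) ST] T0(4) by simp
    then have "idx T ?S = 1 \<or> idx ?S T0 = 1" using p by (metis prime_product)
    moreover have "idx ?S T0 \<noteq> 1" using idx_1_imp_eq[OF T0(1) S(1,3)] S U by blast
    ultimately show ?thesis using idx_1_imp_eq[OF S(1) Suc.prems(1) ST] by blast
  qed
  show ?case
  proof (cases k)
    case 0
    have "?V T 0 = {P}"
    proof -
      have "U = P" if "add_subgrp U" "P \<subseteq> U" "idx U P = 1" for U
        using idx_1_imp_eq[OF P that] by simp
      then show ?thesis using P sub WT idx_self[OF P] by auto
    qed
    then show ?thesis using 0 by simp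
  next
    case k: (Suc j)
    let ?N = "{U \<in> ?V T k. \<not> U \<subseteq> T0}"
    have split: "?V T k = ?V T0 k \<union> ?N" "?V T0 k \<inter> ?N = {}" using T0(3) by auto
    have fibre: "{U \<in> ?N. U \<inter> T0 = U'} = {U. add_subgrp U \<and> U \<subseteq> T \<and> U \<inter> T0 = U' \<and> sumset U T0 = T}"
      if U': "U' \<in> ?V T0 j" for U'
    proof (intro equalityI subsetI)
      fix U assume "U \<in> {U \<in> ?N. U \<inter> T0 = U'}"
      then show "U \<in> {U. add_subgrp U \<and> U \<subseteq> T \<and> U \<inter> T0 = U' \<and> sumset U T0 = T}" using sum_T by auto
    next
      fix U assume "U \<in> {U. add_subgrp U \<and> U \<subseteq> T \<and> U \<inter> T0 = U' \<and> sumset U T0 = T}"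
      then have U: "add_subgrp U" "U \<subseteq> T" "U \<inter> T0 = U'" "sumset U T0 = T" by auto
      have "\<not> U \<subseteq> T0" using sumset_least[OF T0(1), of U T0] U(4) x by blast
      moreover have "P \<subseteq> U" "U \<inter> W = P" using U U' T0(2) by auto
      moreover have "idx U P = p ^ k"
      proof -
        have "sumset T0 U = sumset U T0" unfolding sumset_def by (metis add.commute)
        then have "idx U U' = p" using idx_sumset[OF T0(1) U(1)] U T0(4) by (simp add: Int_commute)
        then show ?thesis using idx_mult[OF P _ U(1), of U'] U' U k by auto
      qed
      ultimately show "U \<in> {U \<in> ?N. U \<inter> T0 = U'}" using U by auto
    qed
    have to: "U \<inter> T0 \<in> ?V T0 j" if U: "U \<in> ?N" for U
    proof -
      have U: "add_subgrp U" "P \<subseteq> U" "U \<subseteq> T" "U \<inter> W = P" "idx U P = p ^ k" "\<not> U \<subseteq> T0" using that by auto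
      have sI: "add_subgrp (U \<inter> T0)" using add_subgrp_Int[OF U(1) T0(1)] .
      have "sumset T0 U = sumset U T0" unfolding sumset_def by (metis add.commute)
      then have "idx U (U \<inter> T0) = p" using idx_sumset[OF T0(1) U(1)] sum_T[OF U(1,3,6)] T0(4) by (simp add: Int_commute)
      then have "p * idx (U \<inter> T0) P = p * p ^ j"
        using idx_mult[OF P sI U(1)] U PT0 k by auto
      then have "idx (U \<inter> T0) P = p ^ j" using pp by simp
      then show ?thesis using sI U PT0 T0(2) by auto
    qed
    have "card ?N = (\<Sum>U'\<in>?V T0 j. card {U \<in> ?N. U \<inter> T0 = U'})"
    proof (rule card_eq_sum_fibres[OF finV0 to])
      fix U' show "finite {U \<in> ?N. U \<inter> T0 = U'}" by (rule rev_finite_subset[OF finV[of k]]) auto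
    qed
    also have "\<dots> = (\<Sum>U'\<in>?V T0 j. p ^ (d - j) * p ^ w)"
    proof (rule sum.cong[OF refl])
      fix U' assume U': "U' \<in> ?V T0 j"
      then have s: "add_subgrp U'" "P \<subseteq> U'" "U' \<subseteq> T0" "U' \<inter> W = P" "idx U' P = p ^ j" by auto
      have "card {U \<in> ?N. U \<inter> T0 = U'} = idx T0 U'"
        unfolding fibre[OF U']
      proof (rule card_lifts[OF s(1) T0(1) Suc.prems(1) s(3) T0(3) x(1) gen])
        fix i y assume "of_int i * x \<in> T0" "y \<in> T"
        then obtain l where "i = l * int p" using rel by (metis dvdE mult.commute)
        then show "of_int i * y \<in> U'"
          using add_subgrp_scale[OF s(1), of "of_nat p * y" l] Suc.prems(3)[OF \<open>y \<in> T\<close>] s(2)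
          by (auto simp: mult.assoc)
      qed
      also have "\<dots> = p ^ (d - j) * p ^ w"
      proof -
        \<comment> \<open>U' meets W only in P, so it embeds into T0 / W of order
          \<open>p ^ d\<close>. Thus j \<le> d, and the subtraction d - j is not truncated.\<close>
        have "p ^ j \<le> p ^ d"
        proof -
          have "idx (sumset U' W) W = p ^ j"
          proof -
            have "sumset U' W = sumset W U'" unfolding sumset_def by (metis add.commute)
            then show ?thesis using idx_sumset[OF W s(1)] s by (simp add: Int_commute)
          qed
          moreover have "idx T0 W = idx T0 (sumset U' W) * idx (sumset U' W) W"
            by (rule idx_mult[OF W add_subgrp_sumset(1)[OF s(1) W] T0(1) add_subgrp_sumset(3)[OF s(1) W]])
               (rule sumset_least[OF T0(1) s(3) T0(2)])
          ultimately have "p ^ j dvd p ^ d" using d0 by simp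
          then show ?thesis using pp by (simp add: dvd_imp_le)
        qed
        then have "j \<le> d" using pp by (simp add: power_increasing_iff)
        have "p ^ (d + w) = idx T0 U' * p ^ j" using idx_mult[OF P s(1) T0(1) s(2,3)] dP s by simp
        moreover have "p ^ (d + w) = (p ^ (d - j) * p ^ w) * p ^ j"
          using \<open>j \<le> d\<close> by (simp flip: power_add)
        ultimately show ?thesis using pp by simp
      qed
      finally show "card {U \<in> ?N. U \<inter> T0 = U'} = p ^ (d - j) * p ^ w" .
    qed
    also have "\<dots> = gbin p d j * p ^ (j * w) * (p ^ (d - j) * p ^ w)" using IH[of j] by simp
    finally have "card ?N = p ^ (d - j) * gbin p d j * p ^ (k * w)" using k by (simp add: power_add ac_simps)
    moreover have "card (?V T k) = card (?V T0 k) + card ?N"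
      by (subst split(1), rule card_Un_disjoint[OF finV0 _ split(2)])
         (rule rev_finite_subset[OF finV[of k]], blast)
    ultimately show ?thesis using IH[of k] k by (simp add: distrib_right)
  qed
qed

section \<open>Chains of subgroups in an elementary abelian section\<close>

definition subgroup_chains :: "nat \<Rightarrow> 'a::ab_group_add set \<Rightarrow> 'a set \<Rightarrow> nat set \<Rightarrow> (nat \<Rightarrow> 'a set) set" where
  "subgroup_chains p P T I = {f \<in> I \<rightarrow>\<^sub>E {U. add_subgrp U \<and> P \<subseteq> U \<and> U \<subseteq> T}.
     (\<forall>i\<in>I. idx T (f i) = p ^ i) \<and> (\<forall>i\<in>I. \<forall>j\<in>I. i < j \<longrightarrow> f j \<subset> f i)}"

lemma gbin_symmetric_nat: "k \<le> n \<Longrightarrow> gbin (p::nat) n (n - k) = gbin p n k"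
  using gbin_symmetric[of k n "int p"] gbin_hom[of int p n k] gbin_hom[of int p n "n - k"] by simp

text \<open>The case W = P of the previous count; passing from order to index is the symmetry of the
  binomial.\<close>

lemma card_index_subgroups:
  fixes T :: "'a::ring_1 set" and p :: nat
  assumes p: "prime p" and P: "add_subgrp P" and T: "add_subgrp T" and PT: "P \<subseteq> T"
    and el: "\<And>x. x \<in> T \<Longrightarrow> of_nat p * x \<in> P" and m: "idx T P = p ^ m" and j: "j \<le> m"
  shows "card {U. add_subgrp U \<and> P \<subseteq> U \<and> U \<subseteq> T \<and> idx T U = p ^ j} = gbin p m j"
proof -
  have pp: "p > 1" using prime_gt_1_nat[OF p] .
  have "idx T U = p ^ j \<longleftrightarrow> idx U P = p ^ (m - j)" if "add_subgrp U" "P \<subseteq> U" "U \<subseteq> T" for U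
  proof -
    have "idx T U * idx U P = p ^ j * p ^ (m - j)"
      using idx_mult[OF P that(1) T that(2,3)] m j by (simp flip: power_add)
    moreover have "p ^ j > 0" "p ^ (m - j) > 0" using pp by simp_all
    ultimately show ?thesis by (metis mult_cancel1 mult_cancel2 less_not_refl)
  qed
  then have "{U. add_subgrp U \<and> P \<subseteq> U \<and> U \<subseteq> T \<and> idx T U = p ^ j}
      = {U. add_subgrp U \<and> P \<subseteq> U \<and> U \<subseteq> T \<and> U \<inter> P = P \<and> idx U P = p ^ (m - j)}" by blast
  then show ?thesis
    using card_trivially_meeting[OF p P P T subset_refl PT el m, of 0 "m - j"] idx_self[OF P]
      gbin_symmetric_nat[OF j, of p] by simp
qed

text \<open>The largest index j belongs to the smallest member U. The other members form a chain in
  T over U, where T / U has order \<open>p ^ j\<close>; hence P and m vary in the induction while T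
  is fixed.\<close>

lemma card_subgroup_chains:
  fixes T :: "'a::ring_1 set" and p :: nat
  assumes p: "prime p" and T: "add_subgrp T" and "finite I"
    and "add_subgrp P" "P \<subseteq> T" "\<And>x. x \<in> T \<Longrightarrow> of_nat p * x \<in> P" "idx T P = p ^ m" "I \<subseteq> {..m}"
  shows "card (subgroup_chains p P T I) = flag_product p m I"
  using assms(3-)
proof (induction I arbitrary: P m rule: finite_linorder_max_induct)
  case empty
  then show ?case by (simp add: subgroup_chains_def)
next
  case (insert j I)
  have pp: "p > 1" using prime_gt_1_nat[OF p] .
  have lt: "i < j" if "i \<in> I" for i using insert.hyps(2) that by blast
  then have jI: "j \<notin> I" by blast
  have j: "j \<le> m" using insert.prems by simp
  let ?B = "{U. add_subgrp U \<and> P \<subseteq> U \<and> U \<subseteq> T \<and> idx T U = p ^ j}"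
  let ?g = "\<lambda>f. (f j, restrict f I)"
  have finB: "finite ?B"
    by (rule rev_finite_subset[OF finite_intermediate_subgroups[OF insert.prems(1), of T]])
       (use insert.prems pp in \<open>auto intro: idx_pos_imp_finite\<close>)
  have "bij_betw ?g (subgroup_chains p P T (insert j I)) (SIGMA U:?B. subgroup_chains p U T I)"
  proof (rule bij_betwI[where g = "\<lambda>(U, f). f(j := U)"])
    show "?g \<in> subgroup_chains p P T (insert j I) \<rightarrow> (SIGMA U:?B. subgroup_chains p U T I)"
    proof
      fix f assume "f \<in> subgroup_chains p P T (insert j I)"
      then have f: "f \<in> insert j I \<rightarrow>\<^sub>E {U. add_subgrp U \<and> P \<subseteq> U \<and> U \<subseteq> T}"
        "\<forall>i\<in>insert j I. idx T (f i) = p ^ i" "\<forall>i\<in>insert j I. \<forall>k\<in>insert j I. i < k \<longrightarrow> f k \<subset> f i"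
        by (auto simp: subgroup_chains_def)
      have s: "add_subgrp (f i)" "P \<subseteq> f i" "f i \<subseteq> T" if "i \<in> insert j I" for i
        using f(1) that by (auto simp: PiE_def Pi_def)
      have "f j \<in> ?B" using s[of j] f(2) by blast
      moreover have "restrict f I \<in> subgroup_chains p (f j) T I"
        using f s lt by (auto simp: subgroup_chains_def)
      ultimately show "?g f \<in> (SIGMA U:?B. subgroup_chains p U T I)" by blast
    qed
    show "(\<lambda>(U, f). f(j := U)) \<in> (SIGMA U:?B. subgroup_chains p U T I) \<rightarrow> subgroup_chains p P T (insert j I)"
    proof (rule Pi_I, clarify)
      fix U f assume U: "add_subgrp U" "P \<subseteq> U" "U \<subseteq> T" "idx T U = p ^ j" and "f \<in> subgroup_chains p U T I"
      then have f: "f \<in> I \<rightarrow>\<^sub>E {V. add_subgrp V \<and> U \<subseteq> V \<and> V \<subseteq> T}"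
        "\<forall>i\<in>I. idx T (f i) = p ^ i" "\<forall>i\<in>I. \<forall>k\<in>I. i < k \<longrightarrow> f k \<subset> f i"
        by (auto simp: subgroup_chains_def)
      have "U \<subset> f i" if i: "i \<in> I" for i
      proof -
        have "f i \<noteq> U" using f(2) i U(4) lt[OF i] pp by (metis less_not_refl power_inject_exp)
        then show ?thesis using f(1) i by (auto simp: PiE_def Pi_def)
      qed
      moreover have "f(j := U) \<in> insert j I \<rightarrow>\<^sub>E {V. add_subgrp V \<and> P \<subseteq> V \<and> V \<subseteq> T}"
        using f(1) U by (auto simp: PiE_def Pi_def extensional_def)
      moreover have "\<not> j < i" if "i \<in> I" for i using lt[OF that] by simp
      ultimately show "f(j := U) \<in> subgroup_chains p P T (insert j I)"
        using f U by (auto simp: subgroup_chains_def)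
    qed
    show "(\<lambda>(U, f). f(j := U)) (?g f) = f" if "f \<in> subgroup_chains p P T (insert j I)" for f
      using that jI by (auto simp: subgroup_chains_def fun_eq_iff PiE_def extensional_def)
    show "?g ((\<lambda>(U, f). f(j := U)) z) = z" if "z \<in> (SIGMA U:?B. subgroup_chains p U T I)" for z
      using that jI by (auto simp: subgroup_chains_def fun_eq_iff PiE_def extensional_def)
  qed
  then have "card (subgroup_chains p P T (insert j I)) = card (SIGMA U:?B. subgroup_chains p U T I)"
    by (rule bij_betw_same_card)
  also have "\<dots> = (\<Sum>U\<in>?B. card (subgroup_chains p U T I))"
  proof (rule card_SigmaI[OF finB], rule ballI)
    fix U assume U: "U \<in> ?B"
    have "finite {V. add_subgrp V \<and> U \<subseteq> V \<and> V \<subseteq> T}"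
      by (rule finite_intermediate_subgroups) (use U pp in \<open>auto intro: idx_pos_imp_finite\<close>)
    then show "finite (subgroup_chains p U T I)" unfolding subgroup_chains_def
      using finite_PiE[OF insert.hyps(1)] by (simp add: finite_PiE insert.hyps(1))
  qed
  also have "\<dots> = (\<Sum>U\<in>?B. flag_product p j I)"
  proof (rule sum.cong[OF refl])
    fix U assume U: "U \<in> ?B"
    have "of_nat p * x \<in> U" if "x \<in> T" for x using insert.prems(3)[OF that] U by blast
    moreover have "I \<subseteq> {..j}" using lt by (auto intro: less_imp_le)
    ultimately show "card (subgroup_chains p U T I) = flag_product p j I"
      using insert.IH[of U j] U by blast
  qed
  also have "\<dots> = gbin p m j * flag_product p j I"
    using card_index_subgroups[OF p insert.prems(1) T insert.prems(2-4) j] by simp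
  finally show ?case using flag_product_insert_max[OF insert.hyps(1) lt j, of p] by simp
qed

section \<open>Integer lattices\<close>

text \<open>Vectors vanish from position m on instead of being undefined there. Lattices of all
  ranks then lie in one additive group, and \<open>lat a\<close> is contained in
  \<open>lat b\<close> for a \<le> b.\<close>

definition lat :: "nat \<Rightarrow> (nat \<Rightarrow> int) set" where
  "lat m = {v. \<forall>i\<ge>m. v i = 0}"

definition mlat :: "nat \<Rightarrow> nat \<Rightarrow> (nat \<Rightarrow> int) set" where
  "mlat q m = {v \<in> lat m. \<forall>i. int q dvd v i}"

definition unitv :: "nat \<Rightarrow> nat \<Rightarrow> int" where
  "unitv k = (\<lambda>i. if i = k then 1 else 0)"

lemma of_int_fun_apply [simp]: "(of_int k :: 'b \<Rightarrow> 'a::ring_1) i = of_int k"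
  by (cases k rule: int_diff_cases) simp

lemma add_subgrp_lat: "add_subgrp (lat m)"
  by (auto simp: add_subgrp_def lat_def)

lemma add_subgrp_mlat: "add_subgrp (mlat q m)"
  by (auto simp: add_subgrp_def lat_def mlat_def)

lemma mlat_subset_lat: "mlat q m \<subseteq> lat m"
  by (auto simp: mlat_def)

lemma lat_scale_mem_mlat: "x \<in> lat m \<Longrightarrow> of_nat q * x \<in> mlat q m"
  by (auto simp: mlat_def lat_def)

lemma unitv_mem_lat: "k < m \<Longrightarrow> unitv k \<in> lat m"
  by (auto simp: unitv_def lat_def)

text \<open>The first k coordinates are made divisible by q for growing k; each step is a cyclic
  quotient of order q generated by a unit vector.\<close>

lemma idx_lat_mlat:
  assumes "q > 0"
  shows "idx (lat m) (mlat q m) = q ^ m"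
proof -
  define R where "R = (\<lambda>k. {v \<in> lat m. \<forall>i<k. int q dvd v i})"
  have sR: "add_subgrp (R k)" for k by (auto simp: add_subgrp_def lat_def R_def)
  have step: "idx (R k) (R (Suc k)) = q" if "k < m" for k
  proof (rule idx_cyclic[OF sR sR, of "unitv k"])
    show "unitv k \<in> R k" using unitv_mem_lat[OF that] by (auto simp: R_def unitv_def)
    show "\<exists>j. y - of_int j * unitv k \<in> R (Suc k)" if "y \<in> R k" for y
      using that \<open>k < m\<close> by (intro exI[of _ "y k"]) (auto simp: R_def unitv_def lat_def less_Suc_eq)
    show "of_int j * unitv k \<in> R (Suc k) \<longleftrightarrow> int q dvd j" for j
      using that by (auto simp: R_def unitv_def lat_def)
  qed (use assms in auto)
  have "k \<le> m \<Longrightarrow> idx (lat m) (R k) = q ^ k" for k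
  proof (induction k)
    case 0
    have "R 0 = lat m" by (simp add: R_def)
    then show ?case using idx_self[OF add_subgrp_lat] by simp
  next
    case (Suc k)
    have "idx (lat m) (R (Suc k)) = idx (lat m) (R k) * idx (R k) (R (Suc k))"
      by (rule idx_mult[OF sR sR add_subgrp_lat]) (auto simp: R_def)
    then show ?case using Suc step[of k] by simp
  qed
  moreover have "R m = mlat q m"
    by (auto simp: R_def mlat_def lat_def) (metis dvd_0_right not_less)
  ultimately show ?thesis by (metis le_refl)
qed

section \<open>Flags in the reduction of a lattice\<close>

definition red :: "nat \<Rightarrow> nat \<Rightarrow> (nat \<Rightarrow> int) \<Rightarrow> nat \<Rightarrow> nat" where
  "red q m v = (\<lambda>j\<in>{0..<m}. nat (v j mod int q))"

text \<open>Correspondence between subspaces of F_q^m and subgroups lying between q Z^m and Z^m; it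
  moves the flag count into the additive setting.\<close>

definition lift_set :: "nat \<Rightarrow> nat \<Rightarrow> (nat \<Rightarrow> nat) set \<Rightarrow> (nat \<Rightarrow> int) set" where
  "lift_set q m W = {v \<in> lat m. red q m v \<in> W}"

context
  fixes q m :: nat
  assumes q: "prime q"
begin

lemma q_pos: "q > 0"
  using prime_gt_0_nat[OF q] .

lemma red_mem_vecs: "red q m v \<in> vecs q m"
  using q_pos by (auto simp: red_def vecs_def nat_less_iff)

lemma red_eq_iff: "v \<in> lat m \<Longrightarrow> w \<in> lat m \<Longrightarrow> red q m v = red q m w \<longleftrightarrow> v - w \<in> mlat q m"
proof -
  assume vw: "v \<in> lat m" "w \<in> lat m"
  have "red q m v = red q m w \<longleftrightarrow> (\<forall>i<m. nat (v i mod int q) = nat (w i mod int q))"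
    by (auto simp: red_def fun_eq_iff)
  also have "\<dots> \<longleftrightarrow> (\<forall>i<m. v i mod int q = w i mod int q)"
    using q_pos by (simp add: nat_eq_iff)
  also have "\<dots> \<longleftrightarrow> (\<forall>i<m. int q dvd v i - w i)" by (simp add: mod_eq_dvd_iff)
  also have "\<dots> \<longleftrightarrow> v - w \<in> mlat q m"
    using vw by (auto simp: mlat_def lat_def) (metis dvd_0_right not_less diff_self)
  finally show ?thesis .
qed

lemma red_surj: "w \<in> vecs q m \<Longrightarrow> \<exists>v\<in>lat m. red q m v = w"
  by (rule bexI[of _ "\<lambda>i. if i < m then int (w i) else 0"])
     (auto simp: vecs_def red_def lat_def fun_eq_iff PiE_def extensional_def Pi_def)

lemma red_zero: "red q m 0 = vzero m"
  by (auto simp: red_def vzero_def)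

lemma red_add: "red q m (v + w) = vadd q m (red q m v) (red q m w)"
proof
  fix j
  have "nat ((v j + w j) mod int q) = (nat (v j mod int q) + nat (w j mod int q)) mod q"
  proof -
    have "int ((nat (v j mod int q) + nat (w j mod int q)) mod q) = (v j mod int q + w j mod int q) mod int q"
      using q_pos by (simp add: zmod_int)
    then show ?thesis by (metis mod_add_eq nat_int)
  qed
  then show "red q m (v + w) j = vadd q m (red q m v) (red q m w) j" by (simp add: red_def vadd_def)
qed

lemma red_scale: "red q m (of_nat c * v) = vsmult q m c (red q m v)"
proof
  fix j
  have "nat ((int c * v j) mod int q) = (c * nat (v j mod int q)) mod q"
  proof -
    have "int ((c * nat (v j mod int q)) mod q) = (int c * (v j mod int q)) mod int q"
      using q_pos by (simp add: zmod_int)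
    then show ?thesis by (metis mod_mult_right_eq nat_int)
  qed
  then show "red q m (of_nat c * v) j = vsmult q m c (red q m v) j" by (simp add: red_def vsmult_def)
qed

lemma red_image_lift_set: "W \<subseteq> vecs q m \<Longrightarrow> red q m ` lift_set q m W = W"
  using red_surj by (fastforce simp: lift_set_def)

lemma lift_set_subspace:
  assumes "subspace_mod q m W"
  shows "add_subgrp (lift_set q m W)" "mlat q m \<subseteq> lift_set q m W" "lift_set q m W \<subseteq> lat m"
proof -
  have W: "vzero m \<in> W" "\<And>v w. v \<in> W \<Longrightarrow> w \<in> W \<Longrightarrow> vadd q m v w \<in> W" "\<And>c v. c < q \<Longrightarrow> v \<in> W \<Longrightarrow> vsmult q m c v \<in> W"
    using assms by (auto simp: subspace_mod_def)
  show "lift_set q m W \<subseteq> lat m" by (auto simp: lift_set_def)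
  show "mlat q m \<subseteq> lift_set q m W"
  proof
    fix v assume v: "v \<in> mlat q m"
    then have "red q m v = red q m 0"
      using red_eq_iff[of v 0] mlat_subset_lat add_subgrp_0[OF add_subgrp_lat] by auto
    then show "v \<in> lift_set q m W" using v mlat_subset_lat W(1) red_zero by (auto simp: lift_set_def)
  qed
  have "x - y \<in> lift_set q m W" if "x \<in> lift_set q m W" "y \<in> lift_set q m W" for x y
  proof -
    have xy: "x \<in> lat m" "y \<in> lat m" "red q m x \<in> W" "red q m y \<in> W" using that by (auto simp: lift_set_def)
    have d: "x - y \<in> lat m" using add_subgrp_diff[OF add_subgrp_lat] xy by blast
    \<comment> \<open>\<open>subspace_mod\<close> offers only sums and multiples by naturals below
      q, so - y is replaced by the congruent (q - 1) y.\<close>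
    have s: "x + of_nat (q - 1) * y \<in> lat m" using xy by (auto simp: lat_def)
    have "x - y - (x + of_nat (q - 1) * y) = of_nat q * (- y)"
      using q_pos by (simp add: of_nat_diff algebra_simps)
    then have "x - y - (x + of_nat (q - 1) * y) \<in> mlat q m"
      using lat_scale_mem_mlat[of "- y" m q] add_subgrp_uminus[OF add_subgrp_lat xy(2)] by simp
    then have "red q m (x - y) = red q m (x + of_nat (q - 1) * y)" using red_eq_iff[OF d s] by simp
    also have "\<dots> \<in> W" unfolding red_add red_scale using xy W q_pos by simp
    finally show ?thesis using d by (simp add: lift_set_def)
  qed
  moreover have "0 \<in> lift_set q m W"
    using W(1) red_zero add_subgrp_0[OF add_subgrp_lat] by (simp add: lift_set_def)
  ultimately show "add_subgrp (lift_set q m W)" by (simp add: add_subgrp_def)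
qed

lemma red_image_subspace:
  assumes U: "add_subgrp U" "mlat q m \<subseteq> U" "U \<subseteq> lat m"
  shows "subspace_mod q m (red q m ` U)" "lift_set q m (red q m ` U) = U"
proof -
  have "vadd q m (red q m v) (red q m w) \<in> red q m ` U" if "v \<in> U" "w \<in> U" for v w
    using add_subgrp_add[OF U(1) that] red_add[of v w] by (metis imageI)
  moreover have "vsmult q m c (red q m v) \<in> red q m ` U" if "v \<in> U" for c v
    using add_subgrp_scale_nat[OF U(1) that, of c] red_scale[of c v] by (metis imageI)
  moreover have "vzero m \<in> red q m ` U" using add_subgrp_0[OF U(1)] red_zero by (metis imageI)
  ultimately show "subspace_mod q m (red q m ` U)"
    unfolding subspace_mod_def using red_mem_vecs by blast
  show "lift_set q m (red q m ` U) = U"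
  proof
    show "U \<subseteq> lift_set q m (red q m ` U)" using U by (auto simp: lift_set_def)
    show "lift_set q m (red q m ` U) \<subseteq> U"
    proof
      fix v assume "v \<in> lift_set q m (red q m ` U)"
      then obtain u where u: "v \<in> lat m" "u \<in> U" "red q m v = red q m u" by (auto simp: lift_set_def)
      then have "v - u \<in> U" using red_eq_iff[of v u] U by blast
      then show "v \<in> U" using add_subgrp_add[OF U(1) _ u(2), of "v - u"] by simp
    qed
  qed
qed

lemma card_red_image:
  assumes U: "U \<subseteq> lat m"
  shows "card (red q m ` U) = idx U (mlat q m)"
  unfolding idx_def
proof (rule card_image_cong_kernel)
  fix x y assume "x \<in> U" "y \<in> U"
  then show "red q m x = red q m y \<longleftrightarrow> add_coset (mlat q m) x = add_coset (mlat q m) y"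
    using U red_eq_iff by (simp add: subset_iff add_coset_eq_iff[OF add_subgrp_mlat])
qed

section \<open>Dimension over F_q expressed by cardinality and index\<close>

lemma lincomb_append:
  assumes "length cs = length vs"
  shows "lincomb q m (cs @ [c]) (vs @ [v]) = vadd q m (lincomb q m cs vs) (vsmult q m c v)"
  using assms by (auto simp: lincomb_def vadd_def vsmult_def fun_eq_iff nth_append mod_simps)

lemma lincomb_Nil: "lincomb q m [] [] = vzero m"
  by (auto simp: lincomb_def vzero_def)

text \<open>Coefficients are naturals, so their difference \<open>es\<close> is formed in the
  integers and reduced below q before linear independence applies.\<close>

lemma lincomb_inj:
  assumes ind: "lin_indep_mod q m vs"
    and cs: "length cs = length vs" "set cs \<subseteq> {0..<q}" and ds: "length ds = length vs" "set ds \<subseteq> {0..<q}"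
    and eq: "lincomb q m cs vs = lincomb q m ds vs"
  shows "cs = ds"
proof -
  define es where "es = map (\<lambda>k. nat ((int (cs ! k) - int (ds ! k)) mod int q)) [0..<length vs]"
  have es: "length es = length vs" by (simp add: es_def)
  have es_nth: "int (es ! k) = (int (cs ! k) - int (ds ! k)) mod int q" if "k < length vs" for k
    using that q_pos by (simp add: es_def)
  have "set es \<subseteq> {0..<q}" using q_pos by (auto simp: es_def nat_less_iff)
  moreover have "lincomb q m es vs = vzero m"
  proof
    fix j
    show "lincomb q m es vs j = vzero m j"
    proof (cases "j < m")
      case True
      let ?v = "\<lambda>k. int ((vs ! k) j)"
      have "(\<Sum>k<length vs. cs ! k * (vs ! k) j) mod q = (\<Sum>k<length vs. ds ! k * (vs ! k) j) mod q"
        using fun_cong[OF eq, of j] True by (simp add: lincomb_def)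
      then have "int (\<Sum>k<length vs. cs ! k * (vs ! k) j) mod int q = int (\<Sum>k<length vs. ds ! k * (vs ! k) j) mod int q"
        by (metis zmod_int)
      then have d: "int q dvd (\<Sum>k<length vs. int (cs ! k) * ?v k) - (\<Sum>k<length vs. int (ds ! k) * ?v k)"
        by (simp add: mod_eq_dvd_iff)
      have "int q dvd (\<Sum>k<length vs. (int (es ! k) - (int (cs ! k) - int (ds ! k))) * ?v k)"
      proof (rule dvd_sum)
        fix k assume "k \<in> {..<length vs}"
        then have "int q dvd int (es ! k) - (int (cs ! k) - int (ds ! k))"
          using es_nth[of k] by (simp add: mod_eq_dvd_iff[symmetric])
        then show "int q dvd (int (es ! k) - (int (cs ! k) - int (ds ! k))) * ?v k" by simp
      qed
      then have "int q dvd (\<Sum>k<length vs. (int (es ! k) - (int (cs ! k) - int (ds ! k))) * ?v k)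
          + ((\<Sum>k<length vs. int (cs ! k) * ?v k) - (\<Sum>k<length vs. int (ds ! k) * ?v k))"
        using d by (rule dvd_add)
      also have "\<dots> = (\<Sum>k<length vs. int (es ! k) * ?v k)"
        by (simp add: sum_subtractf[symmetric] sum.distrib[symmetric] algebra_simps)
      finally have "int q dvd int (\<Sum>k<length vs. es ! k * (vs ! k) j)" by simp
      then have "q dvd (\<Sum>k<length vs. es ! k * (vs ! k) j)" by (simp only: int_dvd_int_iff)
      then show ?thesis using True by (simp add: lincomb_def vzero_def dvd_eq_mod_eq_0)
    qed (simp add: lincomb_def vzero_def)
  qed
  ultimately have zero: "set es \<subseteq> {0}" using ind es unfolding lin_indep_mod_def by blast
  show ?thesis
  proof (rule nth_equalityI)
    fix k assume "k < length cs"
    then have k: "k < length vs" using cs by simp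
    then have "es ! k \<in> set es" using es by simp
    then have "int (es ! k) = 0" using zero by auto
    then have "int (cs ! k) mod int q = int (ds ! k) mod int q"
      using es_nth[OF k] by (simp add: mod_eq_dvd_iff dvd_eq_mod_eq_0)
    moreover have "cs ! k \<in> set cs" "ds ! k \<in> set ds" using k cs ds by simp_all
    then have "cs ! k < q" "ds ! k < q" using cs ds by auto
    ultimately show "cs ! k = ds ! k" by simp
  qed (use cs ds in simp)
qed

lemma has_dim_imp_card: "has_dim q m W d \<Longrightarrow> card W = q ^ d"
proof -
  assume "has_dim q m W d"
  then obtain vs where vs: "length vs = d" "lin_indep_mod q m vs" "span_mod q m vs = W"
    by (auto simp: has_dim_def)
  let ?C = "{cs. set cs \<subseteq> {0..<q} \<and> length cs = d}"
  have "W = (\<lambda>cs. lincomb q m cs vs) ` ?C" using vs by (auto simp: span_mod_def)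
  moreover have "inj_on (\<lambda>cs. lincomb q m cs vs) ?C"
    using lincomb_inj[OF vs(2)] vs(1) by (auto intro!: inj_onI)
  ultimately have "card W = card ?C" by (simp add: card_image)
  then show ?thesis by (simp add: card_lists_length_eq)
qed

text \<open>A basis of a hyperplane T0 is extended by the reduction of x. Independence of the new
  vector holds because c x lies in T0 only if q divides c.\<close>

lemma has_dim_red_image:
  assumes "add_subgrp U" "mlat q m \<subseteq> U" "U \<subseteq> lat m" "idx U (mlat q m) = q ^ d"
  shows "has_dim q m (red q m ` U) d"
  using assms
proof (induction d arbitrary: U)
  case 0
  have "mlat q m = U" using idx_1_imp_eq[OF add_subgrp_mlat 0(1,2)] 0(4) by simp
  moreover have "red q m v = vzero m" if "v \<in> mlat q m" for v
    using red_eq_iff[of v 0] that mlat_subset_lat add_subgrp_0[OF add_subgrp_lat] red_zero by auto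
  ultimately have "red q m ` U = {vzero m}"
    using add_subgrp_0[OF add_subgrp_mlat, of q m] by (auto simp: image_iff)
  moreover have "lin_indep_mod q m []" "span_mod q m [] = {vzero m}"
    by (auto simp: lin_indep_mod_def span_mod_def lincomb_Nil)
  ultimately show ?case unfolding has_dim_def by (intro exI[of _ "[]"]) auto
next
  case (Suc d)
  have q1: "q > 1" using prime_gt_1_nat[OF q] .
  have ne: "mlat q m \<noteq> U" using idx_self[OF add_subgrp_mlat, of q m] Suc.prems(4) q1
    by (metis less_not_refl one_less_power zero_less_Suc)
  then have sub: "mlat q m \<subset> U" using Suc.prems by blast
  have el: "of_nat q * x \<in> mlat q m" if "x \<in> U" for x using lat_scale_mem_mlat that Suc.prems by blast
  obtain T0 x where T0: "add_subgrp T0" "mlat q m \<subseteq> T0" "T0 \<subseteq> U" "idx U T0 = q" and x: "x \<in> U" "x \<notin> T0"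
    and gen: "\<And>y. y \<in> U \<Longrightarrow> \<exists>j. y - of_int j * x \<in> T0"
    using exists_subgroup_of_prime_index[OF q add_subgrp_mlat Suc.prems(1) sub _ el] Suc.prems(4) q1
    by (metis less_trans zero_less_one zero_less_power)
  have T0L: "T0 \<subseteq> lat m" using T0 Suc.prems by blast
  have "idx T0 (mlat q m) = q ^ d"
    using idx_mult[OF add_subgrp_mlat T0(1) Suc.prems(1) T0(2,3)] Suc.prems(4) T0(4) q1 by simp
  then obtain vs where vs: "length vs = d" "set vs \<subseteq> red q m ` T0" "lin_indep_mod q m vs" "span_mod q m vs = red q m ` T0"
    using Suc.IH[OF T0(1,2) T0L] by (auto simp: has_dim_def)
  have rel: "of_int j * x \<in> T0 \<longleftrightarrow> int q dvd j" for j
    by (rule prime_multiple_mem_iff[OF T0(1) q _ x(2)]) (use el[OF x(1)] T0(2) in blast)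
  let ?vs = "vs @ [red q m x]"
  have lc: "lincomb q m (cs @ [c]) ?vs = red q m (t + of_nat c * x)"
    if "length cs = length vs" "lincomb q m cs vs = red q m t" for cs c t
    using that by (simp add: lincomb_append red_add red_scale)
  have "span_mod q m ?vs = red q m ` U"
  proof
    show "span_mod q m ?vs \<subseteq> red q m ` U"
    proof
      fix w assume "w \<in> span_mod q m ?vs"
      then obtain es where es: "w = lincomb q m es ?vs" "length es = Suc (length vs)" "set es \<subseteq> {0..<q}"
        by (auto simp: span_mod_def)
      then obtain cs c where cs: "es = cs @ [c]" "length cs = length vs" by (metis length_Suc_conv_rev)
      then have "lincomb q m cs vs \<in> red q m ` T0" using es vs(4) by (auto simp: span_mod_def)
      then obtain t where t: "t \<in> T0" "lincomb q m cs vs = red q m t" by blast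
      have "t + of_nat c * x \<in> U"
        using t T0(3) add_subgrp_add[OF Suc.prems(1)] add_subgrp_scale_nat[OF Suc.prems(1) x(1)] by blast
      then show "w \<in> red q m ` U" using lc[OF cs(2) t(2)] es(1) cs(1) by blast
    qed
    show "red q m ` U \<subseteq> span_mod q m ?vs"
    proof
      fix w assume "w \<in> red q m ` U"
      then obtain y where y: "y \<in> U" "w = red q m y" by blast
      obtain j where j: "y - of_int j * x \<in> T0" using gen[OF y(1)] by blast
      define c where "c = nat (j mod int q)"
      have c: "c < q" "int c = j mod int q" using q_pos by (auto simp: c_def nat_less_iff)
      have "int q dvd j - int c" using c by (simp add: mod_eq_dvd_iff[symmetric])
      then have "of_int (j - int c) * x \<in> T0" using rel by blast
      then have t: "y - of_nat c * x \<in> T0"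
        using add_subgrp_add[OF T0(1) j] by (fastforce simp: algebra_simps)
      then obtain cs where cs: "length cs = length vs" "set cs \<subseteq> {0..<q}" "lincomb q m cs vs = red q m (y - of_nat c * x)"
        using vs(4) by (force simp: span_mod_def)
      have "w = lincomb q m (cs @ [c]) ?vs" using lc[OF cs(1,3), of c] y by simp
      moreover have "length (cs @ [c]) = length ?vs" "set (cs @ [c]) \<subseteq> {0..<q}" using cs c by auto
      ultimately show "w \<in> span_mod q m ?vs" unfolding span_mod_def by blast
    qed
  qed
  moreover have "lin_indep_mod q m ?vs"
    unfolding lin_indep_mod_def
  proof (intro allI impI)
    fix es assume h: "length es = length ?vs \<and> set es \<subseteq> {0..<q} \<and> lincomb q m es ?vs = vzero m"
    then have "length es = Suc (length vs)" by simp
    then obtain cs c where cs: "es = cs @ [c]" "length cs = length vs" by (metis length_Suc_conv_rev)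
    then have s: "set cs \<subseteq> {0..<q}" "c < q" using h by auto
    then have "lincomb q m cs vs \<in> red q m ` T0" using cs vs(4) by (auto simp: span_mod_def)
    then obtain t where t: "t \<in> T0" "lincomb q m cs vs = red q m t" by blast
    have "red q m (t + of_nat c * x) = red q m 0" using lc[OF cs(2) t(2), of c] h cs(1) red_zero by simp
    moreover have "t + of_nat c * x \<in> lat m"
      using t T0L x(1) Suc.prems(3) add_subgrp_add[OF add_subgrp_lat] add_subgrp_scale_nat[OF add_subgrp_lat] by blast
    ultimately have "t + of_nat c * x \<in> T0"
      using red_eq_iff[of "t + of_nat c * x" 0] add_subgrp_0[OF add_subgrp_lat] T0(2) by auto
    then have "of_int (int c) * x \<in> T0" using add_subgrp_add_iff[OF T0(1) t(1)] by simp
    then have "int q dvd int c" using rel by blast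
    then have "q dvd c" by (simp only: int_dvd_int_iff)
    then have c0: "c = 0" using s(2) by (metis dvd_imp_le not_le neq0_conv)
    then have "lincomb q m cs vs = vzero m"
      using h cs t lc[OF cs(2) t(2), of c] by simp
    then have "set cs \<subseteq> {0}" using vs(3) cs(2) s(1) unfolding lin_indep_mod_def by blast
    then show "set es \<subseteq> {0}" using cs(1) c0 by simp
  qed
  moreover have "set ?vs \<subseteq> red q m ` U" using vs(2) T0(3) x(1) by auto
  ultimately show ?case unfolding has_dim_def using vs(1) by (intro exI[of _ ?vs]) simp
qed

text \<open>One direction counts the vectors of the subspace, the other constructs a basis.
  Dimension m - i becomes index \<open>q ^ i\<close> because the two indices multiply to
  \<open>q ^ m\<close>.\<close>

lemma has_dim_iff_idx:
  assumes "subspace_mod q m W" "i \<le> m"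
  shows "has_dim q m W (m - i) \<longleftrightarrow> idx (lat m) (lift_set q m W) = q ^ i"
proof -
  let ?U = "lift_set q m W"
  have U: "add_subgrp ?U" "mlat q m \<subseteq> ?U" "?U \<subseteq> lat m" using lift_set_subspace[OF assms(1)] .
  have W: "red q m ` ?U = W" using assms(1) red_image_lift_set by (simp add: subspace_mod_def)
  have "has_dim q m W (m - i) \<longleftrightarrow> idx ?U (mlat q m) = q ^ (m - i)"
    using has_dim_imp_card[of W "m - i"] card_red_image[OF U(3)] has_dim_red_image[OF U] W by auto
  moreover have "idx (lat m) ?U * idx ?U (mlat q m) = q ^ i * q ^ (m - i)"
    using idx_mult[OF add_subgrp_mlat U(1) add_subgrp_lat U(2,3)] idx_lat_mlat[OF q_pos, of m] assms(2)
    by (simp flip: power_add)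
  moreover have "q ^ i > 0" "q ^ (m - i) > 0" using q_pos by simp_all
  ultimately show ?thesis by (metis mult_cancel1 mult_cancel2 less_not_refl)
qed

lemma lift_set_mono_iff:
  assumes "V \<subseteq> vecs q m" "W \<subseteq> vecs q m"
  shows "lift_set q m V \<subset> lift_set q m W \<longleftrightarrow> V \<subset> W"
proof -
  have "lift_set q m V \<subseteq> lift_set q m W \<longleftrightarrow> V \<subseteq> W"
    if "V \<subseteq> vecs q m" "W \<subseteq> vecs q m" for V W
    using red_image_lift_set[OF that(1)] red_image_lift_set[OF that(2)] image_mono[of "lift_set q m V" "lift_set q m W" "red q m"]
    by (auto simp: lift_set_def)
  then show ?thesis using assms by (simp add: less_le_not_le)
qed

lemma card_flags:
  assumes I: "I \<subseteq> {..m}"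
  shows "flag_count q m I = flag_product q m I"
proof -
  have fin: "finite I" using I by (rule finite_subset) simp
  let ?F = "\<lambda>f. \<lambda>i\<in>I. lift_set q m (f i)" and ?G = "\<lambda>g. \<lambda>i\<in>I. red q m ` (g i)"
  have "bij_betw ?F (flags q m I) (subgroup_chains q (mlat q m) (lat m) I)"
  proof (rule bij_betwI[where g = ?G])
    show "?F \<in> flags q m I \<rightarrow> subgroup_chains q (mlat q m) (lat m) I"
    proof
      fix f assume f: "f \<in> flags q m I"
      then have s: "subspace_mod q m (f i)" "has_dim q m (f i) (m - i)" "f i \<subseteq> vecs q m" if "i \<in> I" for i
        using that by (auto simp: flags_def subspace_mod_def)
      have lt: "f j \<subset> f i" if "i \<in> I" "j \<in> I" "i < j" for i j using f that by (auto simp: flags_def)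
      have "lift_set q m (f j) \<subset> lift_set q m (f i)" if "i \<in> I" "j \<in> I" "i < j" for i j
        using lift_set_mono_iff[OF s(3)[OF that(2)] s(3)[OF that(1)]] lt[OF that] by (simp only:)
      moreover have "idx (lat m) (lift_set q m (f i)) = q ^ i" if i: "i \<in> I" for i
        using has_dim_iff_idx[OF s(1)[OF i]] s(2)[OF i] I i by auto
      moreover have "?F f \<in> I \<rightarrow>\<^sub>E {U. add_subgrp U \<and> mlat q m \<subseteq> U \<and> U \<subseteq> lat m}"
        using lift_set_subspace[OF s(1)] by (simp add: PiE_def Pi_def)
      ultimately show "?F f \<in> subgroup_chains q (mlat q m) (lat m) I" by (simp add: subgroup_chains_def)
    qed
    show "?G \<in> subgroup_chains q (mlat q m) (lat m) I \<rightarrow> flags q m I"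
    proof
      fix g assume g: "g \<in> subgroup_chains q (mlat q m) (lat m) I"
      have s: "add_subgrp (g i)" "mlat q m \<subseteq> g i" "g i \<subseteq> lat m" "idx (lat m) (g i) = q ^ i" if "i \<in> I" for i
        using g that by (auto simp: subgroup_chains_def PiE_def Pi_def)
      have t: "subspace_mod q m (red q m ` g i)" "lift_set q m (red q m ` g i) = g i" if "i \<in> I" for i
        using red_image_subspace[OF s(1-3)[OF that]] by auto
      have v: "red q m ` g i \<subseteq> vecs q m" for i using red_mem_vecs by blast
      have "has_dim q m (red q m ` g i) (m - i)" if "i \<in> I" for i
        using has_dim_iff_idx[OF t(1)[OF that]] t(2)[OF that] s(4)[OF that] I that by auto
      moreover have "red q m ` g j \<subset> red q m ` g i" if "i \<in> I" "j \<in> I" "i < j" for i j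
        using lift_set_mono_iff[OF v v, of j i] t(2) that g by (auto simp: subgroup_chains_def)
      ultimately show "?G g \<in> flags q m I"
        unfolding flags_def using t(1) v I by auto
    qed
    show "?G (?F f) = f" if f: "f \<in> flags q m I" for f
    proof
      fix i
      show "?G (?F f) i = f i"
        using f red_image_lift_set[of "f i"] by (cases "i \<in> I") (auto simp: flags_def subspace_mod_def PiE_def extensional_def)
    qed
    show "?F (?G g) = g" if g: "g \<in> subgroup_chains q (mlat q m) (lat m) I" for g
    proof
      fix i
      show "?F (?G g) i = g i"
        using g red_image_subspace(2)[of "g i"] by (cases "i \<in> I") (auto simp: subgroup_chains_def PiE_def Pi_def extensional_def)
    qed
  qed
  then have "flag_count q m I = card (subgroup_chains q (mlat q m) (lat m) I)"
    unfolding flag_count_def by (rule bij_betw_same_card)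
  also have "\<dots> = flag_product q m I"
    by (rule card_subgroup_chains[OF q add_subgrp_lat fin add_subgrp_mlat mlat_subset_lat lat_scale_mem_mlat idx_lat_mlat[OF q_pos] I])
  finally show ?thesis .
qed

end

text \<open>The product of binomials in the variable has the prescribed values at primes; a
  polynomial with these values is unique, since there are infinitely many primes.\<close>

lemma bpoly_eq_flag_product:
  assumes I: "I \<subseteq> {..m}"
  shows "bpoly m I = flag_product [:0, 1:] m I"
proof -
  have fin: "finite I" using I by (rule finite_subset) simp
  have ev: "poly (flag_product [:0, 1:] m I) (int q) = int (flag_count q m I)" if "prime q" for q
  proof -
    have "flag_product (int q) m I = int (flag_product q m I)"
      by (rule flag_product_hom) (use fin in auto)
    moreover have "flag_product (poly [:0, 1:] (int q)) m I = poly (flag_product [:0, 1:] m I) (int q)"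
      by (rule flag_product_hom[of "\<lambda>P. poly P (int q)"]) (use fin in auto)
    ultimately show ?thesis using card_flags[OF that I] by simp
  qed
  show ?thesis
    unfolding bpoly_def
  proof (rule the_equality)
    fix P assume P: "\<forall>q. prime q \<longrightarrow> poly P (int q) = int (flag_count q m I)"
    let ?D = "P - flag_product [:0, 1:] m I"
    have "int ` {q. prime q} \<subseteq> {x. poly ?D x = 0}" using P ev by auto
    moreover have "infinite (int ` {q::nat. prime q})"
      using primes_infinite by (simp add: finite_image_iff)
    ultimately have "?D = 0" using poly_roots_finite[of ?D] finite_subset by blast
    then show "P = flag_product [:0, 1:] m I" by simp
  qed (use ev in auto)
qed

lemma Ffun_eq_igusa: "Ffun m c X = igusa c m (\<lambda>i. X i / (1 - X i))"
proof (cases "m = 0")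
  case True
  then show ?thesis
    using bpoly_eq_flag_product[of "{}" 0] by (simp add: Ffun_def igusa_def poly_map_of_int_hom)
next
  case False
  then have e: "{1..m - 1} = {1..<m}" by auto
  show ?thesis unfolding Ffun_def igusa_def e
  proof (rule sum.cong[OF refl])
    fix I assume I: "I \<in> Pow {1..<m}"
    then have fin: "finite I" by (auto intro: finite_subset)
    have "flag_product c m I = poly (map_poly of_int (flag_product [:0, 1:] m I)) c"
      using flag_product_hom[of "\<lambda>P. poly (map_poly of_int P) c" I "[:0, 1:]" m, OF _ _ _ _ fin]
      by (simp add: poly_map_of_int_hom)
    moreover have "bpoly m I = flag_product [:0, 1:] m I" by (rule bpoly_eq_flag_product) (use I in auto)
    ultimately show "poly (map_poly of_int (bpoly m I)) c * (\<Prod>i\<in>I. X i / (1 - X i))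
        = flag_product c m I * (\<Prod>i\<in>I. X i / (1 - X i))" by simp
  qed
qed

section \<open>Counting sublattices one coordinate at a time\<close>

lemma power_fun_apply [simp]: "(f ^ n) i = (f i :: 'a::monoid_mult) ^ n"
  by (induction n) auto

text \<open>T0 is the kernel of the i-th coordinate on T. U is given by U' = U \<inter> T0 of index
  \<open>p ^ j\<close>, by its coordinate values, which are forced by the remaining index
  \<open>p ^ (N - j)\<close>, and by one of \<open>p ^ j\<close> lifts. The predicate Q carries a
  condition on the deeper intersection through repeated use.\<close>

lemma card_subgroups_coordinate_step:
  fixes T :: "(nat \<Rightarrow> int) set" and p :: nat
  assumes p: "prime p" and T: "add_subgrp T" and w: "w \<in> T" "w i \<noteq> 0"
    and T0_def: "T0 = {v \<in> T. v i = 0}"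
    and fin: "\<And>j. finite {U. add_subgrp U \<and> U \<subseteq> T0 \<and> idx T0 U = p ^ j \<and> Q U}"
  shows "finite {U. add_subgrp U \<and> U \<subseteq> T \<and> idx T U = p ^ N \<and> Q (U \<inter> T0)}"
    and "card {U. add_subgrp U \<and> U \<subseteq> T \<and> idx T U = p ^ N \<and> Q (U \<inter> T0)}
      = (\<Sum>j\<le>N. p ^ j * card {U. add_subgrp U \<and> U \<subseteq> T0 \<and> idx T0 U = p ^ j \<and> Q U})"
proof -
  have pp: "p > 1" using prime_gt_1_nat[OF p] .
  have T0: "add_subgrp T0" using T by (auto simp: T0_def add_subgrp_def)
  have T0T: "T0 \<subseteq> T" by (auto simp: T0_def)
  obtain g where g: "g > 0" "\<And>k. (\<exists>v\<in>T. v i = k) \<longleftrightarrow> g dvd k"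
  proof (rule int_ideal_generator[of "\<bar>w i\<bar>" "\<lambda>k. \<exists>v\<in>T. v i = k"])
    show "\<exists>v\<in>T. v i = \<bar>w i\<bar>"
    proof (cases "w i \<ge> 0")
      case False
      then show ?thesis using add_subgrp_uminus[OF T w(1)] by (intro bexI[of _ "- w"]) auto
    qed (use w in auto)
    fix a b assume "\<exists>v\<in>T. v i = a" "\<exists>v\<in>T. v i = b"
    then obtain u v where "u \<in> T" "v \<in> T" "u i = a" "v i = b" by blast
    then show "\<exists>v\<in>T. v i = a - b" using add_subgrp_diff[OF T] by (intro bexI[of _ "u - v"]) auto
  qed (use w in auto)
  then obtain x where x: "x \<in> T" "x i = g" by (metis dvd_refl)
  have gd: "g dvd v i" if "v \<in> T" for v using g(2) that by blast
  \<comment> \<open>The only possible values of U + T0: the subgroups between T0 and T of finite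
    index, with c the index.\<close>
  define Tc where "Tc = (\<lambda>c::nat. {v \<in> T. int c * g dvd v i})"
  have sTc: "add_subgrp (Tc c)" for c using T by (auto simp: Tc_def add_subgrp_def)
  have TcT: "Tc c \<subseteq> T" "T0 \<subseteq> Tc c" for c by (auto simp: Tc_def T0_def)
  have idx_Tc: "idx T (Tc c) = c" if "c > 0" for c
  proof (rule idx_cyclic[OF sTc T x(1)])
    show "\<exists>j. y - of_int j * x \<in> Tc c" if y: "y \<in> T" for y
    proof
      show "y - of_int (y i div g) * x \<in> Tc c"
        using gd[OF y] y x add_subgrp_diff[OF T y add_subgrp_scale[OF T x(1)]] by (simp add: Tc_def)
    qed
    show "of_int j * x \<in> Tc c \<longleftrightarrow> int c dvd j" for j
      using x g(1) add_subgrp_scale[OF T x(1)] by (simp add: Tc_def)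
  qed (use that in simp)
  let ?A = "{U. add_subgrp U \<and> U \<subseteq> T \<and> idx T U = p ^ N \<and> Q (U \<inter> T0)}"
  let ?B = "\<lambda>j. {U. add_subgrp U \<and> U \<subseteq> T0 \<and> idx T0 U = p ^ j \<and> Q U}"
  have idx_sum: "idx T U = c * idx T0 (U \<inter> T0)" if "add_subgrp U" "sumset U T0 = Tc c" "c > 0" for U c
  proof -
    have "U \<subseteq> Tc c" using add_subgrp_sumset(2)[OF that(1) T0] that(2) by simp
    then have "idx T U = idx T (Tc c) * idx (Tc c) U"
      using idx_mult[OF that(1) sTc T _ TcT(1)] by blast
    then show ?thesis using idx_Tc[OF that(3)] idx_sumset[OF that(1) T0] that(2) by simp
  qed
  have sum_eq: "\<exists>c>0. sumset U T0 = Tc c" if U: "add_subgrp U" "U \<subseteq> T" "idx T U = p ^ N" for U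
  proof -
    let ?S = "sumset U T0"
    have S: "add_subgrp ?S" "U \<subseteq> ?S" "T0 \<subseteq> ?S" using add_subgrp_sumset[OF U(1) T0] .
    have ST: "?S \<subseteq> T" by (rule sumset_least[OF T U(2) T0T])
    \<comment> \<open>This multiple of x keeps the coordinate values of U nonzero, so the ideal
      below has a positive member.\<close>
    have px: "of_nat (p ^ N) * x \<in> U" using idx_scale_mem[OF U(1) T U(2) _ x(1)] U(3) pp by simp
    obtain c where c: "c > 0" "\<And>k. (\<exists>v\<in>?S. v i = k * g) \<longleftrightarrow> c dvd k"
    proof (rule int_ideal_generator[of "int (p ^ N)" "\<lambda>k. \<exists>v\<in>?S. v i = k * g"])
      show "\<exists>v\<in>?S. v i = int (p ^ N) * g" using px S(2) x(2) by (intro bexI[of _ "of_nat (p ^ N) * x"]) auto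
      fix a b assume "\<exists>v\<in>?S. v i = a * g" "\<exists>v\<in>?S. v i = b * g"
      then obtain u v where "u \<in> ?S" "v \<in> ?S" "u i = a * g" "v i = b * g" by blast
      then show "\<exists>v\<in>?S. v i = (a - b) * g" using add_subgrp_diff[OF S(1)]
        by (intro bexI[of _ "u - v"]) (auto simp: algebra_simps)
    qed (use pp in auto)
    have "?S = Tc (nat c)"
    proof
      show "?S \<subseteq> Tc (nat c)"
      proof
        fix v assume v: "v \<in> ?S"
        then obtain k where "v i = k * g" using gd ST by (metis dvdE mult.commute subsetD)
        then show "v \<in> Tc (nat c)" using c v ST by (auto simp: Tc_def)
      qed
      show "Tc (nat c) \<subseteq> ?S"
      proof
        fix v assume "v \<in> Tc (nat c)"
        then obtain l where v: "v \<in> T" "v i = c * g * l" using c(1) by (auto simp: Tc_def)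
        obtain s where s: "s \<in> ?S" "s i = c * g" using c(2)[of c] by auto
        have ls: "of_int l * s \<in> ?S" using add_subgrp_scale[OF S(1) s(1)] .
        have "v - of_int l * s \<in> T" using add_subgrp_diff[OF T v(1)] ls ST by blast
        then have "v - of_int l * s \<in> T0" using v s by (simp add: T0_def)
        then have "(v - of_int l * s) + of_int l * s \<in> ?S" using add_subgrp_add[OF S(1) _ ls] S(3) by blast
        then show "v \<in> ?S" by simp
      qed
    qed
    then show ?thesis using c(1) by (intro exI[of _ "nat c"]) simp
  qed
  have fibre: "{U \<in> ?A. U \<inter> T0 = U'} = {U. add_subgrp U \<and> U \<subseteq> Tc (p ^ (N - j)) \<and> U \<inter> T0 = U' \<and> sumset U T0 = Tc (p ^ (N - j))}"
    if U': "U' \<in> ?B j" and j: "j \<le> N" for U' j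
  proof (intro equalityI subsetI)
    fix U assume "U \<in> {U \<in> ?A. U \<inter> T0 = U'}"
    then have U: "add_subgrp U" "U \<subseteq> T" "idx T U = p ^ N" "U \<inter> T0 = U'" by auto
    obtain c where c: "c > 0" "sumset U T0 = Tc c" using sum_eq[OF U(1-3)] by blast
    have "p ^ (N - j) * p ^ j = c * p ^ j"
      using idx_sum[OF U(1) c(2,1)] U U' j by (simp flip: power_add)
    then have "c = p ^ (N - j)" using pp by simp
    then show "U \<in> {U. add_subgrp U \<and> U \<subseteq> Tc (p ^ (N - j)) \<and> U \<inter> T0 = U' \<and> sumset U T0 = Tc (p ^ (N - j))}"
      using U c add_subgrp_sumset(2)[OF U(1) T0] by auto
  next
    fix U assume "U \<in> {U. add_subgrp U \<and> U \<subseteq> Tc (p ^ (N - j)) \<and> U \<inter> T0 = U' \<and> sumset U T0 = Tc (p ^ (N - j))}"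
    then have U: "add_subgrp U" "U \<subseteq> Tc (p ^ (N - j))" "U \<inter> T0 = U'" "sumset U T0 = Tc (p ^ (N - j))" by auto
    have "idx T U = p ^ N" using idx_sum[OF U(1,4)] U U' j pp by (simp flip: power_add)
    then show "U \<in> {U \<in> ?A. U \<inter> T0 = U'}" using U U' TcT by auto
  qed
  have card_fibre: "card {U \<in> ?A. U \<inter> T0 = U'} = p ^ j" if U': "U' \<in> ?B j" and j: "j \<le> N" for U' j
  proof -
    have xc: "of_nat (p ^ (N - j)) * x \<in> Tc (p ^ (N - j))"
      using x add_subgrp_scale_nat[OF T x(1), of "p ^ (N - j)"] by (simp add: Tc_def)
    have "card {U \<in> ?A. U \<inter> T0 = U'} = idx T0 U'"
      unfolding fibre[OF that]
    proof (rule card_lifts[OF _ T0 sTc _ TcT(2) xc])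
      show "\<exists>k. y - of_int k * (of_nat (p ^ (N - j)) * x) \<in> T0" if y: "y \<in> Tc (p ^ (N - j))" for y
      proof -
        obtain k where "y i = int (p ^ (N - j)) * g * k" using y by (auto simp: Tc_def)
        then have "(y - of_int k * (of_nat (p ^ (N - j)) * x)) i = 0" using x(2) by simp
        moreover have "y - of_int k * (of_nat (p ^ (N - j)) * x) \<in> T"
          using y TcT(1) xc add_subgrp_scale[OF T] add_subgrp_diff[OF T] by blast
        ultimately show ?thesis unfolding T0_def by blast
      qed
      show "of_int k * y \<in> U'" if "of_int k * (of_nat (p ^ (N - j)) * x) \<in> T0" for k y
      proof -
        \<comment> \<open>The quotient by T0 is infinite cyclic, so \<open>rel\<close> only has to
          be checked for the zero multiple, and any U' can be lifted.\<close>
        have "k = 0" using that x(2) g(1) pp by (simp add: T0_def)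
        then show ?thesis using U' by (auto simp: add_subgrp_0)
      qed
    qed (use U' in auto)
    then show ?thesis using U' by simp
  qed
  have to: "U \<inter> T0 \<in> (\<Union>j\<le>N. ?B j)" if "U \<in> ?A" for U
  proof -
    have U: "add_subgrp U" "U \<subseteq> T" "idx T U = p ^ N" "Q (U \<inter> T0)" using that by auto
    obtain c where c: "c > 0" "sumset U T0 = Tc c" using sum_eq[OF U(1-3)] by blast
    have "idx T0 (U \<inter> T0) dvd p ^ N" using idx_sum[OF U(1) c(2,1)] U by (metis dvd_triv_right)
    then obtain j where "j \<le> N" "idx T0 (U \<inter> T0) = p ^ j" using p by (auto simp: divides_primepow_nat)
    then show ?thesis using U add_subgrp_Int[OF U(1) T0] by auto
  qed
  have finB: "finite (\<Union>j\<le>N. ?B j)" using fin by auto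
  have fin_fibre: "finite {U \<in> ?A. U \<inter> T0 = U'}" if U': "U' \<in> (\<Union>j\<le>N. ?B j)" for U'
  proof -
    obtain j where "U' \<in> ?B j" "j \<le> N" using U' by blast
    then have "card {U \<in> ?A. U \<inter> T0 = U'} > 0" using card_fibre pp by simp
    then show ?thesis by (rule card_ge_0_finite)
  qed
  have "finite (\<Union>U'\<in>(\<Union>j\<le>N. ?B j). {U \<in> ?A. U \<inter> T0 = U'})"
    using finB fin_fibre by (rule finite_UN_I)
  then show "finite ?A"
  proof (rule rev_finite_subset, intro subsetI)
    fix U assume U: "U \<in> ?A"
    show "U \<in> (\<Union>U'\<in>(\<Union>j\<le>N. ?B j). {U \<in> ?A. U \<inter> T0 = U'})"
      by (rule UN_I[OF to[OF U]]) (use U in simp)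
  qed
  have "card ?A = (\<Sum>U'\<in>(\<Union>j\<le>N. ?B j). card {U \<in> ?A. U \<inter> T0 = U'})"
    by (rule card_eq_sum_fibres[OF finB to fin_fibre])
  also have "\<dots> = (\<Sum>j\<le>N. \<Sum>U'\<in>?B j. card {U \<in> ?A. U \<inter> T0 = U'})"
    by (rule sum.UNION_disjoint) (use fin pp in auto)
  also have "\<dots> = (\<Sum>j\<le>N. \<Sum>U'\<in>?B j. p ^ j)"
    by (intro sum.cong refl card_fibre) auto
  also have "\<dots> = (\<Sum>j\<le>N. p ^ j * card (?B j))" by (simp add: mult.commute)
  finally show "card ?A = (\<Sum>j\<le>N. p ^ j * card (?B j))" .
qed

text \<open>The coefficients of the product of 1 / (1 - p^i t) for i < k; the weight
  \<open>p ^ j\<close> is the number of lifts when a coordinate is added.\<close>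

fun hcount :: "nat \<Rightarrow> nat \<Rightarrow> nat \<Rightarrow> nat" where
  "hcount p 0 N = (if N = 0 then 1 else 0)"
| "hcount p (Suc k) N = (\<Sum>j\<le>N. p ^ j * hcount p k j)"

lemma lat_mono: "a \<le> b \<Longrightarrow> lat a \<subseteq> lat b"
  by (auto simp: lat_def)

text \<open>Each new coordinate weights index \<open>p ^ j\<close> by \<open>p ^ j\<close>. As j
  \<ge> a throughout, a factor \<open>p ^ a\<close> splits off at each of the k steps and leaves
  \<open>hcount\<close> for the excess N - a. The assumption \<open>ne\<close> says that every
  coordinate is nonzero somewhere on K.\<close>

lemma card_subgroups_over:
  assumes p: "prime (p::nat)" and K: "add_subgrp K" "lat m \<subseteq> K"
    and M: "add_subgrp M" "M \<subseteq> lat m" "idx (lat m) M = p ^ a"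
    and ne: "\<And>i. i < k \<Longrightarrow> \<exists>v\<in>K \<inter> lat (m + Suc i). v (m + i) \<noteq> 0"
  shows "finite {U. add_subgrp U \<and> U \<subseteq> K \<inter> lat (m + k) \<and> idx (K \<inter> lat (m + k)) U = p ^ N \<and> U \<inter> lat m = M} \<and>
    card {U. add_subgrp U \<and> U \<subseteq> K \<inter> lat (m + k) \<and> idx (K \<inter> lat (m + k)) U = p ^ N \<and> U \<inter> lat m = M}
      = (if a \<le> N then p ^ (a * k) * hcount p k (N - a) else 0)"
  using ne
proof (induction k arbitrary: N)
  case 0
  have pp: "p > 1" using prime_gt_1_nat[OF p] .
  have e: "K \<inter> lat (m + 0) = lat m" using K(2) by auto
  have "{U. add_subgrp U \<and> U \<subseteq> K \<inter> lat (m + 0) \<and> idx (K \<inter> lat (m + 0)) U = p ^ N \<and> U \<inter> lat m = M}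
      = {U. U = M \<and> N = a}"
    unfolding e using M pp by (auto simp: Int_absorb2)
  then show ?case by auto
next
  case (Suc k)
  let ?A = "\<lambda>k N. {U. add_subgrp U \<and> U \<subseteq> K \<inter> lat (m + k) \<and> idx (K \<inter> lat (m + k)) U = p ^ N \<and> U \<inter> lat m = M}"
  have IH: "finite (?A k N)" "card (?A k N) = (if a \<le> N then p ^ (a * k) * hcount p k (N - a) else 0)" for N
    using Suc.IH[of N] Suc.prems by auto
  obtain w where w: "w \<in> K \<inter> lat (m + Suc k)" "w (m + k) \<noteq> 0" using Suc.prems[of k] by blast
  have T0: "K \<inter> lat (m + k) = {v \<in> K \<inter> lat (m + Suc k). v (m + k) = 0}"
    by (auto simp: lat_def) (metis Suc_leI add_Suc_right le_neq_implies_less)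
  have "lat m \<subseteq> K \<inter> lat (m + k)" using K(2) lat_mono[of m "m + k"] by auto
  then have e: "?A (Suc k) N = {U. add_subgrp U \<and> U \<subseteq> K \<inter> lat (m + Suc k) \<and> idx (K \<inter> lat (m + Suc k)) U = p ^ N
      \<and> (U \<inter> (K \<inter> lat (m + k))) \<inter> lat m = M}" by (auto simp: Int_assoc Int_absorb1)
  note step = card_subgroups_coordinate_step[OF p add_subgrp_Int[OF K(1) add_subgrp_lat] w T0,
      of "\<lambda>U. U \<inter> lat m = M", OF IH(1)]
  have "card (?A (Suc k) N) = (\<Sum>j\<le>N. p ^ j * card (?A k j))" unfolding e by (rule step(2))
  also have "\<dots> = (\<Sum>j\<le>N. if a \<le> j then p ^ j * (p ^ (a * k) * hcount p k (j - a)) else 0)"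
    unfolding IH(2) by (rule sum.cong) auto
  also have "\<dots> = (\<Sum>j | j \<in> {..N} \<and> a \<le> j. p ^ j * (p ^ (a * k) * hcount p k (j - a)))"
    by (rule sum.inter_filter[symmetric]) simp
  also have "\<dots> = (if a \<le> N then p ^ (a * Suc k) * hcount p (Suc k) (N - a) else 0)"
  proof (cases "a \<le> N")
    case True
    have "(\<Sum>j | j \<in> {..N} \<and> a \<le> j. p ^ j * (p ^ (a * k) * hcount p k (j - a)))
        = (\<Sum>j\<le>N - a. p ^ (a * Suc k) * (p ^ j * hcount p k j))"
      by (rule sum.reindex_bij_witness[of _ "\<lambda>j. j + a" "\<lambda>j. j - a"])
         (use True in \<open>auto simp: power_add[symmetric] mult.assoc[symmetric] add.commute\<close>)
    then show ?thesis using True by (simp add: sum_distrib_left)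
  next
    case False
    then have "{j. j \<in> {..N} \<and> a \<le> j} = {}" by auto
    then show ?thesis using False by simp
  qed
  finally show ?case using step(1) unfolding e by simp
qed

section \<open>Ideals lying over a sublattice of the centre\<close>

text \<open>In \<open>lat (2 * m + 1)\<close> the first \<open>m\<close> coordinates are the exponents of the central generators; the other
  \<open>m + 1\<close> are those of \<open>x\<^sub>1, \<dots>, x\<^sub>n\<close>. Up to sign, \<open>shiftv m v\<close> is the commutator of \<open>v\<close> with \<open>x\<^sub>n\<close> and
  \<open>v (2 * m)\<close> times \<open>unitv j\<close> is its commutator with \<open>x\<^sub>j\<^sub>+\<^sub>1\<close>.\<close>

definition shiftv :: "nat \<Rightarrow> (nat \<Rightarrow> int) \<Rightarrow> nat \<Rightarrow> int" where
  "shiftv m v = (\<lambda>i. if i < m then v (m + i) else 0)"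

definition ideals :: "nat \<Rightarrow> (nat \<Rightarrow> int) set set" where
  "ideals m = {S. add_subgrp S \<and> S \<subseteq> lat (2 * m + 1) \<and>
     (\<forall>v\<in>S. shiftv m v \<in> S \<and> (\<forall>j<m. of_int (v (2 * m)) * unitv j \<in> S))}"

text \<open>For M of p-power index, \<open>p ^ lev p m M\<close> is the exponent of Z^m / M.\<close>

definition lev :: "nat \<Rightarrow> nat \<Rightarrow> (nat \<Rightarrow> int) set \<Rightarrow> nat" where
  "lev p m M = (LEAST e. \<forall>v\<in>lat m. of_nat (p ^ e) * v \<in> M)"

text \<open>The scalars killing Z^m / M form an ideal; its generator divides the index and is
  therefore a power of p.\<close>

lemma lev_dvd_iff:
  assumes p: "prime (p::nat)" and M: "add_subgrp M" "M \<subseteq> lat m" "idx (lat m) M = p ^ a"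
  shows "(\<forall>v\<in>lat m. of_int c * v \<in> M) \<longleftrightarrow> int (p ^ lev p m M) dvd c"
proof -
  have pp: "p > 1" using prime_gt_1_nat[OF p] .
  obtain g where g: "g > 0" "\<And>c. (\<forall>v\<in>lat m. of_int c * v \<in> M) \<longleftrightarrow> g dvd c"
  proof (rule int_ideal_generator[of "int (p ^ a)" "\<lambda>c. \<forall>v\<in>lat m. of_int c * v \<in> M"])
    show "\<forall>v\<in>lat m. of_int (int (p ^ a)) * v \<in> M"
      using idx_scale_mem[OF M(1) add_subgrp_lat M(2)] M(3) pp by simp
    show "\<forall>v\<in>lat m. of_int (i - j) * v \<in> M" if "\<forall>v\<in>lat m. of_int i * v \<in> M" "\<forall>v\<in>lat m. of_int j * v \<in> M" for i j
      using that add_subgrp_diff[OF M(1)] by (simp add: left_diff_distrib)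
  qed (use pp in auto)
  have "g dvd int (p ^ a)"
    using g(2)[of "int (p ^ a)"] idx_scale_mem[OF M(1) add_subgrp_lat M(2)] M(3) pp by simp
  then have "nat g dvd p ^ a" using g(1) by (simp add: nat_dvd_iff)
  then obtain f where "nat g = p ^ f" using p by (auto simp: divides_primepow_nat)
  then have gf: "g = int (p ^ f)" using g(1) by (metis int_nat_eq less_imp_le)
  have "(\<forall>v\<in>lat m. of_nat (p ^ e) * v \<in> M) \<longleftrightarrow> f \<le> e" for e
  proof -
    have "(\<forall>v\<in>lat m. of_nat (p ^ e) * v \<in> M) \<longleftrightarrow> int (p ^ f) dvd int (p ^ e)"
      using g(2)[of "int (p ^ e)"] gf by simp
    also have "\<dots> \<longleftrightarrow> p ^ f dvd p ^ e" by (simp only: int_dvd_int_iff)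
    also have "\<dots> \<longleftrightarrow> f \<le> e" using pp power_dvd_imp_le le_imp_power_dvd by blast
    finally show ?thesis .
  qed
  then have "lev p m M = f" unfolding lev_def by (simp add: Least_equality)
  then show ?thesis using g(2) gf by simp
qed

lemma scale_unitv_imp_scale_lat:
  assumes M: "add_subgrp M" and u: "\<forall>j<m. of_int c * unitv j \<in> M"
  shows "\<forall>v\<in>lat m. of_int c * v \<in> M"
proof -
  have "k \<le> m \<Longrightarrow> \<forall>v\<in>lat k. of_int c * v \<in> M" for k
  proof (induction k)
    case 0
    have "v = 0" if "v \<in> lat 0" for v using that by (auto simp: lat_def)
    then have "of_int c * v = 0" if "v \<in> lat 0" for v using that by (metis mult_zero_right)
    then show ?case using add_subgrp_0[OF M] by (metis (no_types))
  next
    case (Suc k)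
    show ?case
    proof
      fix v assume v: "v \<in> lat (Suc k)"
      let ?w = "v - of_int (v k) * unitv k"
      have "?w \<in> lat k" using v by (auto simp: lat_def unitv_def)
      moreover have "k \<le> m" using Suc.prems by simp
      ultimately have "of_int c * ?w \<in> M" using Suc.IH by blast
      moreover have "of_int (v k) * (of_int c * unitv k) \<in> M" using u Suc.prems add_subgrp_scale[OF M] by simp
      ultimately have "of_int c * ?w + of_int (v k) * (of_int c * unitv k) \<in> M" by (rule add_subgrp_add[OF M])
      then show "of_int c * v \<in> M" by (simp add: algebra_simps)
    qed
  qed
  then show ?thesis by blast
qed

text \<open>The preimage in Z^(2m+1) of the overview's M \<oplus> e Z. The central coordinates are
  unrestricted, so \<open>lat m\<close> is contained in it.\<close>

definition over :: "nat \<Rightarrow> nat \<Rightarrow> (nat \<Rightarrow> int) set \<Rightarrow> (nat \<Rightarrow> int) set" where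
  "over p m M = {v \<in> lat (2 * m + 1). shiftv m v \<in> M \<and> int (p ^ lev p m M) dvd v (2 * m)}"

lemma shiftv_diff: "shiftv m (x - y) = shiftv m x - shiftv m y"
  by (auto simp: shiftv_def)

lemma shiftv_mem_lat: "shiftv m v \<in> lat m"
  by (auto simp: shiftv_def lat_def)

lemma shiftv_lat: "v \<in> lat m \<Longrightarrow> shiftv m v = 0"
  by (auto simp: shiftv_def lat_def)

lemma add_subgrp_over:
  assumes "add_subgrp M"
  shows "add_subgrp (over p m M)"
proof -
  have "shiftv m 0 = 0" by (auto simp: shiftv_def)
  then show ?thesis
    using assms add_subgrp_lat[of "2 * m + 1"] unfolding add_subgrp_def over_def by (auto simp: shiftv_diff)
qed

lemma lat_subset_over: "add_subgrp M \<Longrightarrow> lat m \<subseteq> over p m M"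
  using lat_mono[of m "2 * m + 1"] by (auto simp: over_def shiftv_lat add_subgrp_0) (auto simp: lat_def)

text \<open>Closure under commutators becomes containment in a subgroup that depends only on M: the
  commutators with x_n must lie in M, and those with the other generators say that the last
  coordinate kills Z^m / M.\<close>

lemma ideals_iff_subset_over:
  assumes p: "prime (p::nat)" and S: "add_subgrp S" "S \<subseteq> lat (2 * m + 1)"
    and a: "idx (lat m) (S \<inter> lat m) = p ^ a"
  shows "S \<in> ideals m \<longleftrightarrow> S \<subseteq> over p m (S \<inter> lat m)"
proof -
  let ?M = "S \<inter> lat m"
  have M: "add_subgrp ?M" "?M \<subseteq> lat m" using add_subgrp_Int[OF S(1) add_subgrp_lat] by auto
  have "(\<forall>j<m. of_int c * unitv j \<in> S) \<longleftrightarrow> int (p ^ lev p m ?M) dvd c" for c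
  proof
    assume "\<forall>j<m. of_int c * unitv j \<in> S"
    then have "\<forall>j<m. of_int c * unitv j \<in> ?M"
      using unitv_mem_lat add_subgrp_scale[OF add_subgrp_lat] by blast
    then show "int (p ^ lev p m ?M) dvd c"
      using scale_unitv_imp_scale_lat[OF M(1)] lev_dvd_iff[OF p M a] by blast
  next
    assume "int (p ^ lev p m ?M) dvd c"
    then show "\<forall>j<m. of_int c * unitv j \<in> S" using lev_dvd_iff[OF p M a] unitv_mem_lat by blast
  qed
  then show ?thesis
    using S shiftv_mem_lat by (auto simp: ideals_def over_def)
qed

text \<open>The condition on \<open>shiftv\<close> contributes the index of M, the last coordinate
  the exponent. The index of M inside the centre enters once more, whence t^(2a+b).\<close>

lemma idx_over:
  assumes p: "prime (p::nat)" and M: "add_subgrp M" "M \<subseteq> lat m"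
  shows "idx (lat (2 * m + 1)) (over p m M) = idx (lat m) M * p ^ lev p m M"
proof -
  have pp: "p > 0" using prime_gt_0_nat[OF p] .
  let ?K = "{v \<in> lat (2 * m + 1). shiftv m v \<in> M}"
  have K: "add_subgrp ?K"
  proof -
    have "shiftv m 0 = 0" by (auto simp: shiftv_def)
    then show ?thesis
      using M add_subgrp_lat[of "2 * m + 1"] unfolding add_subgrp_def by (auto simp: shiftv_diff)
  qed
  have "shiftv m ` lat (2 * m + 1) = lat m"
  proof
    show "lat m \<subseteq> shiftv m ` lat (2 * m + 1)"
    proof
      fix v assume v: "v \<in> lat m"
      let ?u = "\<lambda>i. if i < m then 0 else v (i - m)"
      have u: "?u \<in> lat (2 * m + 1)" "shiftv m ?u = v" using v by (auto simp: lat_def shiftv_def)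
      show "v \<in> shiftv m ` lat (2 * m + 1)"
        by (rule image_eqI[where x = ?u and f = "shiftv m", OF u(2)[symmetric] u(1)])
    qed
  qed (use shiftv_mem_lat in blast)
  then have "idx (lat (2 * m + 1)) ?K = idx (lat m) M"
    by (intro idx_vimage[OF shiftv_diff M(1) K _ add_subgrp_lat]) auto
  moreover have "idx ?K (over p m M) = p ^ lev p m M"
  proof (rule idx_cyclic[OF add_subgrp_over[OF M(1)] K, of "unitv (2 * m)"])
    have u: "shiftv m (of_int j * unitv (2 * m)) = 0" "of_int j * unitv (2 * m) \<in> lat (2 * m + 1)" for j
      by (auto simp: shiftv_def unitv_def lat_def)
    then show "unitv (2 * m) \<in> ?K" using u[of 1] add_subgrp_0[OF M(1)] by simp
    show "\<exists>j. y - of_int j * unitv (2 * m) \<in> over p m M" if "y \<in> ?K" for y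
      using that u[of "y (2 * m)"] add_subgrp_diff[OF add_subgrp_lat[of "2 * m + 1"]]
      by (intro exI[of _ "y (2 * m)"]) (simp add: over_def shiftv_diff unitv_def)
    show "of_int j * unitv (2 * m) \<in> over p m M \<longleftrightarrow> int (p ^ lev p m M) dvd j" for j
      using u[of j] add_subgrp_0[OF M(1)] by (simp add: over_def unitv_def)
  qed (use pp in simp)
  moreover have "idx (lat (2 * m + 1)) (over p m M) = idx (lat (2 * m + 1)) ?K * idx ?K (over p m M)"
    by (rule idx_mult[OF add_subgrp_over[OF M(1)] K add_subgrp_lat]) (auto simp: over_def)
  ultimately show ?thesis by simp
qed

text \<open>With index \<open>p ^ a\<close> and exponent \<open>p ^ b\<close>, r = 2a + b is the
  least N for which an ideal of index \<open>p ^ N\<close> lies over M.\<close>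

definition sublats :: "nat \<Rightarrow> nat \<Rightarrow> nat \<Rightarrow> (nat \<Rightarrow> int) set set" where
  "sublats p m r = {M. add_subgrp M \<and> M \<subseteq> lat m \<and> idx (lat m) M ^ 2 * p ^ lev p m M = p ^ r}"

lemma sublats_idx:
  assumes p: "prime (p::nat)" and "M \<in> sublats p m r"
  obtains a where "idx (lat m) M = p ^ a" "2 * a + lev p m M = r"
proof -
  have "idx (lat m) M dvd p ^ r" using assms(2) by (auto simp: sublats_def power2_eq_square intro: dvdI[of _ _ "idx (lat m) M * p ^ lev p m M"])
  then obtain a where a: "idx (lat m) M = p ^ a" using p by (auto simp: divides_primepow_nat)
  then have "p ^ (2 * a + lev p m M) = p ^ r" using assms(2) by (simp add: sublats_def power_add power_mult[symmetric] mult.commute)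
  then have "2 * a + lev p m M = r" using prime_gt_1_nat[OF p] by simp
  then show ?thesis using that a by blast
qed

text \<open>The exponent is at most \<open>p ^ r\<close>, so every such M contains
  \<open>mlat (p ^ r) m\<close>, a lattice of finite index.\<close>

lemma finite_sublats:
  assumes p: "prime (p::nat)"
  shows "finite (sublats p m r)"
proof -
  have pos: "p ^ r > 0" using prime_gt_0_nat[OF p] by simp
  have "sublats p m r \<subseteq> {U. add_subgrp U \<and> mlat (p ^ r) m \<subseteq> U \<and> U \<subseteq> lat m}"
  proof
    fix M assume M: "M \<in> sublats p m r"
    then have s: "add_subgrp M" "M \<subseteq> lat m" by (auto simp: sublats_def)
    obtain a where a: "idx (lat m) M = p ^ a" "2 * a + lev p m M = r" using sublats_idx[OF p M] .
    have "mlat (p ^ r) m \<subseteq> M"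
    proof
      fix v assume v: "v \<in> mlat (p ^ r) m"
      let ?u = "\<lambda>i. v i div int (p ^ r)"
      have "?u \<in> lat m" using v by (auto simp: mlat_def lat_def)
      then have "of_int (int (p ^ r)) * ?u \<in> M" using lev_dvd_iff[OF p s a(1), of "int (p ^ r)"] a(2)
        by (simp add: le_imp_power_dvd del: of_nat_power)
      moreover have "of_int (int (p ^ r)) * ?u = v"
        using v by (auto simp: mlat_def fun_eq_iff)
      ultimately show "v \<in> M" by simp
    qed
    then show "M \<in> {U. add_subgrp U \<and> mlat (p ^ r) m \<subseteq> U \<and> U \<subseteq> lat m}" using s by blast
  qed
  moreover have "idx (lat m) (mlat (p ^ r) m) > 0" using idx_lat_mlat[OF pos, of m] pos by simp
  ultimately show ?thesis
    using finite_intermediate_subgroups[OF add_subgrp_mlat idx_pos_imp_finite] finite_subset by blast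
qed

text \<open>Ideals are sorted by their intersection M with the centre. Those over M are the
  subgroups of \<open>over p m M\<close> that meet the centre in M, so
  \<open>card_subgroups_over\<close> applies with the m + 1 noncentral coordinates.\<close>

theorem card_ideals:
  assumes p: "prime (p::nat)"
  shows "card {S \<in> ideals m. idx (lat (2 * m + 1)) S = p ^ N}
    = (\<Sum>r\<le>N. (\<Sum>M\<in>sublats p m r. idx (lat m) M ^ Suc m) * hcount p (Suc m) (N - r))"
proof -
  have pp: "p > 1" using prime_gt_1_nat[OF p] .
  let ?A = "{S \<in> ideals m. idx (lat (2 * m + 1)) S = p ^ N}"
  have facts: "\<exists>a. idx (lat m) (S \<inter> lat m) = p ^ a \<and> S \<subseteq> over p m (S \<inter> lat m)
     \<and> p ^ N = p ^ (a + lev p m (S \<inter> lat m)) * idx (over p m (S \<inter> lat m)) S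
     \<and> p ^ a dvd idx (over p m (S \<inter> lat m)) S"
    if "S \<in> ?A" for S
  proof -
    let ?M = "S \<inter> lat m"
    have S: "add_subgrp S" "S \<subseteq> lat (2 * m + 1)" "S \<in> ideals m" "idx (lat (2 * m + 1)) S = p ^ N"
      using that by (auto simp: ideals_def)
    have M: "add_subgrp ?M" "?M \<subseteq> lat m" using add_subgrp_Int[OF S(1) add_subgrp_lat] by auto
    let ?Z = "sumset S (lat m)"
    have Z: "add_subgrp ?Z" "S \<subseteq> ?Z" "lat m \<subseteq> ?Z" using add_subgrp_sumset[OF S(1) add_subgrp_lat] .
    have ZL: "?Z \<subseteq> lat (2 * m + 1)" by (rule sumset_least[OF add_subgrp_lat S(2)]) (rule lat_mono, simp)
    have iz: "idx ?Z S = idx (lat m) ?M" by (rule idx_sumset[OF S(1) add_subgrp_lat])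
    have "idx (lat m) ?M dvd p ^ N"
      using idx_mult[OF S(1) Z(1) add_subgrp_lat Z(2) ZL] S(4) iz by (metis dvd_triv_right)
    then obtain a where a: "idx (lat m) ?M = p ^ a" using p by (auto simp: divides_primepow_nat)
    have SO: "S \<subseteq> over p m ?M" using ideals_iff_subset_over[OF p S(1,2) a] S(3) by simp
    have O: "add_subgrp (over p m ?M)" by (rule add_subgrp_over[OF M(1)])
    have "p ^ N = p ^ (a + lev p m ?M) * idx (over p m ?M) S"
      using idx_mult[OF S(1) O add_subgrp_lat SO] S(4) idx_over[OF p M] a by (simp add: over_def power_add)
    moreover have "?Z \<subseteq> over p m ?M" by (rule sumset_least[OF O SO lat_subset_over[OF M(1)]])
    then have "p ^ a dvd idx (over p m ?M) S"
      using idx_mult[OF S(1) Z(1) O Z(2)] iz a by (metis dvd_triv_right)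
    ultimately show ?thesis using a SO by blast
  qed
  have to: "S \<inter> lat m \<in> (\<Union>r\<le>N. sublats p m r)" if S: "S \<in> ?A" for S
  proof -
    let ?M = "S \<inter> lat m"
    obtain a where a: "idx (lat m) ?M = p ^ a" "p ^ N = p ^ (a + lev p m ?M) * idx (over p m ?M) S" "p ^ a dvd idx (over p m ?M) S"
      using facts[OF S] by blast
    then have "p ^ (a + lev p m ?M) * p ^ a dvd p ^ N" by (metis mult_dvd_mono dvd_refl)
    then have "p ^ (2 * a + lev p m ?M) dvd p ^ N" by (simp add: power_add[symmetric] add.left_commute mult_2 add.assoc add.commute)
    then have "2 * a + lev p m ?M \<le> N" using pp power_dvd_imp_le by blast
    moreover have "?M \<in> sublats p m (2 * a + lev p m ?M)"
      using S a(1) add_subgrp_Int[OF _ add_subgrp_lat]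
      by (auto simp: sublats_def ideals_def power_add power_mult[symmetric] mult.commute)
    ultimately show ?thesis by blast
  qed
  have fibre: "finite {S \<in> ?A. S \<inter> lat m = M} \<and> card {S \<in> ?A. S \<inter> lat m = M} = idx (lat m) M ^ Suc m * hcount p (Suc m) (N - r)"
    if M: "M \<in> sublats p m r" and r: "r \<le> N" for M r
  proof -
    have s: "add_subgrp M" "M \<subseteq> lat m" using M by (auto simp: sublats_def)
    obtain a where a: "idx (lat m) M = p ^ a" "2 * a + lev p m M = r" using sublats_idx[OF p M] .
    let ?K = "over p m M" and ?e = "lev p m M"
    have K: "add_subgrp ?K" "lat m \<subseteq> ?K" "?K \<subseteq> lat (2 * m + 1)"
      using add_subgrp_over[OF s(1)] lat_subset_over[OF s(1)] by (auto simp: over_def)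
    have K2: "?K \<inter> lat (m + Suc m) = ?K" using K(3) by (auto simp: mult_2)
    have pN: "p ^ N = p ^ (a + ?e) * p ^ (N - a - ?e)" using a r by (simp flip: power_add)
    have "{S \<in> ?A. S \<inter> lat m = M} = {U. add_subgrp U \<and> U \<subseteq> ?K \<inter> lat (m + Suc m) \<and> idx (?K \<inter> lat (m + Suc m)) U = p ^ (N - a - ?e) \<and> U \<inter> lat m = M}"
      unfolding K2
    proof (intro equalityI subsetI)
      fix S assume S: "S \<in> {S \<in> ?A. S \<inter> lat m = M}"
      then obtain a' where "p ^ a = p ^ a'" "S \<subseteq> ?K" "p ^ N = p ^ (a' + ?e) * idx ?K S" using facts[of S] a by auto
      then show "S \<in> {U. add_subgrp U \<and> U \<subseteq> ?K \<and> idx ?K U = p ^ (N - a - ?e) \<and> U \<inter> lat m = M}"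
        using S pN pp by (auto simp: ideals_def)
    next
      fix S assume "S \<in> {U. add_subgrp U \<and> U \<subseteq> ?K \<and> idx ?K U = p ^ (N - a - ?e) \<and> U \<inter> lat m = M}"
      then have S: "add_subgrp S" "S \<subseteq> ?K" "idx ?K S = p ^ (N - a - ?e)" "S \<inter> lat m = M" by auto
      have "S \<in> ideals m" using ideals_iff_subset_over[OF p S(1)] S K(3) a by blast
      moreover have "idx (lat (2 * m + 1)) S = p ^ N"
        using idx_mult[OF S(1) K(1) add_subgrp_lat S(2) K(3)] idx_over[OF p s] S(3) a pN by (simp add: power_add)
      ultimately show "S \<in> {S \<in> ?A. S \<inter> lat m = M}" using S by blast
    qed
    moreover have "\<exists>v\<in>?K \<inter> lat (m + Suc i). v (m + i) \<noteq> 0" if i: "i < Suc m" for i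
    \<comment> \<open>The multiple of a unit vector by the exponent: for i < m its shift lies in M
      by the choice of \<open>lev\<close>, and for i = m the shift is 0 and the last coordinate is
      divisible.\<close>
    proof (rule bexI[of _ "of_int (int (p ^ ?e)) * unitv (m + i)"])
      let ?v = "of_int (int (p ^ ?e)) * unitv (m + i)"
      show "?v (m + i) \<noteq> 0" using pp by (simp add: unitv_def)
      have "shiftv m ?v \<in> M"
      proof (cases "i < m")
        case True
        have "shiftv m ?v = of_int (int (p ^ ?e)) * unitv i" using True by (auto simp: shiftv_def unitv_def)
        then show ?thesis using lev_dvd_iff[OF p s a(1), of "int (p ^ ?e)"] unitv_mem_lat[OF True] by auto
      next
        case False
        then have "shiftv m ?v = 0" by (auto simp: shiftv_def unitv_def)
        then show ?thesis using add_subgrp_0[OF s(1)] by simp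
      qed
      then show "?v \<in> ?K \<inter> lat (m + Suc i)" using i by (auto simp: over_def lat_def unitv_def)
    qed
    ultimately have *: "finite {S \<in> ?A. S \<inter> lat m = M} \<and> card {S \<in> ?A. S \<inter> lat m = M}
        = (if a \<le> N - a - ?e then p ^ (a * Suc m) * hcount p (Suc m) (N - a - ?e - a) else 0)"
      using card_subgroups_over[OF p K(1,2) s a(1), of "Suc m" "N - a - ?e"] by simp
    have "a \<le> N - a - ?e" "N - a - ?e - a = N - r" using a r by auto
    moreover have "p ^ (a * Suc m) = idx (lat m) M ^ Suc m" unfolding a(1) by (rule power_mult)
    ultimately show ?thesis using * by (simp only: if_True)
  qed
  have finB: "finite (\<Union>r\<le>N. sublats p m r)" using finite_sublats[OF p] by auto
  have "card ?A = (\<Sum>M\<in>(\<Union>r\<le>N. sublats p m r). card {S \<in> ?A. S \<inter> lat m = M})"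
    by (rule card_eq_sum_fibres[OF finB to]) (use fibre in blast)+
  also have "\<dots> = (\<Sum>r\<le>N. \<Sum>M\<in>sublats p m r. card {S \<in> ?A. S \<inter> lat m = M})"
    by (rule sum.UNION_disjoint) (use finite_sublats[OF p] pp in \<open>auto simp: sublats_def\<close>)
  also have "\<dots> = (\<Sum>r\<le>N. \<Sum>M\<in>sublats p m r. idx (lat m) M ^ Suc m * hcount p (Suc m) (N - r))"
    by (intro sum.cong refl) (use fibre in auto)
  finally show ?thesis by (simp add: sum_distrib_right)
qed

section \<open>The generating function of the sublattices of the centre\<close>

definition pimg :: "nat \<Rightarrow> (nat \<Rightarrow> int) set \<Rightarrow> (nat \<Rightarrow> int) set" where
  "pimg p N = (\<lambda>v. of_nat p * v) ` N"

definition pdiv :: "nat \<Rightarrow> nat \<Rightarrow> (nat \<Rightarrow> int) set \<Rightarrow> (nat \<Rightarrow> int) set" where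
  "pdiv p m M = {v \<in> lat m. of_nat p * v \<in> M}"

lemma scale_cancel: "p > 0 \<Longrightarrow> of_nat p * v = of_nat p * w \<longleftrightarrow> v = (w :: nat \<Rightarrow> int)"
  by (auto simp: fun_eq_iff)

lemma add_subgrp_pimg: "add_subgrp N \<Longrightarrow> add_subgrp (pimg p N)"
  unfolding add_subgrp_def pimg_def
  by (auto simp: right_diff_distrib[symmetric] intro!: image_eqI[of 0 _ 0])

lemma pimg_subset: "add_subgrp N \<Longrightarrow> pimg p N \<subseteq> N"
  using add_subgrp_scale_nat by (auto simp: pimg_def)

lemma pimg_mono: "M \<subseteq> N \<Longrightarrow> pimg p M \<subseteq> pimg p N"
  by (auto simp: pimg_def)

lemma pimg_mem_iff: "p > 0 \<Longrightarrow> of_nat p * v \<in> pimg p N \<longleftrightarrow> v \<in> N"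
  by (auto simp: pimg_def scale_cancel)

lemma idx_pimg:
  assumes "p > 0" "add_subgrp S" "add_subgrp T"
  shows "idx (pimg p T) (pimg p S) = idx T S"
  by (rule idx_vimage[of "\<lambda>v. of_nat p * v", symmetric])
     (use assms in \<open>auto simp: right_diff_distrib add_subgrp_pimg pimg_mem_iff pimg_def[symmetric]\<close>)

lemma pimg_lat: "p > 0 \<Longrightarrow> pimg p (lat m) = mlat p m"
proof
  show "pimg p (lat m) \<subseteq> mlat p m" using lat_scale_mem_mlat by (auto simp: pimg_def)
  assume p: "p > 0"
  show "mlat p m \<subseteq> pimg p (lat m)"
  proof
    fix v assume v: "v \<in> mlat p m"
    let ?u = "\<lambda>i. v i div int p"
    have "?u \<in> lat m" using v by (auto simp: mlat_def lat_def)
    moreover have "v = of_nat p * ?u" using v by (auto simp: mlat_def fun_eq_iff)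
    ultimately show "v \<in> pimg p (lat m)" using pimg_mem_iff[OF p, of ?u "lat m"] by simp
  qed
qed

text \<open>There are two chains from Z^m down to p N, through N and through p Z^m; comparing them,
  the index of N cancels.\<close>

lemma idx_pimg_self:
  assumes p: "p > 0" and N: "add_subgrp N" "N \<subseteq> lat m" "idx (lat m) N > 0"
  shows "idx N (pimg p N) = p ^ m"
proof -
  have s: "add_subgrp (pimg p N)" "pimg p N \<subseteq> N" using add_subgrp_pimg[OF N(1)] pimg_subset[OF N(1)] .
  have "idx (lat m) (pimg p N) = idx (lat m) N * idx N (pimg p N)"
    by (rule idx_mult[OF s(1) N(1) add_subgrp_lat s(2) N(2)])
  moreover have "idx (lat m) (pimg p N) = idx (lat m) (mlat p m) * idx (mlat p m) (pimg p N)"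
    by (rule idx_mult[OF s(1) add_subgrp_mlat add_subgrp_lat _ mlat_subset_lat])
       (use pimg_mono[OF N(2), of p] pimg_lat[OF p, of m] in simp)
  moreover have "idx (mlat p m) (pimg p N) = idx (lat m) N"
    using idx_pimg[OF p N(1) add_subgrp_lat[of m]] pimg_lat[OF p, of m] by simp
  ultimately show ?thesis using idx_lat_mlat[OF p, of m] N(3) by simp
qed

lemma pdiv_props:
  assumes "add_subgrp M" "M \<subseteq> lat m"
  shows "add_subgrp (pdiv p m M)" "M \<subseteq> pdiv p m M" "pdiv p m M \<subseteq> lat m"
proof -
  show "pdiv p m M \<subseteq> lat m" by (auto simp: pdiv_def)
  show "M \<subseteq> pdiv p m M" using assms add_subgrp_scale_nat[OF assms(1)] by (auto simp: pdiv_def)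
  show "add_subgrp (pdiv p m M)"
    using assms add_subgrp_lat[of m] unfolding add_subgrp_def pdiv_def by (auto simp: right_diff_distrib)
qed

text \<open>Used twice in counting the M over N: for M it is the condition of meeting the fixed
  subspace trivially, for N it gives the dimension of that subspace.\<close>

lemma Int_mlat_eq_pimg_pdiv:
  assumes "p > 0" "M \<subseteq> lat m"
  shows "M \<inter> mlat p m = pimg p (pdiv p m M)"
  unfolding pimg_lat[OF assms(1), symmetric] by (auto simp: pimg_def pdiv_def)

lemma lev_0_imp_eq:
  assumes "prime (p::nat)" "add_subgrp M" "M \<subseteq> lat m" "idx (lat m) M = p ^ a" "lev p m M = 0"
  shows "M = lat m"
proof -
  have "\<forall>v\<in>lat m. of_int 1 * v \<in> M" using lev_dvd_iff[OF assms(1-4), of 1] assms(5) by simp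
  then show ?thesis using assms(3) by auto
qed

text \<open>\<open>p ^ (e + 1)\<close> kills Z^m / M exactly when \<open>p ^ e\<close> kills Z^m /
  N. For M = Z^m the level is already 0 and cannot drop.\<close>

lemma lev_pdiv:
  assumes p: "prime (p::nat)" and M: "add_subgrp M" "M \<subseteq> lat m" "idx (lat m) M = p ^ a" "M \<noteq> lat m"
  shows "lev p m M = Suc (lev p m (pdiv p m M))"
proof -
  have pp: "p > 1" using prime_gt_1_nat[OF p] .
  let ?N = "pdiv p m M"
  note N = pdiv_props[OF M(1,2), of p]
  have "idx (lat m) ?N dvd p ^ a" using idx_mult[OF M(1) N(1) add_subgrp_lat N(2,3)] M(3) by simp
  then obtain b where b: "idx (lat m) ?N = p ^ b" using p by (auto simp: divides_primepow_nat)
  have le: "(\<forall>v\<in>lat m. of_int (int (p ^ e)) * v \<in> S) \<longleftrightarrow> lev p m S \<le> e"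
    if "add_subgrp S" "S \<subseteq> lat m" "idx (lat m) S = p ^ c" for S c e
  proof -
    have "int (p ^ lev p m S) dvd int (p ^ e) \<longleftrightarrow> p ^ lev p m S dvd p ^ e" by (simp only: int_dvd_int_iff)
    also have "\<dots> \<longleftrightarrow> lev p m S \<le> e" using pp power_dvd_imp_le le_imp_power_dvd by blast
    finally show ?thesis using lev_dvd_iff[OF p that, of "int (p ^ e)"] by blast
  qed
  have "(\<forall>v\<in>lat m. of_int (int (p ^ Suc e)) * v \<in> M) \<longleftrightarrow> (\<forall>v\<in>lat m. of_int (int (p ^ e)) * v \<in> ?N)" for e
  proof -
    have "of_int (int (p ^ e)) * v \<in> ?N \<longleftrightarrow> of_int (int (p ^ Suc e)) * v \<in> M" if "v \<in> lat m" for v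
      using that add_subgrp_scale[OF add_subgrp_lat that, of "int (p ^ e)"] by (simp add: pdiv_def mult.assoc)
    then show ?thesis by blast
  qed
  then have *: "lev p m M \<le> Suc e \<longleftrightarrow> lev p m ?N \<le> e" for e
    using le[OF M(1-3), of "Suc e"] le[OF N(1,3) b, of e] by simp
  moreover have "lev p m M \<noteq> 0" using lev_0_imp_eq[OF p M(1-3)] M(4) by blast
  ultimately show ?thesis by (metis le_refl le_antisym not0_implies_Suc not_less_eq_eq)
qed

lemma pdiv_eq_self_imp:
  assumes p: "prime (p::nat)" and M: "add_subgrp M" "M \<subseteq> lat m" "idx (lat m) M = p ^ a" "pdiv p m M = M"
  shows "M = lat m"
  using lev_pdiv[OF p M(1-3)] M(4) by fastforce

text \<open>\<open>pdiv p m M\<close> modulo M is the p-torsion of Z^m / M, so m - k is the number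
  of nontrivial cyclic factors of Z^m / M and k the dimension of M / p N.\<close>

definition sublats_dim :: "nat \<Rightarrow> nat \<Rightarrow> nat \<Rightarrow> nat \<Rightarrow> (nat \<Rightarrow> int) set set" where
  "sublats_dim p m k r = {M \<in> sublats p m r. idx (pdiv p m M) M = p ^ (m - k)}"

definition wsum :: "nat \<Rightarrow> nat \<Rightarrow> nat \<Rightarrow> nat \<Rightarrow> nat" where
  "wsum p m k r = (\<Sum>M\<in>sublats_dim p m k r. idx (lat m) M ^ Suc m)"

section \<open>The recursion for the weighted sums over sublattices\<close>

context
  fixes p m :: nat
  assumes p: "prime p"
begin

lemma p_gt: "p > 1" "p > 0"
  using prime_gt_1_nat[OF p] by auto

lemma sublats_facts:
  assumes M: "M \<in> sublats p m r"
  obtains a b j where "add_subgrp M" "M \<subseteq> lat m" "idx (lat m) M = p ^ a" "2 * a + lev p m M = r"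
    "idx (lat m) (pdiv p m M) = p ^ b" "idx (pdiv p m M) M = p ^ j" "j \<le> m" "a = b + j"
proof -
  have s: "add_subgrp M" "M \<subseteq> lat m" using M by (auto simp: sublats_def)
  obtain a where a: "idx (lat m) M = p ^ a" "2 * a + lev p m M = r" using sublats_idx[OF p M] .
  note N = pdiv_props[OF s, of p]
  let ?N = "pdiv p m M"
  have mult: "p ^ a = idx (lat m) ?N * idx ?N M" using idx_mult[OF s(1) N(1) add_subgrp_lat N(2,3)] a by simp
  then have "idx (lat m) ?N dvd p ^ a" by simp
  then obtain b where b: "idx (lat m) ?N = p ^ b" using p by (auto simp: divides_primepow_nat)
  have P: "add_subgrp (pimg p ?N)" "pimg p ?N \<subseteq> M"
    using add_subgrp_pimg[OF N(1)] by (auto simp: pimg_def pdiv_def)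
  have "idx ?N (pimg p ?N) = p ^ m" using idx_pimg_self[OF p_gt(2) N(1,3)] b p_gt by simp
  then have "idx ?N M dvd p ^ m" using idx_mult[OF P(1) s(1) N(1) P(2) N(2)] by (metis dvd_triv_left)
  then obtain j where j: "idx ?N M = p ^ j" "j \<le> m" using p by (auto simp: divides_primepow_nat)
  have "p ^ a = p ^ (b + j)" using mult b j by (simp add: power_add)
  then have "a = b + j" using p_gt by simp
  then show ?thesis using that s a b j by blast
qed

lemma finite_sublats_dim: "finite (sublats_dim p m k r)"
  using finite_sublats[OF p] by (simp add: sublats_dim_def)

lemma sublats_eq_Union: "sublats p m r = (\<Union>k\<le>m. sublats_dim p m k r)"
proof
  show "sublats p m r \<subseteq> (\<Union>k\<le>m. sublats_dim p m k r)"
  proof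
    fix M assume M: "M \<in> sublats p m r"
    obtain j where "idx (pdiv p m M) M = p ^ j" "j \<le> m" using sublats_facts[OF M] by metis
    then have "M \<in> sublats_dim p m (m - j) r" using M by (simp add: sublats_dim_def)
    then show "M \<in> (\<Union>k\<le>m. sublats_dim p m k r)" by auto
  qed
qed (auto simp: sublats_dim_def)

lemma sublats_dim_disjoint: "k \<le> m \<Longrightarrow> k' \<le> m \<Longrightarrow> k \<noteq> k' \<Longrightarrow> sublats_dim p m k r \<inter> sublats_dim p m k' r = {}"
  using p_gt by (auto simp: sublats_dim_def)

lemma sum_sublats: "(\<Sum>M\<in>sublats p m r. idx (lat m) M ^ Suc m) = (\<Sum>k\<le>m. wsum p m k r)"
  unfolding sublats_eq_Union wsum_def
  by (rule sum.UNION_disjoint) (use finite_sublats_dim sublats_dim_disjoint in auto)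

text \<open>k = m means no p-torsion, hence \<open>pdiv p m M\<close> = M and M = Z^m.\<close>

lemma wsum_top: "wsum p m m r = (if r = 0 then 1 else 0)"
proof -
  have lev0: "lev p m (lat m) = 0" unfolding lev_def by (rule Least_equality) auto
  have i1: "idx (lat m) (lat m) = 1" by (rule idx_self[OF add_subgrp_lat])
  have uniq: "M = lat m \<and> r = 0" if "M \<in> sublats_dim p m m r" for M
  proof -
    have M: "M \<in> sublats p m r" "idx (pdiv p m M) M = 1" using that by (auto simp: sublats_dim_def)
    obtain a where a: "add_subgrp M" "M \<subseteq> lat m" "idx (lat m) M = p ^ a" "2 * a + lev p m M = r"
      using sublats_facts[OF M(1)] by metis
    have "M = pdiv p m M" using idx_1_imp_eq[OF a(1)] pdiv_props[OF a(1,2)] M(2) by blast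
    then have "M = lat m" using pdiv_eq_self_imp[OF p a(1-3)] by simp
    moreover have "p ^ a = 1" using a(3) i1 calculation by simp
    then have "a = 0" using p_gt by (metis less_not_refl one_less_power neq0_conv)
    ultimately show ?thesis using a(4) lev0 by simp
  qed
  have mem: "lat m \<in> sublats_dim p m m 0"
  proof -
    have "pdiv p m (lat m) = lat m"
      using add_subgrp_scale_nat[OF add_subgrp_lat] by (auto simp: pdiv_def)
    then show ?thesis using i1 lev0 add_subgrp_lat by (simp add: sublats_dim_def sublats_def)
  qed
  show ?thesis
  proof (cases "r = 0")
    case True
    then have "sublats_dim p m m r = {lat m}" using uniq mem by blast
    then show ?thesis using i1 True by (simp add: wsum_def)
  next
    case False
    then have "sublats_dim p m m r = {}" using uniq by blast
    then show ?thesis using False by (simp add: wsum_def)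
  qed
qed

text \<open>Passing to N divides the index by \<open>p ^ (m - k)\<close>, which counts twice in r,
  and lowers the level by one: together 2 (m - k) + 1.\<close>

lemma pdiv_sublats_dim:
  assumes M: "M \<in> sublats_dim p m k r" and k: "k < m"
  shows "2 * (m - k) + 1 \<le> r" "pdiv p m M \<in> sublats p m (r - (2 * (m - k) + 1))"
    "idx (lat m) M = idx (lat m) (pdiv p m M) * p ^ (m - k)"
proof -
  have M': "M \<in> sublats p m r" "idx (pdiv p m M) M = p ^ (m - k)" using M by (auto simp: sublats_dim_def)
  obtain a b j where a: "add_subgrp M" "M \<subseteq> lat m" "idx (lat m) M = p ^ a" "2 * a + lev p m M = r"
    "idx (lat m) (pdiv p m M) = p ^ b" "idx (pdiv p m M) M = p ^ j" "a = b + j"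
    using sublats_facts[OF M'(1)] by metis
  have j: "j = m - k" using a(6) M'(2) p_gt by simp
  note N = pdiv_props[OF a(1,2), of p]
  have "M \<noteq> lat m"
  proof
    assume "M = lat m"
    then have "pdiv p m M = M" using N by auto
    then have "p ^ (m - k) = 1" using M'(2) idx_self[OF a(1)] by simp
    then show False using p_gt k by (metis less_not_refl one_less_power zero_less_diff)
  qed
  then have lev: "lev p m M = Suc (lev p m (pdiv p m M))" by (rule lev_pdiv[OF p a(1-3)])
  show "2 * (m - k) + 1 \<le> r" using a(4,7) j lev by simp
  have "2 * b + lev p m (pdiv p m M) = r - (2 * (m - k) + 1)" using a(4,7) j lev by simp
  then show "pdiv p m M \<in> sublats p m (r - (2 * (m - k) + 1))"
    using N a(5) by (simp add: sublats_def power_mult[symmetric] power_add[symmetric] mult.commute)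
  show "idx (lat m) M = idx (lat m) (pdiv p m M) * p ^ (m - k)" using a j by (simp add: power_add)
qed

text \<open>For given \<open>N = pdiv p m M\<close> the lattice \<open>M\<close> is a subspace of \<open>N / p N\<close> meeting
  \<open>(N \<inter> p \<int>\<^sup>m) / p N\<close> trivially.\<close>

lemma card_pdiv_fibre:
  assumes N: "N \<in> sublats_dim p m d r" and k: "k < m" and d: "d \<le> m"
  shows "card {M \<in> sublats_dim p m k (r + (2 * (m - k) + 1)). pdiv p m M = N} = gbin p d k * p ^ (k * (m - d))"
proof -
  have N': "N \<in> sublats p m r" "idx (pdiv p m N) N = p ^ (m - d)" using N by (auto simp: sublats_dim_def)
  obtain a where a: "add_subgrp N" "N \<subseteq> lat m" "idx (lat m) N = p ^ a" "2 * a + lev p m N = r"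
    using sublats_facts[OF N'(1)] by metis
  let ?P = "pimg p N" and ?W = "N \<inter> mlat p m"
  have P: "add_subgrp ?P" "?P \<subseteq> N" using add_subgrp_pimg[OF a(1)] pimg_subset[OF a(1)] .
  have PW: "?P \<subseteq> ?W" using P(2) pimg_mono[OF a(2), of p] pimg_lat[OF p_gt(2), of m] by blast
  have W: "add_subgrp ?W" by (rule add_subgrp_Int[OF a(1) add_subgrp_mlat])
  have NP: "idx N ?P = p ^ m" using idx_pimg_self[OF p_gt(2) a(1,2)] a(3) p_gt by simp
  \<comment> \<open>?W is p times \<open>pdiv p m N\<close>, so its dimension over ?P is that of the
    p-torsion of Z^m / N.\<close>
  have WP: "idx ?W ?P = p ^ (m - d)"
    unfolding Int_mlat_eq_pimg_pdiv[OF p_gt(2) a(2)]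
    using idx_pimg[OF p_gt(2) a(1) pdiv_props(1)[OF a(1,2)]] N'(2) by simp
  have NW: "idx N ?W = p ^ d"
  proof -
    have "p ^ d * p ^ (m - d) = idx N ?W * p ^ (m - d)"
      using idx_mult[OF P(1) W a(1) PW] NP WP d by (simp flip: power_add)
    then show ?thesis using p_gt by simp
  qed
  have "{M \<in> sublats_dim p m k (r + (2 * (m - k) + 1)). pdiv p m M = N}
     = {U. add_subgrp U \<and> ?P \<subseteq> U \<and> U \<subseteq> N \<and> U \<inter> ?W = ?P \<and> idx U ?P = p ^ k}"
  proof (intro equalityI subsetI)
    fix M assume "M \<in> {M \<in> sublats_dim p m k (r + (2 * (m - k) + 1)). pdiv p m M = N}"
    then have M: "M \<in> sublats_dim p m k (r + (2 * (m - k) + 1))" "pdiv p m M = N" by auto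
    then have s: "add_subgrp M" "M \<subseteq> lat m" "idx N M = p ^ (m - k)" by (auto simp: sublats_dim_def sublats_def)
    have MN: "M \<subseteq> N" using pdiv_props(2)[OF s(1,2), of p] M(2) by simp
    have eq: "M \<inter> mlat p m = ?P" using Int_mlat_eq_pimg_pdiv[OF p_gt(2) s(2)] M(2) by simp
    then have PM: "?P \<subseteq> M" by blast
    have "p ^ (m - k) * p ^ k = p ^ (m - k) * idx M ?P"
      using idx_mult[OF P(1) s(1) a(1) PM MN] NP s(3) k by (simp flip: power_add)
    then have "idx M ?P = p ^ k" using p_gt by simp
    moreover have "M \<inter> ?W = ?P" using eq MN by blast
    ultimately show "M \<in> {U. add_subgrp U \<and> ?P \<subseteq> U \<and> U \<subseteq> N \<and> U \<inter> ?W = ?P \<and> idx U ?P = p ^ k}"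
      using s(1) PM MN by blast
  next
    fix U assume "U \<in> {U. add_subgrp U \<and> ?P \<subseteq> U \<and> U \<subseteq> N \<and> U \<inter> ?W = ?P \<and> idx U ?P = p ^ k}"
    then have U: "add_subgrp U" "?P \<subseteq> U" "U \<subseteq> N" "U \<inter> ?W = ?P" "idx U ?P = p ^ k" by auto
    have UL: "U \<subseteq> lat m" using U a by blast
    \<comment> \<open>Trivial intersection with ?W is exactly what keeps \<open>pdiv\<close> from
      growing beyond N.\<close>
    have half: "pdiv p m U = N"
    proof
      show "N \<subseteq> pdiv p m U" using U(2) a(2) by (auto simp: pdiv_def pimg_def)
      show "pdiv p m U \<subseteq> N"
      proof
        fix v assume "v \<in> pdiv p m U"
        then have v: "v \<in> lat m" "of_nat p * v \<in> U" by (auto simp: pdiv_def)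
        then have "of_nat p * v \<in> U \<inter> ?W" using lat_scale_mem_mlat U(3) by blast
        then show "v \<in> N" using U(4) pimg_mem_iff[OF p_gt(2)] by blast
      qed
    qed
    have "p ^ (m - k) * p ^ k = idx N U * p ^ k"
      using idx_mult[OF P(1) U(1) a(1) U(2,3)] NP U(5) k by (simp flip: power_add)
    then have NU: "idx N U = p ^ (m - k)" using p_gt by simp
    have LU: "idx (lat m) U = p ^ (a + (m - k))"
      using idx_mult[OF U(1) a(1) add_subgrp_lat U(3) a(2)] NU a(3) by (simp add: power_add)
    have "U \<noteq> lat m"
    proof
      assume "U = lat m"
      then have "U = N" using U a by auto
      then have "p ^ (m - k) = 1" using NU idx_self[OF a(1)] by simp
      then show False using p_gt k by (metis less_not_refl one_less_power zero_less_diff)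
    qed
    then have "lev p m U = Suc (lev p m N)" using lev_pdiv[OF p U(1) UL LU] half by simp
    then have "2 * (a + (m - k)) + lev p m U = r + (2 * (m - k) + 1)" using a(4) by simp
    moreover have "idx (lat m) U ^ 2 * p ^ lev p m U = p ^ (2 * (a + (m - k)) + lev p m U)"
      unfolding LU by (simp only: power_add power_mult mult.commute[of 2])
    ultimately have "U \<in> sublats p m (r + (2 * (m - k) + 1))"
      using U(1) UL by (simp only: sublats_def mem_Collect_eq simp_thms)
    then show "U \<in> {M \<in> sublats_dim p m k (r + (2 * (m - k) + 1)). pdiv p m M = N}"
      using half NU by (simp add: sublats_dim_def)
  qed
  moreover have "of_nat p * x \<in> ?P" if "x \<in> N" for x using that by (auto simp: pimg_def)
  ultimately show ?thesis
    using card_trivially_meeting[OF p P(1) W a(1) PW Int_lower1 _ NW WP, of k] by simp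
qed

lemma wsum_rec:
  assumes k: "k < m"
  shows "wsum p m k r = (if 2 * (m - k) + 1 \<le> r
    then \<Sum>d\<le>m. gbin p d k * p ^ (k * (m - d)) * p ^ ((m - k) * Suc m) * wsum p m d (r - (2 * (m - k) + 1)) else 0)"
proof (cases "2 * (m - k) + 1 \<le> r")
  case False
  then have "sublats_dim p m k r = {}" using pdiv_sublats_dim(1)[OF _ k] by blast
  then show ?thesis using False by (simp add: wsum_def)
next
  case True
  define r' where "r' = r - (2 * (m - k) + 1)"
  have r: "r = r' + (2 * (m - k) + 1)" using True by (simp add: r'_def)
  let ?A = "sublats_dim p m k r" and ?h = "\<lambda>M. idx (lat m) M ^ Suc m"
  have "wsum p m k r = (\<Sum>N\<in>sublats p m r'. \<Sum>M\<in>{M \<in> ?A. pdiv p m M = N}. ?h M)"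
    unfolding wsum_def
    by (rule sum.group[symmetric, OF finite_sublats_dim finite_sublats[OF p]])
       (use pdiv_sublats_dim(2)[OF _ k] in \<open>auto simp: r'_def\<close>)
  also have "\<dots> = (\<Sum>d\<le>m. \<Sum>N\<in>sublats_dim p m d r'. \<Sum>M\<in>{M \<in> ?A. pdiv p m M = N}. ?h M)"
    unfolding sublats_eq_Union
    by (rule sum.UNION_disjoint) (use finite_sublats_dim sublats_dim_disjoint in auto)
  also have "\<dots> = (\<Sum>d\<le>m. \<Sum>N\<in>sublats_dim p m d r'. gbin p d k * p ^ (k * (m - d)) * (p ^ ((m - k) * Suc m) * ?h N))"
  proof (intro sum.cong refl)
    fix d N assume d: "d \<in> {..m}" and N: "N \<in> sublats_dim p m d r'"
    have "(\<Sum>M\<in>{M \<in> ?A. pdiv p m M = N}. ?h M) = (\<Sum>M\<in>{M \<in> ?A. pdiv p m M = N}. p ^ ((m - k) * Suc m) * ?h N)"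
    proof (rule sum.cong[OF refl])
      fix M assume "M \<in> {M \<in> ?A. pdiv p m M = N}"
      then have "idx (lat m) M = idx (lat m) N * p ^ (m - k)" using pdiv_sublats_dim(3)[OF _ k] by auto
      then show "?h M = p ^ ((m - k) * Suc m) * ?h N"
        unfolding power_mult by (simp only: power_mult_distrib mult.commute)
    qed
    also have "\<dots> = card {M \<in> ?A. pdiv p m M = N} * (p ^ ((m - k) * Suc m) * ?h N)" by simp
    also have "card {M \<in> ?A. pdiv p m M = N} = gbin p d k * p ^ (k * (m - d))"
      using card_pdiv_fibre[OF N k] d r by simp
    finally show "(\<Sum>M\<in>{M \<in> ?A. pdiv p m M = N}. ?h M) = gbin p d k * p ^ (k * (m - d)) * (p ^ ((m - k) * Suc m) * ?h N)" .
  qed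
  finally show ?thesis using True by (simp add: wsum_def sum_distrib_left r'_def mult.assoc)
qed

section \<open>Passage to power series\<close>

text \<open>X_k as a series in t = p^(-s), with n = m + 1.\<close>

definition Xfps :: "nat \<Rightarrow> complex fps" where
  "Xfps k = fps_const (of_nat p ^ ((Suc m + k) * (m - k))) * fps_X ^ (2 * (m - k) + 1)"

definition Sfps :: "nat \<Rightarrow> complex fps" where
  "Sfps k = Abs_fps (\<lambda>r. of_nat (wsum p m k r))"

lemma Sfps_top: "Sfps m = 1"
  by (rule fps_ext) (simp add: Sfps_def wsum_top)

text \<open>In \<open>wsum_rec\<close> the term d = k has binomial 1. Moving it to the left makes
  the recursion triangular and produces the factor 1 - X_k.\<close>

lemma Sfps_rec:
  assumes k: "k < m"
  shows "Sfps k = Xfps k * inverse (1 - Xfps k) * (\<Sum>d\<in>{k<..m}. gbin (fps_const (1 / of_nat p)) d k * Sfps d)"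
proof -
  let ?c = "2 * (m - k) + 1"
  let ?g = "\<lambda>d. fps_const (of_nat (gbin p d k * p ^ (k * (m - d)) * p ^ ((m - k) * Suc m)) :: complex)"
  have "Sfps k = (\<Sum>d\<le>m. ?g d * (fps_X ^ ?c * Sfps d))"
  proof (rule fps_ext)
    fix r
    show "fps_nth (Sfps k) r = fps_nth (\<Sum>d\<le>m. ?g d * (fps_X ^ ?c * Sfps d)) r"
      unfolding fps_sum_nth fps_mult_left_const_nth fps_X_power_mult_nth Sfps_def fps_nth_Abs_fps wsum_rec[OF k, of r]
      by (auto simp: not_less)
  qed
  also have "\<dots> = (\<Sum>d\<in>{k..m}. ?g d * (fps_X ^ ?c * Sfps d))"
    by (rule sum.mono_neutral_right) (auto simp: gbin_eq_0)
  also have "\<dots> = (\<Sum>d\<in>{k..m}. Xfps k * (gbin (fps_const (1 / of_nat p)) d k * Sfps d))"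
  proof (rule sum.cong[OF refl])
    fix d assume d: "d \<in> {k..m}"
    have p0: "(of_nat p :: complex) \<noteq> 0" using p_gt by simp
    have h: "gbin (fps_const (1 / of_nat p)) d k = fps_const (gbin (1 / of_nat p :: complex) d k)"
      by (rule gbin_hom) auto
    have "of_nat (gbin p d k * p ^ (k * (m - d)) * p ^ ((m - k) * Suc m))
       = gbin (of_nat p :: complex) d k * of_nat p ^ (k * (m - d)) * of_nat p ^ ((m - k) * Suc m)"
      using gbin_hom[of "of_nat :: nat \<Rightarrow> complex" p d k] by simp
    also have "gbin (of_nat p :: complex) d k = gbin (1 / of_nat p) d k * of_nat p ^ (k * (d - k))"
      using gbin_inverse[OF p0, of k d] d by simp
    also have "gbin (1 / of_nat p :: complex) d k * of_nat p ^ (k * (d - k)) * of_nat p ^ (k * (m - d)) * of_nat p ^ ((m - k) * Suc m)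
       = gbin (1 / of_nat p) d k * of_nat p ^ (k * (d - k) + k * (m - d) + (m - k) * Suc m)"
      by (simp only: power_add mult.assoc)
    also have "k * (d - k) + k * (m - d) + (m - k) * Suc m = (Suc m + k) * (m - k)"
    proof -
      have "k * (d - k) + k * (m - d) = k * (m - k)" using d by (simp flip: distrib_left)
      then show ?thesis by (simp only: distrib_right) (simp only: mult.commute add.commute)
    qed
    finally have "?g d = fps_const (of_nat p ^ ((Suc m + k) * (m - k))) * gbin (fps_const (1 / of_nat p)) d k"
      unfolding h by (simp only: fps_const_mult mult.commute)
    then show "?g d * (fps_X ^ ?c * Sfps d) = Xfps k * (gbin (fps_const (1 / of_nat p)) d k * Sfps d)"
      unfolding Xfps_def by (simp only: ac_simps)
  qed
  also have "{k..m} = insert k {k<..m}" using k by auto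
  also have "(\<Sum>d\<in>insert k {k<..m}. Xfps k * (gbin (fps_const (1 / of_nat p)) d k * Sfps d))
      = Xfps k * Sfps k + Xfps k * (\<Sum>d\<in>{k<..m}. gbin (fps_const (1 / of_nat p)) d k * Sfps d)"
    by (simp add: sum_distrib_left)
  finally have "(1 - Xfps k) * Sfps k = Xfps k * (\<Sum>d\<in>{k<..m}. gbin (fps_const (1 / of_nat p)) d k * Sfps d)"
    by (simp add: algebra_simps)
  moreover have "inverse (1 - Xfps k) * (1 - Xfps k) = 1"
    by (rule inverse_mult_eq_1) (simp add: Xfps_def)
  ultimately show ?thesis by (metis (no_types, lifting) mult.assoc mult.commute mult_1)
qed

definition Hfps :: "nat \<Rightarrow> complex \<Rightarrow> complex fps" where
  "Hfps k c = Abs_fps (\<lambda>j. c ^ j * of_nat (hcount p k j))"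

text \<open>The parameter c is there for the induction: multiplying by 1 - c t removes one summation
  of \<open>hcount\<close> and replaces c by c p.\<close>

lemma Hfps_mult: "Hfps k c * (\<Prod>i<k. 1 - fps_const (c * of_nat p ^ i) * fps_X) = 1"
proof (induction k arbitrary: c)
  case 0
  show ?case by (simp, rule fps_ext) (simp add: Hfps_def)
next
  case (Suc k)
  have "Hfps (Suc k) c * (1 - fps_const c * fps_X) = Hfps k (c * of_nat p)"
  proof (rule fps_ext)
    fix N
    have e: "Hfps (Suc k) c * (1 - fps_const c * fps_X) = Hfps (Suc k) c - fps_const c * (fps_X * Hfps (Suc k) c)"
      by (simp add: algebra_simps)
    show "fps_nth (Hfps (Suc k) c * (1 - fps_const c * fps_X)) N = fps_nth (Hfps k (c * of_nat p)) N"
      unfolding e fps_sub_nth fps_mult_left_const_nth fps_X_mult_nth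
      by (cases N) (auto simp: Hfps_def algebra_simps power_mult_distrib)
  qed
  then show ?case using Suc.IH[of "c * of_nat p"]
    by (simp add: prod.lessThan_Suc_shift mult.assoc[symmetric] del: prod.lessThan_Suc)
qed

lemma ideals_fps:
  assumes m: "m \<ge> 1"
  shows "Abs_fps (\<lambda>N. of_nat (card {S \<in> ideals m. idx (lat (2 * m + 1)) S = p ^ N}))
    = (\<Prod>i<Suc m. inverse (1 - fps_const (of_nat p ^ i) * fps_X))
      * ((1 + Xfps 0 * inverse (1 - Xfps 0)) * igusa (fps_const (1 / of_nat p)) m (\<lambda>k. Xfps k * inverse (1 - Xfps k)))"
proof -
  have "Abs_fps (\<lambda>N. of_nat (card {S \<in> ideals m. idx (lat (2 * m + 1)) S = p ^ N})) = (\<Sum>k\<le>m. Sfps k) * Hfps (Suc m) 1"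
  proof (rule fps_ext)
    fix N
    show "fps_nth (Abs_fps (\<lambda>N. of_nat (card {S \<in> ideals m. idx (lat (2 * m + 1)) S = p ^ N}))) N
        = fps_nth ((\<Sum>k\<le>m. Sfps k) * Hfps (Suc m) 1) N"
      unfolding fps_nth_Abs_fps card_ideals[OF p] sum_sublats fps_mult_nth fps_sum_nth
      by (simp add: Sfps_def Hfps_def atLeast0AtMost del: hcount.simps)
  qed
  also have "(\<Sum>k\<le>m. Sfps k) = (1 + Xfps 0 * inverse (1 - Xfps 0)) * igusa (fps_const (1 / of_nat p)) m (\<lambda>k. Xfps k * inverse (1 - Xfps k))"
    by (rule sum_transposed_igusa[OF m Sfps_top Sfps_rec])
  also have "Hfps (Suc m) 1 = (\<Prod>i<Suc m. inverse (1 - fps_const (of_nat p ^ i) * fps_X))"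
  proof -
    let ?D = "\<Prod>i<Suc m. 1 - fps_const (of_nat p ^ i :: complex) * fps_X"
    have "(\<Prod>i<Suc m. inverse (1 - fps_const (of_nat p ^ i) * fps_X)) * ?D
       = (\<Prod>i<Suc m. inverse (1 - fps_const (of_nat p ^ i :: complex) * fps_X) * (1 - fps_const (of_nat p ^ i) * fps_X))"
      by (rule prod.distrib[symmetric])
    also have "\<dots> = 1" by (intro prod.neutral ballI inverse_mult_eq_1) simp
    finally have "(\<Prod>i<Suc m. inverse (1 - fps_const (of_nat p ^ i) * fps_X)) * ?D = 1" .
    moreover have "Hfps (Suc m) 1 * ?D = 1" using Hfps_mult[of "Suc m" 1] by simp
    ultimately show ?thesis by (metis (no_types, lifting) mult.assoc mult.commute mult_1)
  qed
  finally show ?thesis by (simp only: mult.commute)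
qed

text \<open>Every factor is rational in t and regular at 0, so the formal product transfers to germs
  factor by factor.\<close>

lemma Vn_has_fps_expansion:
  assumes m: "m \<ge> 1"
  shows "(\<lambda>t. Vn (Suc m) (of_nat p) t) has_fps_expansion
    Abs_fps (\<lambda>N. of_nat (card {S \<in> ideals m. idx (lat (2 * m + 1)) S = p ^ N}))"
proof -
  have X: "(\<lambda>t. Xfun (Suc m) (of_nat p) t k) has_fps_expansion Xfps k" if "k \<le> m" for k
  proof -
    have "2 * (Suc m - k) - 1 = 2 * (m - k) + 1" "Suc m - k - 1 = m - k" using that by auto
    then show ?thesis unfolding Xfun_def Xfps_def by (auto intro!: fps_expansion_intros)
  qed
  have xX: "(\<lambda>t. Xfun (Suc m) (of_nat p) t k * inverse (1 - Xfun (Suc m) (of_nat p) t k)) has_fps_expansion Xfps k * inverse (1 - Xfps k)"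
    if "k \<le> m" for k
    by (intro has_fps_expansion_mult has_fps_expansion_inverse has_fps_expansion_diff has_fps_expansion_1 X that)
       (simp add: Xfps_def)
  have fp: "flag_product (fps_const c) m I = fps_const (flag_product c m I)" if "finite I" for c :: complex and I
    by (rule flag_product_hom) (use that in auto)
  have ig: "(\<lambda>t. igusa (1 / of_nat p) m (\<lambda>k. Xfun (Suc m) (of_nat p) t k * inverse (1 - Xfun (Suc m) (of_nat p) t k)))
     has_fps_expansion igusa (fps_const (1 / of_nat p)) m (\<lambda>k. Xfps k * inverse (1 - Xfps k))"
    unfolding igusa_def
  proof (intro has_fps_expansion_sum)
    fix I assume I: "I \<in> Pow {1..<m}"
    then have fin: "finite I" by (auto intro: finite_subset)
    show "(\<lambda>t. flag_product (1 / of_nat p) m I * (\<Prod>i\<in>I. Xfun (Suc m) (of_nat p) t i * inverse (1 - Xfun (Suc m) (of_nat p) t i)))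
      has_fps_expansion flag_product (fps_const (1 / of_nat p)) m I * (\<Prod>i\<in>I. Xfps i * inverse (1 - Xfps i))"
      unfolding fp[OF fin]
      by (intro has_fps_expansion_mult has_fps_expansion_const has_fps_expansion_prod xX) (use I in auto)
  qed
  let ?V = "\<lambda>t. (\<Prod>i<Suc m. inverse (1 - of_nat p ^ i * t)) *
     ((1 + Xfun (Suc m) (of_nat p) t 0 * inverse (1 - Xfun (Suc m) (of_nat p) t 0))
      * igusa (1 / of_nat p) m (\<lambda>k. Xfun (Suc m) (of_nat p) t k * inverse (1 - Xfun (Suc m) (of_nat p) t k)))"
  have V: "?V has_fps_expansion Abs_fps (\<lambda>N. of_nat (card {S \<in> ideals m. idx (lat (2 * m + 1)) S = p ^ N}))"
    unfolding ideals_fps[OF m]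
    by (intro has_fps_expansion_mult has_fps_expansion_prod has_fps_expansion_inverse has_fps_expansion_diff
          has_fps_expansion_add has_fps_expansion_1 has_fps_expansion_const has_fps_expansion_fps_X xX X ig) auto
  \<comment> \<open>Merging 1 + X_0 / (1 - X_0) into 1 / (1 - X_0) needs X_0 different from 1, which
    holds near t = 0.\<close>
  have "((\<lambda>t. Xfun (Suc m) (of_nat p) t 0) \<longlongrightarrow> Xfun (Suc m) (of_nat p) 0 0) (nhds 0)"
    unfolding Xfun_def by (intro tendsto_intros filterlim_ident)
  moreover have "Xfun (Suc m) (of_nat p) 0 0 \<noteq> 1" by (simp add: Xfun_def)
  ultimately have "\<forall>\<^sub>F t in nhds 0. Xfun (Suc m) (of_nat p) t 0 \<noteq> 1"
    by (rule tendsto_imp_eventually_ne)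
  then have "\<forall>\<^sub>F t in nhds 0. ?V t = Vn (Suc m) (of_nat p) t"
  proof eventually_elim
    case (elim t)
    let ?X = "Xfun (Suc m) (of_nat p) t 0"
    have "of_nat p ^ (Suc m * (Suc m - 1)) * t ^ (2 * Suc m - 1) = ?X" by (simp add: Xfun_def)
    moreover have "1 + ?X * inverse (1 - ?X) = 1 / (1 - ?X)" using elim by (simp add: field_simps)
    ultimately show ?case
      unfolding Vn_def Ffun_eq_igusa by (simp only: divide_inverse diff_Suc_1 mult_1 mult.assoc)
  qed
  then show ?thesis using V unfolding has_fps_expansion_def by (auto elim: eventually_elim2)
qed

end

section \<open>Normal subgroups of \<open>Gn n\<close> as additive subgroups\<close>

text \<open>The order is b_1, ..., b_m, a_1, ..., a_m, a_n. The central coordinates come first, so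
  that they form \<open>lat m\<close> and the others can be added one at a time; position 2 m holds
  the exponent of x_n.\<close>

definition enc :: "nat \<Rightarrow> (nat \<Rightarrow> int) \<times> (nat \<Rightarrow> int) \<Rightarrow> nat \<Rightarrow> int" where
  "enc m g = (\<lambda>i. if i < m then snd g (Suc i) else if i < 2 * m + 1 then fst g (Suc (i - m)) else 0)"

definition mulV :: "nat \<Rightarrow> (nat \<Rightarrow> int) \<Rightarrow> (nat \<Rightarrow> int) \<Rightarrow> nat \<Rightarrow> int" where
  "mulV m x y = x + y + of_int (y (2 * m)) * shiftv m x"

definition invV :: "nat \<Rightarrow> (nat \<Rightarrow> int) \<Rightarrow> nat \<Rightarrow> int" where
  "invV m x = - x + of_int (x (2 * m)) * shiftv m x"

lemma shiftv_add: "shiftv m (x + y) = shiftv m x + shiftv m y"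
  by (auto simp: shiftv_def)

lemma shiftv_uminus: "shiftv m (- x) = - shiftv m x"
  by (auto simp: shiftv_def)

lemma shiftv_scale: "shiftv m (of_int c * x) = of_int c * shiftv m x"
  by (auto simp: shiftv_def)

lemma shiftv_shiftv: "shiftv m (shiftv m x) = 0"
  using shiftv_lat[OF shiftv_mem_lat] .

lemma shiftv_top [simp]: "shiftv m x (2 * m) = 0"
  by (simp add: shiftv_def)

lemmas shiftv_simps = shiftv_add shiftv_diff shiftv_uminus shiftv_shiftv
  shiftv_scale shiftv_scale[unfolded mult.commute[of "of_int c" for c]]
  shiftv_top[unfolded mult.commute[of 2]]

lemma mulV_assoc: "mulV m (mulV m x y) z = mulV m x (mulV m y z)"
  by (simp add: mulV_def shiftv_simps algebra_simps)

lemma mulV_invV: "mulV m (invV m x) x = 0"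
  by (simp add: mulV_def invV_def shiftv_simps algebra_simps)

lemma mulV_lat: "z \<in> lat m \<Longrightarrow> mulV m x z = x + z"
  by (simp add: mulV_def lat_def)

lemma invV_mem_lat: "x \<in> lat (2 * m + 1) \<Longrightarrow> invV m x \<in> lat (2 * m + 1)"
  by (auto simp: invV_def lat_def shiftv_def)

lemma enc_mult: "enc m (g \<otimes>\<^bsub>Gn (Suc m)\<^esub> h) = mulV m (enc m g) (enc m h)"
  by (auto simp: Gn_def enc_def mulV_def shiftv_def fun_eq_iff)

lemma enc_one: "enc m \<one>\<^bsub>Gn (Suc m)\<^esub> = 0"
  by (auto simp: Gn_def enc_def fun_eq_iff)

lemma inj_on_enc: "inj_on (enc m) (carrier (Gn (Suc m)))"
proof (rule inj_onI)
  fix g h assume gh: "g \<in> carrier (Gn (Suc m))" "h \<in> carrier (Gn (Suc m))" "enc m g = enc m h"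
  have b: "snd g j = snd h j" if "j \<in> {1..m}" for j
    using fun_cong[OF gh(3), of "j - 1"] that by (cases j) (auto simp: enc_def)
  have a: "fst g i = fst h i" if "i \<in> {1..Suc m}" for i
    using fun_cong[OF gh(3), of "m + i - 1"] that by (cases i) (auto simp: enc_def)
  have "fst g = fst h" by (rule extensionalityI[of _ "{1..Suc m}"]) (use gh a in \<open>auto simp: Gn_def\<close>)
  moreover have "snd g = snd h" by (rule extensionalityI[of _ "{1..m}"]) (use gh b in \<open>auto simp: Gn_def\<close>)
  ultimately show "g = h" by (simp add: prod_eq_iff)
qed

lemma enc_image: "enc m ` carrier (Gn (Suc m)) = lat (2 * m + 1)"
proof
  show "enc m ` carrier (Gn (Suc m)) \<subseteq> lat (2 * m + 1)" by (auto simp: enc_def lat_def)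
  show "lat (2 * m + 1) \<subseteq> enc m ` carrier (Gn (Suc m))"
  proof
    fix v assume v: "v \<in> lat (2 * m + 1)"
    let ?g = "(\<lambda>i\<in>{1..Suc m}. v (m + i - 1), \<lambda>j\<in>{1..m}. v (j - 1))"
    have "?g \<in> carrier (Gn (Suc m))" by (simp add: Gn_def)
    moreover have "enc m ?g = v"
      using v by (auto simp: enc_def lat_def fun_eq_iff)
    ultimately show "v \<in> enc m ` carrier (Gn (Suc m))" by (metis imageI)
  qed
qed

lemma group_Gn: "group (Gn (Suc m))"
proof (rule groupI)
  let ?G = "Gn (Suc m)"
  show closed: "x \<otimes>\<^bsub>?G\<^esub> y \<in> carrier ?G" for x y by (simp add: Gn_def)
  show one: "\<one>\<^bsub>?G\<^esub> \<in> carrier ?G" by (simp add: Gn_def)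
  show "x \<otimes>\<^bsub>?G\<^esub> y \<otimes>\<^bsub>?G\<^esub> z = x \<otimes>\<^bsub>?G\<^esub> (y \<otimes>\<^bsub>?G\<^esub> z)" for x y z
    by (rule inj_onD[OF inj_on_enc[of m]]) (simp_all add: enc_mult mulV_assoc closed)
  show "\<one>\<^bsub>?G\<^esub> \<otimes>\<^bsub>?G\<^esub> x = x" if "x \<in> carrier ?G" for x
    by (rule inj_onD[OF inj_on_enc[of m]])
       (simp_all add: enc_mult enc_one closed that, simp add: mulV_def shiftv_def fun_eq_iff)
  show "\<exists>y\<in>carrier ?G. y \<otimes>\<^bsub>?G\<^esub> x = \<one>\<^bsub>?G\<^esub>" if x: "x \<in> carrier ?G" for x
  proof -
    have "enc m x \<in> lat (2 * m + 1)" using enc_image x by blast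
    then have "invV m (enc m x) \<in> enc m ` carrier ?G" using enc_image invV_mem_lat by blast
    then obtain y where y: "y \<in> carrier ?G" "enc m y = invV m (enc m x)" by (metis imageE)
    have "y \<otimes>\<^bsub>?G\<^esub> x = \<one>\<^bsub>?G\<^esub>"
      by (rule inj_onD[OF inj_on_enc[of m]]) (simp_all add: enc_mult enc_one closed one y mulV_invV)
    then show ?thesis using y by blast
  qed
qed

lemma enc_mem_iff:
  assumes "H \<subseteq> carrier (Gn (Suc m))" "g \<in> carrier (Gn (Suc m))"
  shows "enc m g \<in> enc m ` H \<longleftrightarrow> g \<in> H"
  using inj_on_image_mem_iff[OF inj_on_enc assms(2,1)] .

lemma ideal_scale_mem:
  assumes "S \<in> ideals m" "v \<in> S" "z \<in> lat m"
  shows "of_int (v (2 * m)) * z \<in> S"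
proof -
  have "add_subgrp S" "\<forall>j<m. of_int (v (2 * m)) * unitv j \<in> S" using assms by (auto simp: ideals_def)
  then show ?thesis using scale_unitv_imp_scale_lat assms(3) by blast
qed

text \<open>The product v x differs from v + x by a multiple of \<open>shiftv m v\<close>, which
  lies in S. The correction is undone by subtracting it, because \<open>shiftv\<close> applied twice
  is 0.\<close>

lemma enc_r_coset:
  assumes S: "enc m ` H \<in> ideals m"
  shows "enc m ` (H #>\<^bsub>Gn (Suc m)\<^esub> x) = add_coset (enc m ` H) (enc m x)"
proof -
  let ?S = "enc m ` H" and ?x = "enc m x"
  have s: "add_subgrp ?S" "\<And>v. v \<in> ?S \<Longrightarrow> shiftv m v \<in> ?S" using S by (auto simp: ideals_def)
  have "enc m ` (H #>\<^bsub>Gn (Suc m)\<^esub> x) = (\<lambda>v. mulV m v ?x) ` ?S"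
    by (auto simp: r_coset_def enc_mult image_iff)
  also have "\<dots> = add_coset ?S ?x"
  proof (intro equalityI subsetI)
    fix y assume "y \<in> (\<lambda>v. mulV m v ?x) ` ?S"
    then obtain v where v: "v \<in> ?S" "y = mulV m v ?x" by blast
    have "y - ?x = v + of_int (?x (2 * m)) * shiftv m v" using v by (simp add: mulV_def)
    then show "y \<in> add_coset ?S ?x"
      using add_subgrp_add[OF s(1) v(1) add_subgrp_scale[OF s(1) s(2)[OF v(1)]]] by (simp add: add_coset_def)
  next
    fix y assume "y \<in> add_coset ?S ?x"
    then have y: "y - ?x \<in> ?S" by (simp add: add_coset_def)
    let ?v = "(y - ?x) - of_int (?x (2 * m)) * shiftv m (y - ?x)"
    have "?v \<in> ?S" by (rule add_subgrp_diff[OF s(1) y add_subgrp_scale[OF s(1) s(2)[OF y]]])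
    moreover have "mulV m ?v ?x = y" by (simp add: mulV_def shiftv_simps algebra_simps)
    ultimately show "y \<in> (\<lambda>v. mulV m v ?x) ` ?S" by (metis imageI)
  qed
  finally show ?thesis .
qed

lemma normal_imp_ideal:
  assumes H: "H \<lhd> Gn (Suc m)"
  shows "enc m ` H \<in> ideals m"
proof -
  let ?G = "Gn (Suc m)" and ?S = "enc m ` H"
  interpret normal H ?G by (rule H)
  have SL: "?S \<subseteq> lat (2 * m + 1)" using subset enc_image by blast
  have zero: "0 \<in> ?S" using subgroup.one_closed[OF subgroup_axioms] enc_one by (metis imageI)
  have mul: "mulV m x y \<in> ?S" if "x \<in> ?S" "y \<in> ?S" for x y
    using that by (auto simp flip: enc_mult)
  have inv: "invV m x \<in> ?S" if x: "x \<in> ?S" for x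
  proof -
    obtain h where h: "h \<in> H" "x = enc m h" using x by (metis imageE)
    have "invV m x = mulV m (invV m x) (mulV m x (enc m (inv\<^bsub>?G\<^esub> h)))"
      using h subset r_inv[of h] by (simp add: enc_mult[symmetric] subset_iff enc_one) (simp add: mulV_def)
    also have "\<dots> = mulV m 0 (enc m (inv\<^bsub>?G\<^esub> h))" by (simp only: mulV_assoc[symmetric] mulV_invV)
    also have "\<dots> = enc m (inv\<^bsub>?G\<^esub> h)" by (simp add: mulV_def shiftv_def fun_eq_iff)
    finally show ?thesis using h by simp
  qed
  \<comment> \<open>This vector encodes the commutator of h and x, obtained as the product of the
    inverse of h with the conjugate h1 of h.\<close>
  have comm: "of_int (x (2 * m)) * shiftv m h - of_int (h (2 * m)) * shiftv m x \<in> ?S"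
    if h: "h \<in> ?S" and x: "x \<in> lat (2 * m + 1)" for h x
  proof -
    obtain h0 where h0: "h0 \<in> H" "h = enc m h0" using h by (metis imageE)
    have "x \<in> enc m ` carrier ?G" using x enc_image by blast
    then obtain x0 where x0: "x0 \<in> carrier ?G" "x = enc m x0" by (metis imageE)
    have "h0 \<otimes>\<^bsub>?G\<^esub> x0 \<in> x0 <#\<^bsub>?G\<^esub> H" using coset_eq x0 h0 by (auto simp: r_coset_def)
    then obtain h1 where h1: "h1 \<in> H" "h0 \<otimes>\<^bsub>?G\<^esub> x0 = x0 \<otimes>\<^bsub>?G\<^esub> h1" by (auto simp: l_coset_def)
    let ?h = "enc m h1"
    have eq: "mulV m h x = mulV m x ?h" using h1(2) h0 x0 enc_mult by metis
    have "mulV m h x (2 * m) = mulV m x ?h (2 * m)" using eq by simp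
    then have c: "?h (2 * m) = h (2 * m)" by (simp add: mulV_def)
    have "h + x + of_int (x (2 * m)) * shiftv m h = x + ?h + of_int (h (2 * m)) * shiftv m x"
      using eq c by (simp add: mulV_def)
    then have "?h = h + of_int (x (2 * m)) * shiftv m h - of_int (h (2 * m)) * shiftv m x"
      by (simp add: algebra_simps)
    moreover have "mulV m (invV m h) ?h = ?h - h"
      unfolding mulV_def invV_def c by (simp add: shiftv_simps algebra_simps)
    ultimately have "mulV m (invV m h) ?h = of_int (x (2 * m)) * shiftv m h - of_int (h (2 * m)) * shiftv m x"
      by simp
    then show ?thesis using mul[OF inv[OF h], of ?h] h1(1) by simp
  qed
  have sh: "shiftv m h \<in> ?S" if h: "h \<in> ?S" for h
  proof -
    have "shiftv m (unitv (2 * m)) = 0" "unitv (2 * m) (2 * m) = 1" by (auto simp: shiftv_def unitv_def)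
    then show ?thesis using comm[OF h unitv_mem_lat[of "2 * m" "2 * m + 1"]] by simp
  qed
  have top: "of_int (h (2 * m)) * unitv j \<in> ?S" if h: "h \<in> ?S" and j: "j < m" for h j
  proof -
    \<comment> \<open>The negative unit vector cancels the minus sign that the commutator formula
      attaches to \<open>shiftv m x\<close>.\<close>
    have "shiftv m (- unitv (m + j)) = - unitv j" "(- unitv (m + j)) (2 * m) = 0"
      using j by (auto simp: shiftv_def unitv_def)
    then show ?thesis
      using comm[OF h add_subgrp_uminus[OF add_subgrp_lat unitv_mem_lat[of "m + j" "2 * m + 1"]]] j by simp
  qed
  \<comment> \<open>Additivity is obtained first inside \<open>lat m\<close>, where
    \<open>mulV\<close> is ordinary addition; the correction term \<open>?z\<close> below relies on
    it.\<close>
  have Z: "add_subgrp (?S \<inter> lat m)"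
  proof -
    have "x - y \<in> ?S" if "x \<in> ?S \<inter> lat m" "y \<in> ?S \<inter> lat m" for x y
    proof -
      have iy: "invV m y = - y" using that by (simp add: invV_def lat_def)
      moreover have "- y \<in> lat m" using that by (simp add: lat_def)
      ultimately show ?thesis using mul[OF _ inv, of x y] mulV_lat[of "- y" m x] that by simp
    qed
    then show ?thesis using zero add_subgrp_lat[of m] by (auto simp: add_subgrp_def)
  qed
  have "x - y \<in> ?S" if x: "x \<in> ?S" and y: "y \<in> ?S" for x y
  proof -
    \<comment> \<open>The central element by which x - y differs from the group quotient of x by
      y.\<close>
    let ?z = "of_int (y (2 * m)) * shiftv m x - of_int (y (2 * m)) * shiftv m y"
    have "shiftv m x \<in> ?S \<inter> lat m" "shiftv m y \<in> ?S \<inter> lat m" using sh x y shiftv_mem_lat by simp_all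
    then have z: "?z \<in> ?S \<inter> lat m"
      by (intro add_subgrp_diff[OF Z] add_subgrp_scale[OF Z])
    have "mulV m (mulV m x (invV m y)) ?z \<in> ?S" using mul[OF mul[OF x inv[OF y]]] z by blast
    also have "mulV m (mulV m x (invV m y)) ?z = mulV m x (invV m y) + ?z" by (rule mulV_lat) (use z in blast)
    also have "\<dots> = x - y" by (simp add: mulV_def invV_def shiftv_simps algebra_simps)
    finally show ?thesis .
  qed
  then show ?thesis using SL zero sh top by (auto simp: ideals_def add_subgrp_def)
qed

lemma ideal_imp_normal:
  assumes S: "enc m ` H \<in> ideals m" and H: "H \<subseteq> carrier (Gn (Suc m))"
  shows "H \<lhd> Gn (Suc m)"
proof -
  let ?G = "Gn (Suc m)" and ?S = "enc m ` H"
  interpret group ?G by (rule group_Gn)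
  have s: "add_subgrp ?S" "\<And>v. v \<in> ?S \<Longrightarrow> shiftv m v \<in> ?S" using S by (auto simp: ideals_def)
  have sc: "of_int c * shiftv m v \<in> ?S" if "v \<in> ?S" for c v using add_subgrp_scale[OF s(1) s(2)[OF that]] .
  have sub: "subgroup H ?G"
  proof (rule subgroupI[OF H])
    have "\<one>\<^bsub>?G\<^esub> \<in> H" using enc_mem_iff[OF H one_closed] enc_one add_subgrp_0[OF s(1)] by metis
    then show "H \<noteq> {}" by blast
    fix g assume g: "g \<in> H"
    then have gc: "g \<in> carrier ?G" using H by blast
    have "enc m (inv\<^bsub>?G\<^esub> g) = mulV m (mulV m (invV m (enc m g)) (enc m g)) (enc m (inv\<^bsub>?G\<^esub> g))"
      by (simp add: mulV_invV) (simp add: mulV_def shiftv_def fun_eq_iff)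
    also have "\<dots> = mulV m (invV m (enc m g)) (enc m (g \<otimes>\<^bsub>?G\<^esub> inv\<^bsub>?G\<^esub> g))" by (simp only: mulV_assoc enc_mult)
    also have "\<dots> = invV m (enc m g)" using r_inv[OF gc] by (simp add: enc_one) (simp add: mulV_def)
    also have "\<dots> \<in> ?S"
      unfolding invV_def using g by (intro add_subgrp_add[OF s(1)] add_subgrp_uminus[OF s(1)] sc) auto
    finally show "inv\<^bsub>?G\<^esub> g \<in> H" using enc_mem_iff[OF H inv_closed[OF gc]] by simp
    fix h assume h: "h \<in> H"
    have "mulV m (enc m g) (enc m h) \<in> ?S"
      unfolding mulV_def using g h by (intro add_subgrp_add[OF s(1)] sc) auto
    then have "enc m (g \<otimes>\<^bsub>?G\<^esub> h) \<in> ?S" by (simp only: enc_mult)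
    then show "g \<otimes>\<^bsub>?G\<^esub> h \<in> H" using enc_mem_iff[OF H] gc h H by blast
  qed
  show ?thesis
  proof (rule normalI[OF sub], rule ballI)
    fix x assume x: "x \<in> carrier ?G"
    let ?x = "enc m x"
    \<comment> \<open>Conjugation changes v by a multiple of \<open>shiftv m v\<close> and a
      multiple of \<open>v (2 * m)\<close> times a central vector. Both defining closure properties
      of ideals are used here; c and d are the signs for the two inclusions.\<close>
    have corr: "v + of_int (c * ?x (2 * m)) * shiftv m v + of_int (d * v (2 * m)) * shiftv m ?x \<in> ?S"
      if "v \<in> ?S" for v c d
    proof -
      have "of_int d * (of_int (v (2 * m)) * shiftv m ?x) \<in> ?S"
        using add_subgrp_scale[OF s(1) ideal_scale_mem[OF S that shiftv_mem_lat]] .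
      then have "of_int (d * v (2 * m)) * shiftv m ?x \<in> ?S" by (simp add: mult.assoc)
      then show ?thesis using add_subgrp_add[OF s(1) add_subgrp_add[OF s(1) that sc[OF that]]] by blast
    qed
    show "H #>\<^bsub>?G\<^esub> x = x <#\<^bsub>?G\<^esub> H"
    proof (intro equalityI subsetI)
      fix y assume "y \<in> H #>\<^bsub>?G\<^esub> x"
      then obtain h where h: "h \<in> H" "y = h \<otimes>\<^bsub>?G\<^esub> x" by (auto simp: r_coset_def)
      let ?v = "enc m h"
      have "?v + of_int (1 * ?x (2 * m)) * shiftv m ?v + of_int (- 1 * ?v (2 * m)) * shiftv m ?x \<in> ?S"
        by (rule corr) (use h in blast)
      then obtain h1 where h1: "h1 \<in> H" "enc m h1 = ?v + of_int (1 * ?x (2 * m)) * shiftv m ?v + of_int (- 1 * ?v (2 * m)) * shiftv m ?x"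
        by (metis imageE)
      have "enc m y = enc m (x \<otimes>\<^bsub>?G\<^esub> h1)"
        unfolding h enc_mult h1 by (simp add: mulV_def shiftv_simps algebra_simps)
      then have "y = x \<otimes>\<^bsub>?G\<^esub> h1"
        by (rule inj_onD[OF inj_on_enc]) (use h h1 x H in auto)
      then show "y \<in> x <#\<^bsub>?G\<^esub> H" using h1 by (auto simp: l_coset_def)
    next
      fix y assume "y \<in> x <#\<^bsub>?G\<^esub> H"
      then obtain h where h: "h \<in> H" "y = x \<otimes>\<^bsub>?G\<^esub> h" by (auto simp: l_coset_def)
      let ?v = "enc m h"
      have "?v + of_int (- 1 * ?x (2 * m)) * shiftv m ?v + of_int (1 * ?v (2 * m)) * shiftv m ?x \<in> ?S"
        by (rule corr) (use h in blast)
      then obtain h1 where h1: "h1 \<in> H" "enc m h1 = ?v + of_int (- 1 * ?x (2 * m)) * shiftv m ?v + of_int (1 * ?v (2 * m)) * shiftv m ?x"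
        by (metis imageE)
      have "enc m y = enc m (h1 \<otimes>\<^bsub>?G\<^esub> x)"
        unfolding h enc_mult h1 by (simp add: mulV_def shiftv_simps algebra_simps)
      then have "y = h1 \<otimes>\<^bsub>?G\<^esub> x"
        by (rule inj_onD[OF inj_on_enc]) (use h h1 x H in auto)
      then show "y \<in> H #>\<^bsub>?G\<^esub> x" using h1 by (auto simp: r_coset_def)
    qed
  qed
qed

lemma card_rcosets_eq_idx:
  assumes H: "H \<subseteq> carrier (Gn (Suc m))" and S: "enc m ` H \<in> ideals m"
  shows "card (rcosets\<^bsub>Gn (Suc m)\<^esub> H) = idx (lat (2 * m + 1)) (enc m ` H)"
proof -
  let ?G = "Gn (Suc m)"
  interpret group ?G by (rule group_Gn)
  have "rcosets\<^bsub>?G\<^esub> H = (\<lambda>x. H #>\<^bsub>?G\<^esub> x) ` carrier ?G" by (auto simp: RCOSETS_def)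
  then have "card (rcosets\<^bsub>?G\<^esub> H) = card ((\<lambda>x. H #>\<^bsub>?G\<^esub> x) ` carrier ?G)" by simp
  also have "\<dots> = card ((\<lambda>x. add_coset (enc m ` H) (enc m x)) ` carrier ?G)"
  proof (rule card_image_cong_kernel)
    fix x y assume "x \<in> carrier ?G" "y \<in> carrier ?G"
    then show "H #>\<^bsub>?G\<^esub> x = H #>\<^bsub>?G\<^esub> y \<longleftrightarrow> add_coset (enc m ` H) (enc m x) = add_coset (enc m ` H) (enc m y)"
      using inj_on_image_eq_iff[OF inj_on_enc r_coset_subset_G[OF H] r_coset_subset_G[OF H], of x y]
        enc_r_coset[OF S, of x] enc_r_coset[OF S, of y] by simp
  qed
  also have "(\<lambda>x. add_coset (enc m ` H) (enc m x)) ` carrier ?G = add_coset (enc m ` H) ` lat (2 * m + 1)"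
    using enc_image by (metis image_image)
  finally show ?thesis by (simp add: idx_def)
qed

lemma normal_index_count_eq:
  "normal_index_count (Gn (Suc m)) N = card {S \<in> ideals m. idx (lat (2 * m + 1)) S = N}"
proof -
  let ?G = "Gn (Suc m)"
  have sub: "H \<subseteq> carrier ?G" if "H \<lhd> ?G" for H
    using that by (simp add: normal_def subgroup.subset)
  have "bij_betw (\<lambda>H. enc m ` H) {H. H \<lhd> ?G \<and> card (rcosets\<^bsub>?G\<^esub> H) = N}
      {S \<in> ideals m. idx (lat (2 * m + 1)) S = N}"
  proof (rule bij_betw_imageI)
    show "inj_on (\<lambda>H. enc m ` H) {H. H \<lhd> ?G \<and> card (rcosets\<^bsub>?G\<^esub> H) = N}"
      using inj_on_image_eq_iff[OF inj_on_enc sub sub] by (auto intro!: inj_onI)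
    show "(\<lambda>H. enc m ` H) ` {H. H \<lhd> ?G \<and> card (rcosets\<^bsub>?G\<^esub> H) = N} = {S \<in> ideals m. idx (lat (2 * m + 1)) S = N}"
    proof (intro equalityI subsetI)
      fix S assume "S \<in> (\<lambda>H. enc m ` H) ` {H. H \<lhd> ?G \<and> card (rcosets\<^bsub>?G\<^esub> H) = N}"
      then obtain H where H: "H \<lhd> ?G" "card (rcosets\<^bsub>?G\<^esub> H) = N" "S = enc m ` H" by blast
      then show "S \<in> {S \<in> ideals m. idx (lat (2 * m + 1)) S = N}"
        using normal_imp_ideal[OF H(1)] card_rcosets_eq_idx[OF sub[OF H(1)]] by simp
    next
      fix S assume S: "S \<in> {S \<in> ideals m. idx (lat (2 * m + 1)) S = N}"
      then have "S \<subseteq> enc m ` carrier ?G" unfolding enc_image by (auto simp: ideals_def)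
      then obtain H where H: "H \<subseteq> carrier ?G" "S = enc m ` H" by (metis subset_imageE)
      then show "S \<in> (\<lambda>H. enc m ` H) ` {H. H \<lhd> ?G \<and> card (rcosets\<^bsub>?G\<^esub> H) = N}"
        using S ideal_imp_normal[of m H] card_rcosets_eq_idx[OF H(1)] by auto
    qed
  qed
  then show ?thesis unfolding normal_index_count_def by (rule bij_betw_same_card)
qed

section \<open>Convergence and the functional equation\<close>

text \<open>The point p^(-s) enters any disc around 0 once Re s is large, so the abscissa is read
  off from a radius r on which the expansion sums to f.\<close>

lemma has_fps_expansion_imp_sums:
  fixes f :: "complex \<Rightarrow> complex" and p :: nat
  assumes f: "f has_fps_expansion F" and p: "p > 1"
  shows "\<exists>\<sigma>0::real. \<forall>s::complex. Re s > \<sigma>0 \<longrightarrow>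
    (\<lambda>k. fps_nth F k * (of_nat p powr (- s)) ^ k) sums f (of_nat p powr (- s))"
proof -
  have F: "fps_conv_radius F > 0" "\<forall>\<^sub>F z in nhds 0. eval_fps F z = f z" using f by (auto simp: has_fps_expansion_def)
  have "\<forall>\<^sub>F z in nhds (0::complex). ereal (norm z) < fps_conv_radius F"
  proof -
    have "open (eball (0::complex) (fps_conv_radius F))" by simp
    then have "\<forall>\<^sub>F z in nhds (0::complex). z \<in> eball 0 (fps_conv_radius F)"
      using F(1) by (intro eventually_nhds_in_open) (auto simp: zero_ereal_def)
    then show ?thesis by eventually_elim (auto simp: in_eball_iff)
  qed
  with F(2) have "\<forall>\<^sub>F z in nhds 0. (\<lambda>k. fps_nth F k * z ^ k) sums f z"
    by eventually_elim (metis sums_eval_fps)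
  then obtain r where r: "r > 0" "\<And>z. norm z < r \<Longrightarrow> (\<lambda>k. fps_nth F k * z ^ k) sums f z"
    unfolding eventually_nhds_metric by (auto simp: dist_norm)
  have lnp: "ln (real p) > 0" using p by simp
  have "norm (of_nat p powr (- s) :: complex) < r" if "Re s > - ln r / ln (real p)" for s
  proof -
    have "norm (of_nat p powr (- s) :: complex) = exp (- Re s * ln (real p))"
      using p by (subst norm_powr_real) auto
    also have "\<dots> < exp (ln r)" using that lnp by (simp add: field_simps)
    finally show ?thesis using r(1) by simp
  qed
  then show ?thesis using r(2) by blast
qed

lemma igusa_cong: "(\<And>i. 1 \<le> i \<Longrightarrow> i < m \<Longrightarrow> x i = y i) \<Longrightarrow> igusa q m x = igusa q m y"
  unfolding igusa_def by (intro sum.cong refl arg_cong2[where f = "(*)"] prod.cong) auto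

lemma prod_neg_powers:
  fixes q t :: "'a::comm_ring_1"
  shows "(\<Prod>i<n. - (q ^ i * t)) = (-1) ^ n * q ^ (n choose 2) * t ^ n"
  by (induction n) (simp_all add: numeral_2_eq_2 power_add algebra_simps)

text \<open>Each geometric factor obeys 1 / (1 - 1/z) = - z / (1 - z), and X / (1 - X) becomes - 1 -
  X / (1 - X), the substitution in \<open>igusa_functional_equation\<close>. The signs (-1)^n, -1
  and (-1)^(m-1) multiply to -1.\<close>

lemma Vn_functional_equation:
  assumes m: "m \<ge> 1" and d: "Vn_defined (Suc m) q t"
  shows "Vn (Suc m) (1 / q) (1 / t) = - (q ^ ((2 * Suc m - 1) choose 2) * t ^ (3 * Suc m - 1)) * Vn (Suc m) q t"
proof -
  let ?n = "Suc m" and ?X = "Xfun (Suc m) q t" and ?Y = "q ^ (Suc m * m) * t ^ (2 * m + 1)"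
  have q: "q \<noteq> 0" "t \<noteq> 0" and f: "\<forall>i<?n. q ^ i * t \<noteq> 1" and Y: "?Y \<noteq> 1" and X: "\<And>i. 1 \<le> i \<Longrightarrow> i < m \<Longrightarrow> ?X i \<noteq> 1"
    using d by (auto simp: Vn_defined_def)
  have inv: "1 / (1 - 1 / z) = - z * (1 / (1 - z))" if "z \<noteq> 0" "z \<noteq> 1" for z :: complex
    using that by (simp add: field_simps)
  have Xinv: "Xfun ?n (1 / q) (1 / t) i = 1 / ?X i" for i
    by (simp add: Xfun_def power_divide)
  have "(\<Prod>i<?n. 1 / (1 - (1 / q) ^ i * (1 / t))) = (\<Prod>i<?n. - (q ^ i * t) * (1 / (1 - q ^ i * t)))"
  proof (rule prod.cong[OF refl])
    fix i assume "i \<in> {..<?n}"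
    then show "1 / (1 - (1 / q) ^ i * (1 / t)) = - (q ^ i * t) * (1 / (1 - q ^ i * t))"
      using inv[of "q ^ i * t"] f q by (simp add: power_divide)
  qed
  also have "\<dots> = (-1) ^ ?n * q ^ (?n choose 2) * t ^ ?n * (\<Prod>i<?n. 1 / (1 - q ^ i * t))"
    unfolding prod.distrib prod_neg_powers ..
  finally have 1: "(\<Prod>i<?n. 1 / (1 - (1 / q) ^ i * (1 / t))) = (-1) ^ ?n * q ^ (?n choose 2) * t ^ ?n * (\<Prod>i<?n. 1 / (1 - q ^ i * t))" .
  have 2: "1 / (1 - (1 / q) ^ (?n * m) * (1 / t) ^ (2 * m + 1)) = - ?Y * (1 / (1 - ?Y))"
    using inv[of ?Y] Y q by (simp add: power_divide del: power_Suc power_Suc2)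
  have "Ffun m (1 / (1 / q)) (Xfun ?n (1 / q) (1 / t)) = igusa (1 / (1 / q)) m (\<lambda>i. - 1 - ?X i / (1 - ?X i))"
    unfolding Ffun_eq_igusa Xinv
  proof (rule igusa_cong)
    fix i assume "1 \<le> i" "i < m"
    moreover have "?X i \<noteq> 0" using q by (simp add: Xfun_def)
    ultimately show "1 / ?X i / (1 - 1 / ?X i) = - 1 - ?X i / (1 - ?X i)"
      using X[of i] by (simp add: field_simps)
  qed
  also have "\<dots> = (-1) ^ (m - 1) * (1 / (1 / q)) ^ (m choose 2) * igusa (1 / q) m (\<lambda>i. ?X i / (1 - ?X i))"
    by (rule igusa_functional_equation) (use q m in auto)
  finally have 3: "Ffun m (1 / (1 / q)) (Xfun ?n (1 / q) (1 / t)) = (-1) ^ (m - 1) * q ^ (m choose 2) * Ffun m (1 / q) ?X"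
    by (simp add: Ffun_eq_igusa)
  have V: "Vn ?n q' t' = (\<Prod>i<?n. 1 / (1 - q' ^ i * t')) * (1 / (1 - q' ^ (?n * m) * t' ^ (2 * m + 1))) * Ffun m (1 / q') (Xfun ?n q' t')" for q' t'
    by (simp only: Vn_def diff_Suc_1) simp
  \<comment> \<open>The summands come from the n linear factors, from the factor 1 / (1 - X_0), and
    from F.\<close>
  have "(?n choose 2) + ?n * m + (m choose 2) = (2 * ?n - 1) choose 2"
    by (induction m) (simp_all add: numeral_2_eq_2)
  then have Q: "q ^ ((2 * ?n - 1) choose 2) = q ^ (?n choose 2) * q ^ (?n * m) * q ^ (m choose 2)"
    by (simp only: power_add[symmetric])
  have T: "t ^ (3 * ?n - 1) = t ^ ?n * t ^ (2 * m + 1)"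
    unfolding power_add[symmetric] by (rule arg_cong[where f = "\<lambda>k. t ^ k"]) simp
  obtain l where l: "m = Suc l" using m by (cases m) auto
  have "(-1::complex) ^ l * (-1) ^ l = 1" by (simp flip: power_mult_distrib)
  then have sign: "(-1::complex) ^ ?n * - 1 * (-1) ^ (m - 1) = - 1" using l by simp
  have "Vn ?n (1 / q) (1 / t) = ((-1) ^ ?n * - 1 * (-1) ^ (m - 1))
      * (q ^ (?n choose 2) * q ^ (?n * m) * q ^ (m choose 2) * (t ^ ?n * t ^ (2 * m + 1))) * Vn ?n q t"
    unfolding V 1 2 3 by (simp only: ac_simps mult_minus_left mult_minus_right mult_1_left)
  also have "\<dots> = - (q ^ ((2 * ?n - 1) choose 2) * t ^ (3 * ?n - 1)) * Vn ?n q t"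
    unfolding sign Q T by simp
  finally show ?thesis .
qed

theorem theorem2p7:
  fixes n :: nat
  assumes "n \<ge> 2"
  shows "(\<forall>p::nat. prime p \<longrightarrow>
            (\<exists>\<sigma>0::real. \<forall>s::complex. Re s > \<sigma>0 \<longrightarrow>
               (\<lambda>k. of_nat (normal_index_count (Gn n) (p ^ k)) * (of_nat p powr (- s)) ^ k)
                 sums Vn n (of_nat p) (of_nat p powr (- s))))
       \<and> (\<forall>q t :: complex. Vn_defined n q t \<and> Vn_defined n (1 / q) (1 / t) \<longrightarrow>
            Vn n (1 / q) (1 / t) = - (q ^ ((2 * n - 1) choose 2) * t ^ (3 * n - 1)) * Vn n q t)"
proof -
  obtain m where n: "n = Suc m" and m: "m \<ge> 1" using assms by (cases n) auto
  have "\<exists>\<sigma>0::real. \<forall>s::complex. Re s > \<sigma>0 \<longrightarrow>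
      (\<lambda>k. of_nat (normal_index_count (Gn n) (p ^ k)) * (of_nat p powr (- s)) ^ k)
        sums Vn n (of_nat p) (of_nat p powr (- s))" if "prime p" for p :: nat
    using has_fps_expansion_imp_sums[OF Vn_has_fps_expansion[OF that m] prime_gt_1_nat[OF that]]
    by (simp add: n normal_index_count_eq)
  then show ?thesis using Vn_functional_equation[OF m] n by blast
qed

end
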